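(* For $2\le\alpha\le5$ let $\sigma_\alpha$ be the state on $\mathbb C^3\otimes\mathbb C^3$ $$\sigma_\alpha=\frac27\lvert\Phi\rangle\langle\Phi\rvert+\frac{\alpha}{21}\sum_{i=0}^{2}\lvert i,i{+}1\rangle\langle i,i{+}1\rvert+\frac{5-\alpha}{21}\sum_{i=0}^{2}\lvert i{+}1,i\rangle\langle i{+}1,i\rvert ,\qquad \lvert\Phi\rangle=\frac{\lvert00\rangle+\lvert11\rangle+\lvert22\rangle}{\sqrt3},$$ with indices modulo $3$. Let $(X,Y,Z)$ be the random variables with $X,Y\in\{0,1,2\}$, $P(X=x,Y=y)=\frac{2}{21},\frac{\alpha}{21},\frac{5-\alpha}{21}$ according to whether $y-x\equiv0,1,2\pmod3$, and $Z=\bot$ if $X=Y$, $Z=(X,Y)$ if $X\ne Y$. Then for every $3<\alpha\le5$ the key distillable from $\sigma_\alpha$ by local operations and two-way public communication satisfies $$K_D^{\leftrightarrow}(\sigma_\alpha)\ \ge\ S(X;Y\Vert Z)\ >\ 0 .$$ In particular, all the bound-entangled members of the family, $3<\alpha\le4$, have positive two-way distillable key.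
   Context: All alphabets are finite and logarithms are base two. $I(\cdot;\cdot)$ is mutual information, $H$ is Shannon entropy. It is known (Horodecki et al.) that $\sigma_\alpha$ is separable for $2\le\alpha\le3$, bound entangled (entangled, but no singlets can be distilled) for $3<\alpha\le4$, and distillable for $4<\alpha\le5$. Secret-key rate (classical). An $n$-copy protocol: Alice holds $X^n$, Bob holds $Y^n$, Eve holds $Z^n$, where $(X^n,Y^n,Z^n)$ are $n$ i.i.d. copies of $(X,Y,Z)$. Alice and Bob have private local randomness (independent of each other and of the source) and exchange an arbitrary finite number of rounds of public messages, each message being a function of the sender's data, the sender's private randomness and the previous messages; $F$ denotes the full public transcript. At the end Alice computes $K_A$ and Bob computes $K_B$, with values in a finite set $\mathcal K_n$, from their own data, randomness and $F$. A sequence of such protocols is admissible if, as $n\to\infty$, $\Pr[K_A=K_B]\to1$, $\log|\mathcal K_n|-H(K_A)\to0$, and $I(K_A;Z^n,F)\to0$; its rate is $\liminf_{n\to\infty}\frac1n\log|\mathcal K_n|$. $S(X;Y\Vert Z)$ is the supremum of the rates of admissible sequences. (The weak, strong, and trace-distance versions of the secrecy condition are known to give the same rate.) Distillable key (quantum). $K_D^{\leftrightarrow}(\sigma)$ is the optimal rate of secret key distillable from many copies of the bipartite state $\sigma_{AB}$ by local operations and two-way public classical communication, with Eve holding a purifying system. Precisely: let $\lvert\Psi\rangle_{ABE}$ be a purification of $\sigma$. Given $\Psi^{\otimes n}$, Alice and Bob perform finitely many rounds of local quantum operations and exchange of public classical messages (transcript $F$, a copy of which goes to Eve), and output classical $K_A,K_B$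 with values in a finite set $\mathcal K_n$. A sequence of such protocols is admissible if the trace distance between the final state $\rho_{K_AK_BE^nF}$ and $\frac1{|\mathcal K_n|}\sum_{k}\lvert kk\rangle\langle kk\rvert\otimes\rho_{E^nF}$ tends to $0$ as $n\to\infty$; its rate is $\liminf_{n}\frac1n\log|\mathcal K_n|$, and $K_D^{\leftrightarrow}(\sigma)$ is the supremum of the rates of admissible sequences (it does not depend on the choice of purification). *)

theory Defs
  imports "HOL-Probability.Probability"
begin

section \<open>Entropy and mutual information of discrete random variables\<close>

text \<open>The notions of the library in base two, for random variables \<open>X\<close>, \<open>Y\<close> on the discrete
  probability space given by \<open>p\<close>. On finitely supported \<open>p\<close> they are the usual finite sums, see
  \<open>shannon_entropy_finite\<close> and \<open>mutual_inf_finite\<close> below.\<close>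

definition shannon_entropy :: "'a pmf \<Rightarrow> ('a \<Rightarrow> 'b) \<Rightarrow> real" where
  "shannon_entropy p X = prob_space.entropy (measure_pmf p) 2 (count_space UNIV) X"

definition mutual_inf :: "'a pmf \<Rightarrow> ('a \<Rightarrow> 'b) \<Rightarrow> ('a \<Rightarrow> 'c) \<Rightarrow> real" where
  "mutual_inf p X Y =
     prob_space.mutual_information (measure_pmf p) 2 (count_space UNIV) (count_space UNIV) X Y"

lemma information_space_pmf: "information_space (measure_pmf p) 2"
  by (simp add: information_space_def information_space_axioms_def prob_space_measure_pmf)

lemma distributed_map_pmf:
  "distributed (measure_pmf p) (count_space UNIV) X (\<lambda>x. ennreal (pmf (map_pmf X p) x))"
  unfolding distributed_def
  by (simp add: map_pmf_rep_eq[symmetric] measure_pmf_eq_density[symmetric])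

lemma shannon_entropy_finite:
  fixes X :: "'a \<Rightarrow> 'b :: countable"
  assumes "finite (set_pmf p)"
  shows "shannon_entropy p X =
    - (\<Sum>x\<in>set_pmf (map_pmf X p). pmf (map_pmf X p) x * log 2 (pmf (map_pmf X p) x))"
proof -
  interpret information_space "measure_pmf p" 2 by (rule information_space_pmf)
  have "shannon_entropy p X = - (\<integral>x. pmf (map_pmf X p) x * log 2 (pmf (map_pmf X p) x) \<partial>count_space UNIV)"
    unfolding shannon_entropy_def by (rule entropy_distr[OF distributed_map_pmf]) simp
  also have "(\<integral>x. pmf (map_pmf X p) x * log 2 (pmf (map_pmf X p) x) \<partial>count_space UNIV) =
     (\<Sum>x\<in>set_pmf (map_pmf X p). pmf (map_pmf X p) x * log 2 (pmf (map_pmf X p) x))"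
  proof (subst lebesgue_integral_count_space_finite_support)
    have sub: "{x. pmf (map_pmf X p) x * log 2 (pmf (map_pmf X p) x) \<noteq> 0} \<subseteq> set_pmf (map_pmf X p)"
      by (auto simp: set_pmf_eq)
    show "finite {x\<in>UNIV. pmf (map_pmf X p) x * log 2 (pmf (map_pmf X p) x) \<noteq> 0}"
      using finite_subset[OF sub] assms by simp
    show "(\<Sum>x | x \<in> UNIV \<and> pmf (map_pmf X p) x * log 2 (pmf (map_pmf X p) x) \<noteq> 0.
        pmf (map_pmf X p) x * log 2 (pmf (map_pmf X p) x)) =
      (\<Sum>x\<in>set_pmf (map_pmf X p). pmf (map_pmf X p) x * log 2 (pmf (map_pmf X p) x))"
      using sub assms by (intro sum.mono_neutral_left) auto
  qed
  finally show ?thesis .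
qed

lemma mutual_inf_finite:
  fixes X :: "'a \<Rightarrow> 'b :: countable" and Y :: "'a \<Rightarrow> 'c :: countable"
  assumes fin: "finite (set_pmf p)"
  shows "mutual_inf p X Y =
    (\<Sum>(x, y)\<in>set_pmf (map_pmf (\<lambda>w. (X w, Y w)) p).
       pmf (map_pmf (\<lambda>w. (X w, Y w)) p) (x, y) *
       log 2 (pmf (map_pmf (\<lambda>w. (X w, Y w)) p) (x, y) / (pmf (map_pmf X p) x * pmf (map_pmf Y p) y)))"
    (is "_ = sum (\<lambda>(x, y). ?g x y) ?S")
proof -
  interpret information_space "measure_pmf p" 2 by (rule information_space_pmf)
  have cc: "count_space UNIV \<Otimes>\<^sub>M count_space UNIV = (count_space UNIV :: ('b \<times> 'c) measure)"
    by (simp add: pair_measure_countable)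
  have "mutual_inf p X Y = (\<integral>z. ?g (fst z) (snd z) \<partial>(count_space UNIV \<Otimes>\<^sub>M count_space UNIV))"
    unfolding mutual_inf_def prod.collapse
    by (rule mutual_information_distr[OF _ _ distributed_map_pmf _ distributed_map_pmf])
       (auto simp: cc distributed_map_pmf sigma_finite_measure_count_space)
  also have "\<dots> = (\<integral>z. (\<lambda>(x, y). ?g x y) z \<partial>count_space UNIV)"
    by (simp only: cc case_prod_beta)
  also have "\<dots> = sum (\<lambda>(x, y). ?g x y) ?S"
  proof (subst lebesgue_integral_count_space_finite_support)
    have sub: "{z. (\<lambda>(x, y). ?g x y) z \<noteq> 0} \<subseteq> ?S"
      by (auto simp del: set_map_pmf simp: set_pmf_iff)
    show "finite {z\<in>UNIV. (\<lambda>(x, y). ?g x y) z \<noteq> 0}"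
      using finite_subset[OF sub] fin by simp
    show "(\<Sum>z | z \<in> UNIV \<and> (\<lambda>(x, y). ?g x y) z \<noteq> 0. (\<lambda>(x, y). ?g x y) z) =
        sum (\<lambda>(x, y). ?g x y) ?S"
      using sub fin by (intro sum.mono_neutral_left) auto
  qed
  finally show ?thesis .
qed


section \<open>The classical secret-key rate\<close>

text \<open>Messages and keys are natural numbers and the key alphabet is \<open>{..<ckeys}\<close>. Private
  randomness is an arbitrary finitely supported distribution, so the set of reachable transcripts
  is finite. Alice and Bob alternate, Alice first; since messages may be constant this covers any
  order of speaking. Transcripts carry the latest message at their head.\<close>

record ('x, 'y) key_protocol =
  crounds :: nat
  ckeys :: nat
  rand_A :: "nat pmf"
  rand_B :: "nat pmf"
  msg_A :: "'x list \<Rightarrow> nat \<Rightarrow> nat list \<Rightarrow> nat"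
  msg_B :: "'y list \<Rightarrow> nat \<Rightarrow> nat list \<Rightarrow> nat"
  key_A :: "'x list \<Rightarrow> nat \<Rightarrow> nat list \<Rightarrow> nat"
  key_B :: "'y list \<Rightarrow> nat \<Rightarrow> nat list \<Rightarrow> nat"

definition valid_key_protocol :: "('x, 'y) key_protocol \<Rightarrow> bool" where
  "valid_key_protocol p \<longleftrightarrow>
     0 < ckeys p \<and> finite (set_pmf (rand_A p)) \<and> finite (set_pmf (rand_B p)) \<and>
     (\<forall>xs r t. key_A p xs r t < ckeys p) \<and> (\<forall>ys r t. key_B p ys r t < ckeys p)"

primrec transcript ::
    "('x, 'y) key_protocol \<Rightarrow> 'x list \<Rightarrow> nat \<Rightarrow> 'y list \<Rightarrow> nat \<Rightarrow> nat \<Rightarrow> nat list" where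
  "transcript p xs ra ys rb 0 = []"
| "transcript p xs ra ys rb (Suc k) =
     (let t = transcript p xs ra ys rb k
      in (if even k then msg_A p xs ra t else msg_B p ys rb t) # t)"

text \<open>Joint distribution of \<open>(K\<^sub>A, K\<^sub>B, Z\<^sup>n, F)\<close> for \<open>n\<close> copies of the source \<open>P\<close>.\<close>

definition run :: "('x \<times> 'y \<times> 'z) pmf \<Rightarrow> nat \<Rightarrow> ('x, 'y) key_protocol
    \<Rightarrow> (nat \<times> nat \<times> 'z list \<times> nat list) pmf" where
  "run P n p = do {
     w \<leftarrow> replicate_pmf n P;
     ra \<leftarrow> rand_A p;
     rb \<leftarrow> rand_B p;
     let xs = map (\<lambda>(x, y, z). x) w;
     let ys = map (\<lambda>(x, y, z). y) w;
     let zs = map (\<lambda>(x, y, z). z) w;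
     let f = transcript p xs ra ys rb (crounds p);
     return_pmf (key_A p xs ra f, key_B p ys rb f, zs, f)
   }"

definition admissible ::
    "('x \<times> 'y \<times> 'z::countable) pmf \<Rightarrow> (nat \<Rightarrow> ('x, 'y) key_protocol) \<Rightarrow> bool" where
  "admissible P p \<longleftrightarrow>
     (\<forall>n. valid_key_protocol (p n)) \<and>
     (\<lambda>n. measure_pmf.prob (run P n (p n)) {(ka, kb, zs, f). ka = kb}) \<longlonglongrightarrow> 1 \<and>
     (\<lambda>n. log 2 (real (ckeys (p n))) -
          shannon_entropy (run P n (p n)) (\<lambda>(ka, kb, zs, f). ka)) \<longlonglongrightarrow> 0 \<and>
     (\<lambda>n. mutual_inf (run P n (p n)) (\<lambda>(ka, kb, zs, f). ka) (\<lambda>(ka, kb, zs, f). (zs, f))) \<longlonglongrightarrow> 0"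

definition rate :: "(nat \<Rightarrow> nat) \<Rightarrow> ereal" where
  "rate M = liminf (\<lambda>n. ereal (log 2 (real (M n)) / real n))"

definition secret_key_rate :: "('x \<times> 'y \<times> 'z::countable) pmf \<Rightarrow> ereal" where
  "secret_key_rate P = (SUP p\<in>{p. admissible P p}. rate (\<lambda>n. ckeys (p n)))"


section \<open>Operators with labelled basis\<close>

text \<open>\<open>M i j\<close> is the matrix element \<open>\<langle>i|M|j\<rangle>\<close>. An operator on the space \<open>\<complex>\<^sup>I\<close> (for a finite
  set \<open>I\<close> of basis labels) is used only at arguments in \<open>I\<close>; an operator from \<open>\<complex>\<^sup>I\<close> to \<open>\<complex>\<^sup>J\<close>
  has its first argument in \<open>J\<close>.\<close>

type_synonym 'i op = "'i \<Rightarrow> 'i \<Rightarrow> complex"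

definition op_mult :: "'i set \<Rightarrow> 'i op \<Rightarrow> 'i op \<Rightarrow> 'i op" where
  "op_mult I M N = (\<lambda>i j. \<Sum>k\<in>I. M i k * N k j)"

definition op_adj :: "'i op \<Rightarrow> 'i op" where
  "op_adj M = (\<lambda>i j. cnj (M j i))"

definition op_trace :: "'i set \<Rightarrow> 'i op \<Rightarrow> complex" where
  "op_trace I M = (\<Sum>i\<in>I. M i i)"

definition op_positive :: "'i set \<Rightarrow> 'i op \<Rightarrow> bool" where
  "op_positive I M \<longleftrightarrow>
     (\<forall>v. let q = \<Sum>i\<in>I. \<Sum>j\<in>I. cnj (v i) * M i j * v j in Im q = 0 \<and> 0 \<le> Re q)"

text \<open>The positive square root; entries outside \<open>I\<close> are set to zero to make it unique as a function.\<close>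

definition op_sqrt :: "'i set \<Rightarrow> 'i op \<Rightarrow> 'i op" where
  "op_sqrt I M = (THE R. op_positive I R \<and> (\<forall>i j. i \<notin> I \<or> j \<notin> I \<longrightarrow> R i j = 0) \<and>
     (\<forall>i\<in>I. \<forall>j\<in>I. op_mult I R R i j = M i j))"

definition trace_norm :: "'i set \<Rightarrow> 'i op \<Rightarrow> real" where
  "trace_norm I M = Re (op_trace I (op_sqrt I (op_mult I (op_adj M) M)))"

definition trace_distance :: "'i set \<Rightarrow> 'i op \<Rightarrow> 'i op \<Rightarrow> real" where
  "trace_distance I M N = trace_norm I (\<lambda>i j. M i j - N i j) / 2"

definition ket :: "'i \<Rightarrow> 'i \<Rightarrow> complex" where
  "ket i = (\<lambda>j. if j = i then 1 else 0)"

definition proj :: "('i \<Rightarrow> complex) \<Rightarrow> 'i op" where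
  "proj v = (\<lambda>i j. v i * cnj (v j))"


section \<open>The two-way distillable key of a bipartite state\<close>

definition words :: "nat \<Rightarrow> nat \<Rightarrow> nat list set" where
  "words d n = {w. length w = n \<and> set w \<subseteq> {..<d}}"

definition purification ::
    "nat \<Rightarrow> nat \<Rightarrow> (nat \<times> nat) op \<Rightarrow> nat \<Rightarrow> (nat \<times> nat \<times> nat \<Rightarrow> complex) \<Rightarrow> bool" where
  "purification dA dB \<sigma> dE \<Psi> \<longleftrightarrow>
     (\<forall>a<dA. \<forall>b<dB. \<forall>a'<dA. \<forall>b'<dB.
        (\<Sum>e<dE. proj \<Psi> (a, b, e) (a', b', e)) = \<sigma> (a, b) (a', b'))"

text \<open>The \<open>n\<close>-fold tensor power of \<open>\<Psi>\<close>, with the tensor factors regrouped as \<open>A\<^sup>n B\<^sup>n E\<^sup>n\<close>.\<close>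

definition copies ::
    "nat \<Rightarrow> (nat \<times> nat \<times> nat \<Rightarrow> complex) \<Rightarrow> nat list \<times> nat list \<times> nat list \<Rightarrow> complex" where
  "copies n \<Psi> = (\<lambda>(as, bs, es). \<Prod>i<n. \<Psi> (as ! i, bs ! i, es ! i))"

text \<open>A quantum instrument on \<open>\<complex>\<^sup>S\<close> with outcomes \<open>m < M\<close>, given by Kraus operators
  \<open>K m j\<close>, \<open>j < J\<close>, from the space with basis labels \<open>S\<close> to the
  one with basis labels \<open>S' m\<close>. The outcome \<open>m\<close> is recorded, \<open>j\<close> is not.\<close>

definition instrument ::
    "'i set \<Rightarrow> (nat \<Rightarrow> 'i set) \<Rightarrow> nat \<Rightarrow> nat \<Rightarrow> (nat \<Rightarrow> nat \<Rightarrow> 'i op) \<Rightarrow> bool" where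
  "instrument S S' M J K \<longleftrightarrow>
     (\<forall>a\<in>S. \<forall>a'\<in>S. (\<Sum>m<M. \<Sum>j<J. \<Sum>c\<in>S' m. cnj (K m j c a) * K m j c a')
        = (if a = a' then 1 else 0))"

definition povm :: "'i set \<Rightarrow> nat \<Rightarrow> (nat \<Rightarrow> 'i op) \<Rightarrow> bool" where
  "povm S M E \<longleftrightarrow>
     (\<forall>k<M. op_positive S (E k)) \<and>
     (\<forall>a\<in>S. \<forall>a'\<in>S. (\<Sum>k<M. E k a a') = (if a = a' then 1 else 0))"

text \<open>As in the classical case Alice and Bob alternate, and the latest message is the head of the
  transcript. After transcript \<open>t\<close>, Alice's and Bob's local systems have the basis labels \<open>reg_A t\<close>
  and \<open>reg_B t\<close> (arbitrary finite sets, so that ancillas and local memory are included). The party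
  whose turn it is applies the instrument \<open>kraus t\<close>, whose outcome is the public message. At the
  end each party obtains the key from a measurement of the local system; \<open>meas_A t k\<close> is the
  effect of Alice's key value \<open>k\<close>.\<close>

record locc_protocol =
  qrounds :: nat
  qkeys :: nat
  qmsgs :: nat
  qkraus :: nat
  reg_A :: "nat list \<Rightarrow> nat list set"
  reg_B :: "nat list \<Rightarrow> nat list set"
  kraus :: "nat list \<Rightarrow> nat \<Rightarrow> nat \<Rightarrow> nat list op"
  meas_A :: "nat list \<Rightarrow> nat \<Rightarrow> nat list op"
  meas_B :: "nat list \<Rightarrow> nat \<Rightarrow> nat list op"

definition valid_locc :: "nat \<Rightarrow> nat \<Rightarrow> nat \<Rightarrow> locc_protocol \<Rightarrow> bool" where
  "valid_locc dA dB n p \<longleftrightarrow>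
     0 < qkeys p \<and> reg_A p [] = words dA n \<and> reg_B p [] = words dB n \<and>
     (\<forall>k\<le>qrounds p. \<forall>t\<in>words (qmsgs p) k. finite (reg_A p t) \<and> finite (reg_B p t)) \<and>
     (\<forall>k<qrounds p. \<forall>t\<in>words (qmsgs p) k.
        if even k
        then instrument (reg_A p t) (\<lambda>m. reg_A p (m # t)) (qmsgs p) (qkraus p) (kraus p t) \<and>
             (\<forall>m<qmsgs p. reg_B p (m # t) = reg_B p t)
        else instrument (reg_B p t) (\<lambda>m. reg_B p (m # t)) (qmsgs p) (qkraus p) (kraus p t) \<and>
             (\<forall>m<qmsgs p. reg_A p (m # t) = reg_A p t)) \<and>
     (\<forall>t\<in>words (qmsgs p) (qrounds p).
        povm (reg_A p t) (qkeys p) (meas_A p t) \<and> povm (reg_B p t) (qkeys p) (meas_B p t))"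

text \<open>The unnormalized state on \<open>A B E\<^sup>n\<close> after the given transcript; its trace is the probability
  of the transcript.\<close>

primrec post_state ::
    "locc_protocol \<Rightarrow> (nat list \<times> nat list \<times> nat list) op \<Rightarrow> nat list
     \<Rightarrow> (nat list \<times> nat list \<times> nat list) op" where
  "post_state p \<rho> [] = \<rho>"
| "post_state p \<rho> (m # t) =
     (if even (length t)
      then (\<lambda>(a, b, e) (a', b', e'). \<Sum>j<qkraus p. \<Sum>x\<in>reg_A p t. \<Sum>x'\<in>reg_A p t.
              kraus p t m j a x * post_state p \<rho> t (x, b, e) (x', b', e') *
              cnj (kraus p t m j a' x'))
      else (\<lambda>(a, b, e) (a', b', e'). \<Sum>j<qkraus p. \<Sum>y\<in>reg_B p t. \<Sum>y'\<in>reg_B p t.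
              kraus p t m j b y * post_state p \<rho> t (a, y, e) (a', y', e') *
              cnj (kraus p t m j b' y')))"

text \<open>Basis labels of \<open>K\<^sub>A K\<^sub>B E\<^sup>n F\<close>, the final state on this system, and the ideal state in which
  a uniform common key is independent of \<open>E\<^sup>n F\<close>.\<close>

definition final_basis :: "nat \<Rightarrow> nat \<Rightarrow> locc_protocol \<Rightarrow> (nat \<times> nat \<times> nat list \<times> nat list) set" where
  "final_basis dE n p =
     {..<qkeys p} \<times> {..<qkeys p} \<times> words dE n \<times> words (qmsgs p) (qrounds p)"

definition final_state :: "locc_protocol \<Rightarrow> (nat list \<times> nat list \<times> nat list) op
     \<Rightarrow> (nat \<times> nat \<times> nat list \<times> nat list) op" where
  "final_state p \<rho> = (\<lambda>(ka, kb, e, f) (ka', kb', e', f').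
     if ka = ka' \<and> kb = kb' \<and> f = f'
     then \<Sum>a\<in>reg_A p f. \<Sum>a'\<in>reg_A p f. \<Sum>b\<in>reg_B p f. \<Sum>b'\<in>reg_B p f.
            meas_A p f ka a' a * meas_B p f kb b' b * post_state p \<rho> f (a, b, e) (a', b', e')
     else 0)"

definition ideal_state :: "locc_protocol \<Rightarrow> (nat list \<times> nat list \<times> nat list) op
     \<Rightarrow> (nat \<times> nat \<times> nat list \<times> nat list) op" where
  "ideal_state p \<rho> = (\<lambda>(ka, kb, e, f) (ka', kb', e', f').
     (if ka = kb \<and> ka' = kb' \<and> ka = ka' then 1 / of_nat (qkeys p) else 0) *
     (\<Sum>k<qkeys p. \<Sum>l<qkeys p. final_state p \<rho> (k, l, e, f) (k, l, e', f')))"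

text \<open>Security is required against every purification, so no choice is made. Purifications of the
  same state differ by a partial isometry on Eve's system, which leaves the trace distance unchanged.\<close>

definition q_admissible :: "nat \<Rightarrow> nat \<Rightarrow> (nat \<times> nat) op \<Rightarrow> (nat \<Rightarrow> locc_protocol) \<Rightarrow> bool" where
  "q_admissible dA dB \<sigma> p \<longleftrightarrow>
     (\<forall>n. valid_locc dA dB n (p n)) \<and>
     (\<forall>dE \<Psi>. purification dA dB \<sigma> dE \<Psi> \<longrightarrow>
        (\<lambda>n. let \<rho> = proj (copies n \<Psi>) in
           trace_distance (final_basis dE n (p n)) (final_state (p n) \<rho>) (ideal_state (p n) \<rho>))
        \<longlonglongrightarrow> 0)"

definition distillable_key :: "nat \<Rightarrow> nat \<Rightarrow> (nat \<times> nat) op \<Rightarrow> ereal" where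
  "distillable_key dA dB \<sigma> = (SUP p\<in>{p. q_admissible dA dB \<sigma> p}. rate (\<lambda>n. qkeys (p n)))"


section \<open>The Horodecki states and the associated source\<close>

definition Phi3 :: "nat \<times> nat \<Rightarrow> complex" where
  "Phi3 = (\<lambda>x. (ket (0, 0) x + ket (1, 1) x + ket (2, 2) x) / complex_of_real (sqrt 3))"

definition horodecki_state :: "real \<Rightarrow> (nat \<times> nat) op" where
  "horodecki_state \<alpha> = (\<lambda>x y.
     complex_of_real (2 / 7) * proj Phi3 x y +
     complex_of_real (\<alpha> / 21) * (\<Sum>i<3. proj (ket (i, (i + 1) mod 3)) x y) +
     complex_of_real ((5 - \<alpha>) / 21) * (\<Sum>i<3. proj (ket ((i + 1) mod 3, i)) x y))"

definition xy_prob :: "real \<Rightarrow> nat \<times> nat \<Rightarrow> real" where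
  "xy_prob \<alpha> = (\<lambda>(x, y).
     if x < 3 \<and> y < 3 then
       (if (int y - int x) mod 3 = 0 then 2 / 21
        else if (int y - int x) mod 3 = 1 then \<alpha> / 21
        else (5 - \<alpha>) / 21)
     else 0)"

text \<open>The value \<open>None\<close> of \<open>Z\<close> plays the role of \<open>\<bottom>\<close>.\<close>

definition horodecki_source :: "real \<Rightarrow> (nat \<times> nat \<times> (nat \<times> nat) option) pmf" where
  "horodecki_source \<alpha> =
     map_pmf (\<lambda>(x, y). (x, y, if x = y then None else Some (x, y))) (embed_pmf (xy_prob \<alpha>))"

lemma pmf_xy:
  assumes "2 \<le> \<alpha>" "\<alpha> \<le> 5"
  shows "pmf (embed_pmf (xy_prob \<alpha>)) = xy_prob \<alpha>"
proof -
  have nonneg: "0 \<le> xy_prob \<alpha> z" for z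
    using assms by (auto simp: xy_prob_def split: prod.split)
  have three: "{..<3::nat} = {0, 1, 2}" by auto
  have "(\<integral>\<^sup>+z. ennreal (xy_prob \<alpha> z) \<partial>count_space UNIV) =
        (\<Sum>z\<in>{..<3} \<times> {..<3}. ennreal (xy_prob \<alpha> z))"
    by (rule nn_integral_count_space') (auto simp: xy_prob_def split: if_splits)
  also have "\<dots> = ennreal (\<Sum>z\<in>{..<3} \<times> {..<3}. xy_prob \<alpha> z)"
    by (intro sum_ennreal nonneg)
  also have "(\<Sum>z\<in>{..<3} \<times> {..<3}. xy_prob \<alpha> z) = 1"
    by (simp add: sum.cartesian_product[symmetric] three xy_prob_def field_simps)
  finally show ?thesis
    using nonneg by (intro ext pmf_embed_pmf) auto
qed

end

theory Submission
  imports Defs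
begin

text \<open>Positivity of the classical rate. Alice and Bob filter the source in three layers. Long constant
  blocks (repetition) make \<open>Y = X + 1\<close> dominant, but on these blocks Eve knows everything. Adding
  suitably many such symbols modulo 3 gives a total difference \<open>n - 1\<close> mainly when exactly one block
  has \<open>X = Y\<close>, and in this event Eve learns nothing about that block. Finally Alice and Bob keep only
  words of the form \<open>s\<^sup>M t\<^sup>M\<close> or \<open>t\<^sup>M s\<^sup>M\<close>, each standing for a bit. A bit is wrong with
  probability of order \<open>(w\<^sub>0 w\<^sub>2)\<^sup>M\<close> against \<open>w\<^sub>1\<^sup>2\<^sup>M\<close> for a correct one, where \<open>w\<^sub>k\<close> is the
  probability of the total difference \<open>n - k\<close>. These are roughly the weights of \<open>k\<close> blocks with
  \<open>X = Y\<close>, so \<open>w\<^sub>0 w\<^sub>2 / w\<^sub>1\<^sup>2\<close> is about \<open>1 / 2\<close>; blocks with \<open>Y = X + 2\<close> do not matter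
  because \<open>\<alpha> > 3\<close> makes \<open>5 - \<alpha> < 2\<close>. The errors are thus exponentially rarer than the
  bits secret from Eve, and one-way error correction and hashing by a greedily chosen colouring give a
  positive rate. Reliability and leakage are bounded together, by union and \<open>\<chi>\<^sup>2\<close> bounds.

  Comparison of the rates. Given any purification, Eve's vectors for distinct values of \<open>Z\<close> are
  orthogonal, and the one for \<open>Z = \<bottom>\<close> does not depend on the common value of \<open>X\<close> and \<open>Y\<close>. Hence,
  when Alice and Bob measure in the computational basis and run a classical protocol, the final state
  is diagonal in an orthogonal family with the joint law of keys, Eve's data and transcript as weights. The
  trace distance becomes a total variation distance, which is at most the error probability plus
  \<open>\<surd>(ln 2 (log K - H(K\<^sub>A) + I(K\<^sub>A; Z F)))\<close>.\<close>

section \<open>One-shot hashing\<close>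

text \<open>The classical half is steered by the criterion \<open>4 * acc * err < m\<^sup>2\<close>,
  where \<open>acc\<close> bounds the accepted mass, \<open>err\<close> the wrong accepted mass, and
  \<open>m\<close> bounds from below the mass on which both bits remain possible for Eve. Both sides
  have degree two, so a common factor cancels: a filter may accept extremely rarely, and only ratios
  of weights count. The number n of added symbols is confined to a window. Let x and y be the
  relative weights of Y = X and Y = X + 2 after repetition. For the weights of 0, 1, 2 blocks with X
  = Y to behave like 1, n x and (n x)^2 / 2, the product n x must be small, while n y must be
  negligible against (n x)^2. So n x has to lie well between y / x and 1, which is possible because
  y / x = ((5 - \<alpha>) / 2)^N becomes arbitrarily small with the length N of the repetition. In
  the quantum half the trace norm is defined through a square root given by description, so it can
  be evaluated only where that root is shown to be unique. This is done for operators presented by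
  an orthogonal family of vectors, which is all that the comparison produces.\<close>

lemma greedy_colouring:
  fixes g1 g2 :: "'a \<Rightarrow> 'a \<Rightarrow> real" and r K :: nat
  assumes "finite A" "0 < r" "0 < K"
  shows "\<exists>h1 h2. (\<forall>a. h1 a < r) \<and> (\<forall>a. h2 a < K) \<and>
    (\<Sum>a\<in>A. \<Sum>b\<in>A - {a}. (if h1 a = h1 b then g1 a b else 0) +
       (if h1 a = h1 b \<and> h2 a = h2 b then g2 a b else 0))
    \<le> (\<Sum>a\<in>A. \<Sum>b\<in>A - {a}. g1 a b / r + g2 a b / (r * K))"
  using assms(1)
proof (induction A rule: finite_induct)
  case empty
  then show ?case using assms(2,3) by (auto intro!: exI[of _ "\<lambda>_. 0"])
next
  case (insert z A)
  then obtain h1 h2 where h: "\<And>a. h1 a < r" "\<And>a. h2 a < K"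
    and le: "(\<Sum>a\<in>A. \<Sum>b\<in>A - {a}. (if h1 a = h1 b then g1 a b else 0) +
       (if h1 a = h1 b \<and> h2 a = h2 b then g2 a b else 0))
    \<le> (\<Sum>a\<in>A. \<Sum>b\<in>A - {a}. g1 a b / r + g2 a b / (r * K))" by blast
  \<comment> \<open>Random hashing, derandomised by averaging: under uniform colours a pair would
    collide in the first colour with probability 1 / r and in both with probability 1 / (r K). The
    old points keep their colours, and \<open>z\<close> receives a colour pair whose cost is at most
    the average over \<open>C\<close>. Both kinds of collision enter one cost, so a single choice
    serves both.\<close>
  define C where "C = {..<r} \<times> {..<K}"
  define s1 where "s1 b = g1 z b + g1 b z" for b
  define s2 where "s2 b = g2 z b + g2 b z" for b
  define cost where "cost c = (\<Sum>b\<in>A. (if fst c = h1 b then s1 b else 0) +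
       (if c = (h1 b, h2 b) then s2 b else 0))" for c
  have split: "(\<Sum>a\<in>insert z A. \<Sum>b\<in>insert z A - {a}. F a b) =
     (\<Sum>a\<in>A. \<Sum>b\<in>A - {a}. F a b) + (\<Sum>b\<in>A. F z b + F b z)" for F :: "'a \<Rightarrow> 'a \<Rightarrow> real"
  proof -
    have "(\<Sum>a\<in>A. \<Sum>b\<in>insert z A - {a}. F a b) = (\<Sum>a\<in>A. F a z + (\<Sum>b\<in>A - {a}. F a b))"
    proof (intro sum.cong refl)
      fix a assume "a \<in> A"
      then have "insert z A - {a} = insert z (A - {a})" using insert by auto
      then show "(\<Sum>b\<in>insert z A - {a}. F a b) = F a z + (\<Sum>b\<in>A - {a}. F a b)"
        using insert by simp
    qed
    moreover have "insert z A - {z} = A" using insert by auto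
    ultimately show ?thesis using insert by (simp add: sum.distrib)
  qed
  have cardC: "card C = r * K" by (simp add: C_def)
  have "(\<Sum>c\<in>C. cost c) = (\<Sum>b\<in>A. real K * s1 b + s2 b)"
  proof -
    have "(\<Sum>c\<in>C. cost c) = (\<Sum>b\<in>A. (\<Sum>c\<in>C. if fst c = h1 b then s1 b else 0) +
       (\<Sum>c\<in>C. if c = (h1 b, h2 b) then s2 b else 0))"
      unfolding cost_def by (subst sum.swap) (simp add: sum.distrib)
    also have "\<dots> = (\<Sum>b\<in>A. real K * s1 b + s2 b)"
    proof (intro sum.cong refl)
      fix b
      have "(\<Sum>c\<in>C. if fst c = h1 b then s1 b else 0) = (\<Sum>x<r. \<Sum>y<K. if x = h1 b then s1 b else 0)"
        unfolding C_def by (subst sum.cartesian_product) (auto intro!: sum.cong)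
      also have "\<dots> = (\<Sum>x<r. if x = h1 b then real K * s1 b else 0)" by (intro sum.cong) auto
      also have "\<dots> = real K * s1 b" using h by (simp add: sum.delta)
      finally have 1: "(\<Sum>c\<in>C. if fst c = h1 b then s1 b else 0) = real K * s1 b" .
      have "finite C" "(h1 b, h2 b) \<in> C" using h by (auto simp: C_def)
      then have "(\<Sum>c\<in>C. if c = (h1 b, h2 b) then s2 b else 0) = s2 b" by (simp add: sum.delta)
      with 1 show "(\<Sum>c\<in>C. if fst c = h1 b then s1 b else 0) +
         (\<Sum>c\<in>C. if c = (h1 b, h2 b) then s2 b else 0) = real K * s1 b + s2 b" by simp
    qed
    finally show ?thesis .
  qed
  also have "\<dots> = (\<Sum>c\<in>C. \<Sum>b\<in>A. s1 b / r + s2 b / (r * K))"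
  proof -
    have "real K * s1 b + s2 b = real (r * K) * (s1 b / r + s2 b / (r * K))" for b
      using assms(2,3) by (simp add: distrib_left)
    then show ?thesis by (simp add: cardC sum_distrib_left)
  qed
  finally have "(\<Sum>c\<in>C. cost c) = (\<Sum>c\<in>C. \<Sum>b\<in>A. s1 b / r + s2 b / (r * K))" .
  moreover have "finite C" "C \<noteq> {}" using assms by (auto simp: C_def)
  ultimately obtain c where c: "c \<in> C" "cost c \<le> (\<Sum>b\<in>A. s1 b / r + s2 b / (r * K))"
    using sum_strict_mono[of C "\<lambda>_. \<Sum>b\<in>A. s1 b / r + s2 b / (r * K)" cost] by force
  define h1' where "h1' = h1(z := fst c)"
  define h2' where "h2' = h2(z := snd c)"
  have ne: "b \<in> A \<Longrightarrow> b \<noteq> z" for b using insert by auto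
  have "(\<Sum>a\<in>A. \<Sum>b\<in>A - {a}. (if h1' a = h1' b then g1 a b else 0) +
       (if h1' a = h1' b \<and> h2' a = h2' b then g2 a b else 0)) =
      (\<Sum>a\<in>A. \<Sum>b\<in>A - {a}. (if h1 a = h1 b then g1 a b else 0) +
       (if h1 a = h1 b \<and> h2 a = h2 b then g2 a b else 0))"
    by (intro sum.cong refl) (auto simp: h1'_def h2'_def ne)
  moreover have "(\<Sum>b\<in>A. ((if h1' z = h1' b then g1 z b else 0) +
       (if h1' z = h1' b \<and> h2' z = h2' b then g2 z b else 0)) + ((if h1' b = h1' z then g1 b z else 0) +
       (if h1' b = h1' z \<and> h2' b = h2' z then g2 b z else 0))) = cost c"
    unfolding cost_def
    by (intro sum.cong refl) (auto simp: h1'_def h2'_def ne s1_def s2_def prod_eq_iff)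
  ultimately have "(\<Sum>a\<in>insert z A. \<Sum>b\<in>insert z A - {a}. (if h1' a = h1' b then g1 a b else 0) +
       (if h1' a = h1' b \<and> h2' a = h2' b then g2 a b else 0)) \<le>
     (\<Sum>a\<in>insert z A. \<Sum>b\<in>insert z A - {a}. g1 a b / r + g2 a b / (r * K))"
    unfolding split using le c(2) by (simp add: s1_def s2_def add_divide_distrib algebra_simps)
  moreover have "\<forall>a. h1' a < r" "\<forall>a. h2' a < K"
    using h c(1) by (auto simp: h1'_def h2'_def C_def)
  ultimately show ?case by blast
qed

section \<open>Expectations over finitely supported distributions\<close>

abbreviation expect :: "'a pmf \<Rightarrow> ('a \<Rightarrow> real) \<Rightarrow> real" where
  "expect p \<equiv> measure_pmf.expectation p"

abbreviation prob_of :: "'w pmf \<Rightarrow> ('w \<Rightarrow> 'a) \<Rightarrow> 'w \<Rightarrow> real" where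
  "prob_of W f w \<equiv> pmf (map_pmf f W) (f w)"

lemma expect_finite:
  "finite (set_pmf W) \<Longrightarrow> expect W f = (\<Sum>w\<in>set_pmf W. pmf W w * f w)"
  by (subst integral_measure_pmf_real[of "set_pmf W"]) (auto simp: set_pmf_iff mult.commute)

lemma integrable_finite_pmf: "finite (set_pmf W) \<Longrightarrow> integrable (measure_pmf W) (f :: _ \<Rightarrow> real)"
  by (rule integrable_measure_pmf_finite)

lemma expect_mono:
  assumes "finite (set_pmf W)" "\<And>w. w \<in> set_pmf W \<Longrightarrow> f w \<le> g w"
  shows "expect W f \<le> expect W g"
  using assms by (simp add: expect_finite sum_mono mult_left_mono)

lemma expect_cong:
  assumes "\<And>w. w \<in> set_pmf W \<Longrightarrow> f w = g w"
  shows "expect W f = expect W g"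
  using assms by (intro integral_cong_AE) (auto simp: AE_measure_pmf_iff)

lemma prob_of_pos: "w \<in> set_pmf W \<Longrightarrow> 0 < prob_of W f w"
  by (auto simp: pmf_positive_iff)

lemma pmf_map_sum:
  assumes "finite (set_pmf W)"
  shows "pmf (map_pmf f W) y = (\<Sum>w\<in>set_pmf W. if f w = y then pmf W w else 0)"
proof -
  have "pmf (map_pmf f W) y = expect W (\<lambda>w. indicator (f -` {y}) w)"
    by (simp add: pmf_map)
  also have "\<dots> = (\<Sum>w\<in>set_pmf W. pmf W w * indicator (f -` {y}) w)"
    by (rule expect_finite[OF assms])
  also have "\<dots> = (\<Sum>w\<in>set_pmf W. if f w = y then pmf W w else 0)"
    by (intro sum.cong refl) (simp add: indicator_def)
  finally show ?thesis .
qed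

lemma expect_comp:
  assumes "finite (set_pmf W)"
  shows "expect W (\<lambda>w. g (f w)) = (\<Sum>y\<in>f ` set_pmf W. pmf (map_pmf f W) y * g y)"
  using expect_finite[of "map_pmf f W" g] assms by simp

text \<open>Averaging against the law of \<open>f\<close> cancels the denominator and leaves the sum
  of \<open>g\<close> over the values that occur. If \<open>g\<close> consists of probability
  weights the bound is 1, which together with \<open>expect_log_le\<close> yields the nonnegativity
  of relative entropies.\<close>

lemma expect_inverse_prob_le:
  assumes fin: "finite (set_pmf W)" and D: "finite D" "f ` set_pmf W \<subseteq> D" and g: "\<And>y. y \<in> D \<Longrightarrow> 0 \<le> g y"
  shows "expect W (\<lambda>w. g (f w) / prob_of W f w) \<le> (\<Sum>y\<in>D. g y)"
proof -
  have "expect W (\<lambda>w. g (f w) / prob_of W f w) =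
     (\<Sum>y\<in>f ` set_pmf W. pmf (map_pmf f W) y * (g y / pmf (map_pmf f W) y))"
    by (rule expect_comp[OF fin, of "\<lambda>y. g y / pmf (map_pmf f W) y" f])
  also have "\<dots> = (\<Sum>y\<in>f ` set_pmf W. g y)"
  proof (intro sum.cong refl)
    fix y assume "y \<in> f ` set_pmf W"
    then have "0 < pmf (map_pmf f W) y" by (auto simp only: prob_of_pos)
    then show "pmf (map_pmf f W) y * (g y / pmf (map_pmf f W) y) = g y" by simp
  qed
  also have "\<dots> \<le> (\<Sum>y\<in>D. g y)" using D g by (intro sum_mono2) auto
  finally show ?thesis .
qed

text \<open>From ln t \<le> t - 1. Since the mean of \<open>t\<close> is kept, the same inequality
  also bounds a relative entropy by a \<chi>^2 distance.\<close>

lemma expect_log_le: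
  assumes "finite (set_pmf W)" "\<And>w. w \<in> set_pmf W \<Longrightarrow> 0 < t w"
  shows "expect W (\<lambda>w. log 2 (t w)) \<le> (expect W t - 1) / ln 2"
proof -
  have "expect W (\<lambda>w. log 2 (t w)) \<le> expect W (\<lambda>w. (t w - 1) / ln 2)"
    using assms by (intro expect_mono) (auto simp: log_def divide_right_mono ln_le_minus_one)
  also have "\<dots> = (expect W t - 1) / ln 2"
    using assms(1) by (simp add: integrable_finite_pmf)
  finally show ?thesis .
qed

text \<open>Maximum-weight decoding among the words with hash \<open>v\<close>. The weight need not
  be a likelihood; it only ranks the candidates.\<close>

definition decode :: "'a set \<Rightarrow> ('b \<Rightarrow> 'a \<Rightarrow> real) \<Rightarrow> ('a \<Rightarrow> nat) \<Rightarrow> 'b \<Rightarrow> nat \<Rightarrow> 'a" where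
  "decode S wt h b v = (SOME a. a \<in> S \<and> h a = v \<and> (\<forall>a'\<in>S. h a' = v \<longrightarrow> wt b a' \<le> wt b a))"

text \<open>A maximum exists because \<open>a\<close> itself is a candidate. Ties are charged as
  errors, hence the weak inequality.\<close>

lemma decode_neqD:
  assumes "finite S" "a \<in> S" "decode S wt h b (h a) \<noteq> a"
  shows "\<exists>a'\<in>S - {a}. h a' = h a \<and> wt b a \<le> wt b a'"
proof -
  let ?P = "\<lambda>a'. a' \<in> S \<and> h a' = h a \<and> (\<forall>x\<in>S. h x = h a \<longrightarrow> wt b x \<le> wt b a')"
  define M where "M = {x \<in> S. h x = h a}"
  have M: "finite (wt b ` M)" "wt b ` M \<noteq> {}" using assms(1,2) by (auto simp: M_def)
  then have "Max (wt b ` M) \<in> wt b ` M" by (rule Max_in)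
  then obtain y where y: "y \<in> M" "Max (wt b ` M) = wt b y" by auto
  have "wt b x \<le> wt b y" if "x \<in> M" for x using Max_ge[of "wt b ` M" "wt b x"] M that y by simp
  then have "?P y" using y by (auto simp: M_def)
  then have "?P (decode S wt h b (h a))" unfolding decode_def by (rule someI)
  then show ?thesis using assms(2,3) by (intro bexI[of _ "decode S wt h b (h a)"]) auto
qed

text \<open>A decoding error costs at most the sum of the ratios \<open>t1\<close> over competitors
  with the same \<open>h1\<close>, and the \<chi>^2 quantity expands into the posteriors
  \<open>t2\<close> of all words with the same pair of hashes. Both are sums over pairs of words, so
  one greedy colouring bounds their total; as both are nonnegative, each is below
  \<open>\<eta>\<close>.\<close>

lemma one_shot_hash:
  fixes W :: "'w pmf" and A :: "'w \<Rightarrow> 'a" and B :: "'w \<Rightarrow> 'b" and E :: "'w \<Rightarrow> 'e"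
    and wt :: "'b \<Rightarrow> 'a \<Rightarrow> real" and r K :: nat
  assumes fin: "finite (set_pmf W)" and S: "finite S" "A ` set_pmf W \<subseteq> S"
    and rK: "0 < r" "0 < K"
    and wt: "\<And>b a. 0 \<le> wt b a" "\<And>w. w \<in> set_pmf W \<Longrightarrow> 0 < wt (B w) (A w)"
    and eta: "\<eta> = expect W (\<lambda>w. \<Sum>a\<in>S. wt (B w) a / wt (B w) (A w)) / r +
      real (r * K) * expect W (\<lambda>w. prob_of W (\<lambda>w. (A w, E w)) w / prob_of W E w)"
  obtains h1 h2 :: "'a \<Rightarrow> nat" where "\<And>a. h1 a < r" "\<And>a. h2 a < K"
    "measure_pmf.prob W {w. decode S wt h1 (B w) (h1 (A w)) \<noteq> A w} \<le> \<eta>"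
    "expect W (\<lambda>w. real (r * K) * prob_of W (\<lambda>w. (h2 (A w), h1 (A w), E w)) w / prob_of W E w) - 1 \<le> \<eta>"
proof -
  define q where "q a e = pmf (map_pmf (\<lambda>w. (A w, E w)) W) (a, e)" for a e
  define t1 where "t1 w a = wt (B w) a / wt (B w) (A w)" for w a
  define t2 where "t2 w a = q a (E w) / prob_of W E w" for w a
  \<comment> \<open>Outcomes are grouped by the value of \<open>A\<close>, so that a cost depending
    on an outcome and a competitor becomes a cost of a pair of words; \<open>swap\<close> undoes
    this.\<close>
  define lift where "lift t a b = (\<Sum>w\<in>set_pmf W. if A w = a then pmf W w * t w b else 0)"
    for t :: "'w \<Rightarrow> 'a \<Rightarrow> real" and a b
  define k where "k = real (r * K)"
  have k: "0 < k" using rK by (simp add: k_def)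
  have pE: "0 < prob_of W E w" if "w \<in> set_pmf W" for w using that by (rule prob_of_pos)
  have AS: "A w \<in> S" if "w \<in> set_pmf W" for w using S that by auto
  have swap: "(\<Sum>a\<in>S. \<Sum>b\<in>S - {a}. c a b * lift t a b) =
      expect W (\<lambda>w. \<Sum>b\<in>S - {A w}. c (A w) b * t w b)" for c :: "'a \<Rightarrow> 'a \<Rightarrow> real" and t
  proof -
    have "(\<Sum>a\<in>S. \<Sum>b\<in>S - {a}. c a b * lift t a b) =
       (\<Sum>a\<in>S. \<Sum>w\<in>set_pmf W. if a = A w then pmf W w * (\<Sum>b\<in>S - {a}. c a b * t w b) else 0)"
    proof (intro sum.cong refl)
      fix a
      have "(\<Sum>b\<in>S - {a}. c a b * lift t a b) =
        (\<Sum>w\<in>set_pmf W. \<Sum>b\<in>S - {a}. c a b * (if A w = a then pmf W w * t w b else 0))"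
        unfolding lift_def sum_distrib_left by (rule sum.swap)
      also have "\<dots> = (\<Sum>w\<in>set_pmf W. if a = A w then pmf W w * (\<Sum>b\<in>S - {a}. c a b * t w b) else 0)"
        by (intro sum.cong refl) (auto simp: sum_distrib_left intro!: sum.cong)
      finally show "(\<Sum>b\<in>S - {a}. c a b * lift t a b) =
        (\<Sum>w\<in>set_pmf W. if a = A w then pmf W w * (\<Sum>b\<in>S - {a}. c a b * t w b) else 0)" .
    qed
    also have "\<dots> = (\<Sum>w\<in>set_pmf W. \<Sum>a\<in>S. if a = A w then pmf W w * (\<Sum>b\<in>S - {a}. c a b * t w b) else 0)"
      by (rule sum.swap)
    also have "\<dots> = (\<Sum>w\<in>set_pmf W. pmf W w * (\<Sum>b\<in>S - {A w}. c (A w) b * t w b))"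
      by (intro sum.cong refl) (use S AS in \<open>simp add: sum.delta\<close>)
    finally show ?thesis by (simp add: expect_finite[OF fin])
  qed
  obtain h1 h2 where h: "\<forall>a. h1 a < r" "\<forall>a. h2 a < K"
    and col: "(\<Sum>a\<in>S. \<Sum>b\<in>S - {a}. (if h1 a = h1 b then lift t1 a b else 0) +
       (if h1 a = h1 b \<and> h2 a = h2 b then k * lift t2 a b else 0))
    \<le> (\<Sum>a\<in>S. \<Sum>b\<in>S - {a}. lift t1 a b / r + k * lift t2 a b / (r * K))"
    using greedy_colouring[OF S(1) rK, of "lift t1" "\<lambda>a b. k * lift t2 a b"] by blast
  define c1 :: "'a \<Rightarrow> 'a \<Rightarrow> real" where "c1 a b = of_bool (h1 a = h1 b)" for a b
  define c2 :: "'a \<Rightarrow> 'a \<Rightarrow> real" where "c2 a b = of_bool (h1 a = h1 b \<and> h2 a = h2 b)" for a b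
  have c2_refl: "c2 a a = 1" for a by (simp add: c2_def)
  define X1 where "X1 = expect W (\<lambda>w. \<Sum>b\<in>S - {A w}. c1 (A w) b * t1 w b)"
  define X2 where "X2 = expect W (\<lambda>w. \<Sum>b\<in>S - {A w}. c2 (A w) b * t2 w b)"
  define Y1 where "Y1 = expect W (\<lambda>w. \<Sum>b\<in>S - {A w}. 1 * t1 w b)"
  define Y2 where "Y2 = expect W (\<lambda>w. \<Sum>b\<in>S - {A w}. 1 * t2 w b)"
  define nu where "nu = expect W (\<lambda>w. \<Sum>a\<in>S. t1 w a)"
  define kappa where "kappa = expect W (\<lambda>w. t2 w (A w))"
  have "(\<Sum>a\<in>S. \<Sum>b\<in>S - {a}. (if h1 a = h1 b then lift t1 a b else 0) +
       (if h1 a = h1 b \<and> h2 a = h2 b then k * lift t2 a b else 0)) =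
     (\<Sum>a\<in>S. \<Sum>b\<in>S - {a}. c1 a b * lift t1 a b) + k * (\<Sum>a\<in>S. \<Sum>b\<in>S - {a}. c2 a b * lift t2 a b)"
    unfolding sum_distrib_left sum.distrib[symmetric]
    by (intro sum.cong refl) (simp add: c1_def c2_def)
  also have "\<dots> = X1 + k * X2" unfolding swap X1_def X2_def by simp
  finally have lhs: "(\<Sum>a\<in>S. \<Sum>b\<in>S - {a}. (if h1 a = h1 b then lift t1 a b else 0) +
       (if h1 a = h1 b \<and> h2 a = h2 b then k * lift t2 a b else 0)) = X1 + k * X2" .
  have "(\<Sum>a\<in>S. \<Sum>b\<in>S - {a}. lift t1 a b / r + k * lift t2 a b / (r * K)) =
     (\<Sum>a\<in>S. \<Sum>b\<in>S - {a}. 1 * lift t1 a b) / r + (\<Sum>a\<in>S. \<Sum>b\<in>S - {a}. 1 * lift t2 a b)"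
    unfolding sum_divide_distrib sum.distrib[symmetric]
    using rK by (intro sum.cong refl) (simp add: k_def)
  also have "\<dots> = Y1 / r + Y2"
    using swap[of "\<lambda>_ _. 1" t1] swap[of "\<lambda>_ _. 1" t2] unfolding Y1_def Y2_def by simp
  finally have XY: "X1 + k * X2 \<le> Y1 / r + Y2" using col lhs by simp
  have t1: "0 \<le> t1 w a" for w a by (simp add: t1_def wt)
  have "Y1 \<le> nu" unfolding Y1_def nu_def
    using S(1) t1 by (intro expect_mono fin) (auto intro!: sum_mono2)
  then have Y1: "Y1 / r \<le> nu / r" by (simp add: divide_right_mono)
  have qsum: "(\<Sum>a\<in>S. c a * q a e) = (\<Sum>w\<in>set_pmf W. if E w = e then c (A w) * pmf W w else 0)"
    for c :: "'a \<Rightarrow> real" and e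
  proof -
    have "(\<Sum>a\<in>S. c a * q a e) =
      (\<Sum>w\<in>set_pmf W. \<Sum>a\<in>S. if a = A w then (if E w = e then c a * pmf W w else 0) else 0)"
      unfolding q_def pmf_map_sum[OF fin] sum_distrib_left
      by (subst sum.swap) (auto intro!: sum.cong)
    also have "\<dots> = (\<Sum>w\<in>set_pmf W. if E w = e then c (A w) * pmf W w else 0)"
      by (intro sum.cong refl) (use S AS in \<open>simp add: sum.delta\<close>)
    finally show ?thesis .
  qed
  have t2sum: "(\<Sum>a\<in>S. t2 w a) = 1" if w: "w \<in> set_pmf W" for w
  proof -
    have "(\<Sum>a\<in>S. q a (E w)) = prob_of W E w"
      using qsum[of "\<lambda>_. 1" "E w"] by (simp add: pmf_map_sum[OF fin] cong: if_cong)
    then show ?thesis using pE[OF w] by (simp add: t2_def sum_divide_distrib[symmetric])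
  qed
  \<comment> \<open>The posteriors of all words sum to 1, so off the diagonal 1 -
    \<open>kappa\<close> remains. This cancels against the 1 that is subtracted in
    \<open>chi\<close>.\<close>
  have Y2: "Y2 = 1 - kappa"
  proof -
    have "Y2 = expect W (\<lambda>w. 1 - t2 w (A w))" unfolding Y2_def
      using S AS t2sum by (intro expect_cong) (simp add: sum_diff1)
    then show ?thesis using fin by (simp add: kappa_def integrable_finite_pmf)
  qed
  have chi: "expect W (\<lambda>w. k * prob_of W (\<lambda>w. (h2 (A w), h1 (A w), E w)) w / prob_of W E w) = k * (kappa + X2)"
  proof -
    have "k * prob_of W (\<lambda>w. (h2 (A w), h1 (A w), E w)) w / prob_of W E w =
       k * (t2 w (A w) + (\<Sum>b\<in>S - {A w}. c2 (A w) b * t2 w b))" if w: "w \<in> set_pmf W" for w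
    proof -
      have "prob_of W (\<lambda>w. (h2 (A w), h1 (A w), E w)) w = (\<Sum>a\<in>S. c2 (A w) a * q a (E w))"
        unfolding qsum pmf_map_sum[OF fin] by (intro sum.cong refl) (auto simp: c2_def)
      also have "\<dots> = q (A w) (E w) + (\<Sum>b\<in>S - {A w}. c2 (A w) b * q b (E w))"
        by (subst sum.remove[OF S(1) AS[OF w]]) (simp add: c2_refl)
      finally have eq: "prob_of W (\<lambda>w. (h2 (A w), h1 (A w), E w)) w =
        q (A w) (E w) + (\<Sum>b\<in>S - {A w}. c2 (A w) b * q b (E w))" .
      have "(\<Sum>b\<in>S - {A w}. c2 (A w) b * t2 w b) = (\<Sum>b\<in>S - {A w}. c2 (A w) b * q b (E w)) / prob_of W E w"
        unfolding t2_def sum_divide_distrib by simp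
      then show ?thesis unfolding eq t2_def[of w "A w"] by (simp only: add_divide_distrib distrib_left times_divide_eq_right)
    qed
    then have "expect W (\<lambda>w. k * prob_of W (\<lambda>w. (h2 (A w), h1 (A w), E w)) w / prob_of W E w) =
      expect W (\<lambda>w. k * (t2 w (A w) + (\<Sum>b\<in>S - {A w}. c2 (A w) b * t2 w b)))"
      by (intro expect_cong)
    then show ?thesis using fin by (simp add: kappa_def X2_def integrable_finite_pmf)
  qed
  define P where "P = measure_pmf.prob W {w. decode S wt h1 (B w) (h1 (A w)) \<noteq> A w}"
  have P: "P \<le> X1"
  proof -
    have "P = expect W (indicator {w. decode S wt h1 (B w) (h1 (A w)) \<noteq> A w})" by (simp add: P_def)
    also have "\<dots> \<le> X1" unfolding X1_def
    proof (intro expect_mono fin)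
      fix w assume w: "w \<in> set_pmf W"
      show "indicator {w. decode S wt h1 (B w) (h1 (A w)) \<noteq> A w} w \<le> (\<Sum>b\<in>S - {A w}. c1 (A w) b * t1 w b)"
      proof (cases "decode S wt h1 (B w) (h1 (A w)) = A w")
        case True
        have "0 \<le> (\<Sum>b\<in>S - {A w}. c1 (A w) b * t1 w b)"
          by (intro sum_nonneg mult_nonneg_nonneg t1) (simp add: c1_def)
        moreover have "indicator {w. decode S wt h1 (B w) (h1 (A w)) \<noteq> A w} w = (0 :: real)"
          using True by (intro indicator_simps(2)) blast
        ultimately show ?thesis by (simp only:)
      next
        case False
        obtain a where a: "a \<in> S - {A w}" "h1 a = h1 (A w)" "wt (B w) (A w) \<le> wt (B w) a"
          using decode_neqD[OF S(1) AS[OF w] False] by (elim bexE conjE)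
        have "1 \<le> c1 (A w) a * t1 w a" using a wt(2)[OF w] by (simp add: c1_def t1_def)
        also have "\<dots> \<le> (\<Sum>b\<in>S - {A w}. c1 (A w) b * t1 w b)"
          using a(1) S(1) by (intro member_le_sum) (auto simp: t1 c1_def)
        finally show ?thesis by (rule order_trans[OF indicator_le_1])
      qed
    qed
    finally show ?thesis .
  qed
  define chi where "chi = k * (kappa + X2) - 1"
  have "0 \<le> chi"
  proof -
    let ?f = "\<lambda>w. (h2 (A w), h1 (A w), E w)"
    let ?x = "\<lambda>w. k * prob_of W ?f w / prob_of W E w"
    let ?G = "\<lambda>y. pmf (map_pmf E W) (snd (snd y)) / k"
    let ?Q = "\<lambda>w. ?G (?f w) / prob_of W ?f w"
    have "expect W ?Q \<le> (\<Sum>y\<in>{..<K} \<times> {..<r} \<times> E ` set_pmf W. ?G y)"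
      using fin h k by (intro expect_inverse_prob_le[of W _ ?f ?G]) auto
    also have "\<dots> = (\<Sum>x<K. \<Sum>y<r. (\<Sum>e\<in>E ` set_pmf W. pmf (map_pmf E W) e) / k)"
      by (simp add: sum.cartesian_product' sum_divide_distrib)
    also have "\<dots> = 1"
      using fin rK sum_pmf_eq_1[of "E ` set_pmf W" "map_pmf E W"] by (simp add: k_def)
    finally have le: "expect W ?Q \<le> 1" .
    have "1 \<le> 2 - expect W ?Q" using le by simp
    also have "\<dots> = expect W (\<lambda>w. 2 - ?Q w)"
      using fin by (simp add: integrable_finite_pmf)
    also have "\<dots> \<le> expect W ?x"
    proof (intro expect_mono fin)
      fix w assume w: "w \<in> set_pmf W"
      have x: "0 < ?x w" using k pE[OF w] prob_of_pos[OF w, of ?f] by simp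
      have Q: "?Q w = 1 / ?x w" using k by simp
      have two: "2 \<le> y + 1 / y" if "0 < y" for y :: real
      proof -
        have "0 \<le> (y - 1)\<^sup>2 / y" using that by simp
        also have "\<dots> = y + 1 / y - 2" using that by (simp add: power2_eq_square field_simps)
        finally show ?thesis by simp
      qed
      show "2 - ?Q w \<le> ?x w" using two[OF x] unfolding Q by linarith
    qed
    finally show ?thesis using chi by (simp add: chi_def)
  qed
  moreover have "0 \<le> P" by (simp add: P_def)
  moreover have "P + chi \<le> \<eta>"
  proof -
    have "P + chi \<le> nu / r + (1 - kappa) + k * kappa - 1"
      using P XY Y1 Y2 by (simp add: chi_def distrib_left)
    moreover have "0 \<le> kappa" unfolding kappa_def t2_def q_def
      by (intro Bochner_Integration.integral_nonneg) simp
    ultimately have "P + chi \<le> nu / r + k * kappa" by simp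
    then show ?thesis by (simp add: eta nu_def kappa_def t1_def t2_def q_def k_def)
  qed
  ultimately have "P \<le> \<eta>" "chi \<le> \<eta>" by auto
  then show ?thesis
    using h chi by (intro that[of h1 h2]) (simp_all only: P_def chi_def k_def simp_thms)
qed

section \<open>Entropy and leakage\<close>

text \<open>The probability of the fibre through \<open>w\<close> depends only on the partition of
  the support, so a view may be replaced by any equivalent encoding of it.\<close>

lemma prob_of_cong:
  assumes "finite (set_pmf W)" "\<And>w'. w' \<in> set_pmf W \<Longrightarrow> f w' = f w \<longleftrightarrow> g w' = g w"
  shows "prob_of W f w = prob_of W g w"
  using assms by (simp add: pmf_map_sum cong: sum.cong)

lemma shannon_entropy_expect:
  fixes X :: "'w \<Rightarrow> 'b :: countable"
  assumes "finite (set_pmf R)"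
  shows "shannon_entropy R X = expect R (\<lambda>w. - log 2 (prob_of R X w))"
  unfolding shannon_entropy_finite[OF assms]
  by (simp add: expect_comp[OF assms, where g = "\<lambda>x. log 2 (pmf (map_pmf X R) x)"] integrable_finite_pmf[OF assms])

lemma mutual_inf_expect:
  fixes X :: "'w \<Rightarrow> 'b :: countable" and Y :: "'w \<Rightarrow> 'c :: countable"
  assumes "finite (set_pmf R)"
  shows "mutual_inf R X Y = expect R (\<lambda>w. log 2 (prob_of R (\<lambda>w. (X w, Y w)) w / (prob_of R X w * prob_of R Y w)))"
proof -
  let ?g = "\<lambda>(x, y). log 2 (pmf (map_pmf (\<lambda>w. (X w, Y w)) R) (x, y) / (pmf (map_pmf X R) x * pmf (map_pmf Y R) y))"
  show ?thesis
    unfolding mutual_inf_finite[OF assms]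
    using expect_comp[OF assms, of ?g "\<lambda>w. (X w, Y w)"] by (simp add: case_prod_unfold)
qed

locale key_view =
  fixes R :: "'w pmf" and X :: "'w \<Rightarrow> nat" and Y :: "'w \<Rightarrow> 'c :: countable" and K :: nat
  assumes fin: "finite (set_pmf R)" and X: "\<And>w. w \<in> set_pmf R \<Longrightarrow> X w < K"
begin

lemma K_pos: "0 < K"
proof -
  obtain w where "w \<in> set_pmf R" using set_pmf_not_empty[of R] by blast
  then show ?thesis using X by fastforce
qed

lemma entropy_le_log: "shannon_entropy R X \<le> log 2 K"
proof -
  have "shannon_entropy R X - log 2 K = expect R (\<lambda>w. log 2 ((1 / K) / prob_of R X w))"
  proof -
    have "expect R (\<lambda>w. log 2 ((1 / K) / prob_of R X w)) = expect R (\<lambda>w. - log 2 (prob_of R X w) - log 2 K)"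
      using K_pos by (intro expect_cong) (use prob_of_pos[of _ R X] in \<open>force simp: log_divide log_mult\<close>)
    then show ?thesis using fin by (simp add: shannon_entropy_expect integrable_finite_pmf)
  qed
  also have "\<dots> \<le> (expect R (\<lambda>w. (1 / K) / prob_of R X w) - 1) / ln 2"
    using K_pos by (intro expect_log_le fin divide_pos_pos prob_of_pos) simp_all
  also have "expect R (\<lambda>w. (1 / K) / prob_of R X w) \<le> (\<Sum>y<K. 1 / K)"
    using fin X by (intro expect_inverse_prob_le[where g = "\<lambda>_. 1 / real K"]) auto
  then have "(expect R (\<lambda>w. (1 / K) / prob_of R X w) - 1) / ln 2 \<le> 0"
    using K_pos by (simp add: divide_nonpos_pos)
  finally show ?thesis by simp
qed

lemma mutual_inf_nonneg: "0 \<le> mutual_inf R X Y"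
proof -
  let ?p = "\<lambda>w. prob_of R (\<lambda>w. (X w, Y w)) w"
  let ?g = "\<lambda>(x, y). pmf (map_pmf X R) x * pmf (map_pmf Y R) y"
  let ?t = "\<lambda>w. ?g (X w, Y w) / ?p w"
  have pos: "0 < ?p w" "0 < prob_of R X w" "0 < prob_of R Y w" if "w \<in> set_pmf R" for w
    using that by (auto intro!: prob_of_pos)
  have "- mutual_inf R X Y = expect R (\<lambda>w. - log 2 (?p w / (prob_of R X w * prob_of R Y w)))"
    using fin by (simp add: mutual_inf_expect)
  also have "\<dots> = expect R (\<lambda>w. log 2 (?t w))"
    by (intro expect_cong) (use pos in \<open>force simp: log_divide log_mult\<close>)
  also have "\<dots> \<le> (expect R ?t - 1) / ln 2"
    using pos by (intro expect_log_le fin) simp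
  also have "expect R ?t \<le> (\<Sum>z\<in>X ` set_pmf R \<times> Y ` set_pmf R. ?g z)"
    using fin by (intro expect_inverse_prob_le[of R _ "\<lambda>w. (X w, Y w)" ?g]) auto
  also have "(\<Sum>z\<in>X ` set_pmf R \<times> Y ` set_pmf R. ?g z) = 1"
    using fin by (simp add: sum.cartesian_product[symmetric] sum_product[symmetric] sum_pmf_eq_1)
  finally show ?thesis by (simp add: divide_right_mono)
qed

text \<open>The two defects that \<open>admissible\<close> requires to vanish add up to the relative
  entropy of the law of (X, Y) from a uniform key independent of Y. By \<open>entropy_le_log\<close>
  and \<open>mutual_inf_nonneg\<close> both are nonnegative, so it is enough to control this one
  number.\<close>

lemma gap_eq:
  "log 2 K - shannon_entropy R X + mutual_inf R X Y =
     expect R (\<lambda>w. log 2 (K * prob_of R (\<lambda>w. (X w, Y w)) w / prob_of R Y w))"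
proof -
  let ?p = "\<lambda>w. prob_of R (\<lambda>w. (X w, Y w)) w"
  have pos: "0 < ?p w" "0 < prob_of R X w" "0 < prob_of R Y w" if "w \<in> set_pmf R" for w
    using that by (auto intro!: prob_of_pos)
  have "expect R (\<lambda>w. log 2 (K * ?p w / prob_of R Y w)) =
    expect R (\<lambda>w. log 2 K - - log 2 (prob_of R X w) + log 2 (?p w / (prob_of R X w * prob_of R Y w)))"
    using K_pos by (intro expect_cong) (use pos in \<open>force simp: log_divide log_mult\<close>)
  also have "\<dots> = log 2 K - shannon_entropy R X + mutual_inf R X Y"
    unfolding shannon_entropy_expect[OF fin] mutual_inf_expect[OF fin]
    by (simp add: integrable_finite_pmf[OF fin] del: minus_diff_eq)
  finally show ?thesis ..
qed

text \<open>Here \<open>V\<close> is the published hash and \<open>E\<close> the rest of Eve's view.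
  Replacing the law of \<open>Y\<close> by a uniform \<open>V\<close> independent of
  \<open>E\<close> can only increase the relative entropy, since the difference is a relative
  entropy again; the result is at most the \<chi>^2 distance divided by ln 2.\<close>

lemma gap_le_chi:
  assumes V: "\<And>w. w \<in> set_pmf R \<Longrightarrow> V w < r"
    and YVE: "\<And>w w'. w \<in> set_pmf R \<Longrightarrow> w' \<in> set_pmf R \<Longrightarrow> Y w = Y w' \<longleftrightarrow> V w = V w' \<and> E w = E w'"
  shows "log 2 K - shannon_entropy R X + mutual_inf R X Y \<le>
    (expect R (\<lambda>w. real (r * K) * prob_of R (\<lambda>w. (X w, V w :: nat, E w)) w / prob_of R E w) - 1) / ln 2"
proof -
  let ?p = "\<lambda>w. prob_of R (\<lambda>w. (X w, V w, E w)) w"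
  let ?y = "\<lambda>w. prob_of R (\<lambda>w. (V w, E w)) w"
  obtain w0 where w0: "w0 \<in> set_pmf R" using set_pmf_not_empty[of R] by blast
  have r: "0 < r" using V[OF w0] by simp
  have pos: "0 < ?p w" "0 < prob_of R E w" "0 < ?y w" if "w \<in> set_pmf R" for w
    using that by (auto intro!: prob_of_pos)
  have "log 2 K - shannon_entropy R X + mutual_inf R X Y =
     expect R (\<lambda>w. log 2 (K * ?p w / ?y w))"
    unfolding gap_eq
  proof (intro expect_cong)
    fix w assume w: "w \<in> set_pmf R"
    have "prob_of R (\<lambda>w. (X w, Y w)) w = ?p w" "prob_of R Y w = ?y w"
      using YVE[OF _ w] by (auto intro!: prob_of_cong[OF fin])
    then show "log 2 (K * prob_of R (\<lambda>w. (X w, Y w)) w / prob_of R Y w) = log 2 (K * ?p w / ?y w)" by simp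
  qed
  also have "\<dots> = expect R (\<lambda>w. log 2 (real (r * K) * ?p w / prob_of R E w)) + expect R (\<lambda>w. log 2 ((prob_of R E w / r) / ?y w))"
  proof -
    have "expect R (\<lambda>w. log 2 (K * ?p w / ?y w)) = expect R (\<lambda>w. log 2 (real (r * K) * ?p w / prob_of R E w) + log 2 ((prob_of R E w / r) / ?y w))"
      using K_pos r by (intro expect_cong) (use pos in \<open>force simp: log_divide log_mult\<close>)
    then show ?thesis using fin by (simp add: integrable_finite_pmf)
  qed
  also have "\<dots> \<le> (expect R (\<lambda>w. real (r * K) * ?p w / prob_of R E w) - 1) / ln 2 + 0"
  proof (rule add_mono)
    show "expect R (\<lambda>w. log 2 (real (r * K) * ?p w / prob_of R E w)) \<le> (expect R (\<lambda>w. real (r * K) * ?p w / prob_of R E w) - 1) / ln 2"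
      using pos K_pos r by (intro expect_log_le fin) simp
    have "expect R (\<lambda>w. log 2 ((prob_of R E w / r) / ?y w)) \<le> (expect R (\<lambda>w. (prob_of R E w / r) / ?y w) - 1) / ln 2"
      using pos r by (intro expect_log_le fin) simp
    also have "expect R (\<lambda>w. (prob_of R E w / r) / ?y w) \<le> (\<Sum>z\<in>{..<r} \<times> E ` set_pmf R. pmf (map_pmf E R) (snd z) / r)"
      using fin V expect_inverse_prob_le[of R "{..<r} \<times> E ` set_pmf R" "\<lambda>w. (V w, E w)" "\<lambda>z. pmf (map_pmf E R) (snd z) / r"]
      by auto
    also have "\<dots> = 1"
      using fin r sum_pmf_eq_1[of "E ` set_pmf R" "map_pmf E R"]
      by (simp add: sum.cartesian_product' sum_divide_distrib[symmetric])
    finally show "expect R (\<lambda>w. log 2 ((prob_of R E w / r) / ?y w)) \<le> 0"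
      by (simp add: divide_right_mono)
  qed
  finally show ?thesis by simp
qed

end

section \<open>I.i.d. words: concatenation, letterwise maps and expectations of products\<close>

lemma replicate_pmf_Suc_pair:
  "replicate_pmf (Suc n) p = map_pmf (\<lambda>(x, xs). x # xs) (pair_pmf p (replicate_pmf n p))"
  by (simp add: pair_pmf_def map_pmf_def bind_assoc_pmf bind_return_pmf)

lemma replicate_pmf_append_pair:
  "replicate_pmf (m + n) p = map_pmf (\<lambda>(xs, ys). xs @ ys) (pair_pmf (replicate_pmf m p) (replicate_pmf n p))"
  by (simp add: replicate_pmf_distrib pair_pmf_def map_pmf_def bind_assoc_pmf bind_return_pmf)

lemma map_replicate_pmf: "map_pmf (map f) (replicate_pmf n p) = replicate_pmf n (map_pmf f p)"
proof (induction n)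
  case (Suc n)
  have "map_pmf (map f) (replicate_pmf (Suc n) p) =
    map_pmf (\<lambda>(x, xs). x # xs) (map_pmf (\<lambda>(x, xs). (f x, map f xs)) (pair_pmf p (replicate_pmf n p)))"
    unfolding replicate_pmf_Suc_pair by (simp add: map_pmf_comp case_prod_unfold)
  also have "\<dots> = replicate_pmf (Suc n) (map_pmf f p)"
    unfolding map_pair Suc replicate_pmf_Suc_pair ..
  finally show ?case .
qed simp

lemma finite_set_replicate_pmf: "finite (set_pmf p) \<Longrightarrow> finite (set_pmf (replicate_pmf n p))"
  using finite_lists_length_eq[of "set_pmf p" n] by (simp add: set_replicate_pmf lists_eq_set conj_commute)

lemma length_replicate_pmf: "xs \<in> set_pmf (replicate_pmf n p) \<Longrightarrow> length xs = n"
  by (simp add: set_replicate_pmf)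

lemma pmf_replicate_pmf:
  "length xs = n \<Longrightarrow> pmf (replicate_pmf n p) xs = prod_list (map (pmf p) xs)"
proof (induction n arbitrary: xs)
  case (Suc n)
  then obtain y ys where xs: "xs = y # ys" "length ys = n" by (cases xs) auto
  have "inj (\<lambda>(x, xs). x # xs)" by (auto simp: inj_def)
  then have "pmf (replicate_pmf (Suc n) p) (y # ys) = pmf (pair_pmf p (replicate_pmf n p)) (y, ys)"
    unfolding replicate_pmf_Suc_pair using pmf_map_inj'[of "\<lambda>(x, xs). x # xs" _ "(y, ys)"] by simp
  then show ?case using Suc.IH[OF xs(2)] by (simp add: xs pmf_pair)
qed simp

lemma expect_pair_mult:
  assumes "finite (set_pmf p)" "finite (set_pmf q)"
  shows "expect (pair_pmf p q) (\<lambda>z. f (fst z) * g (snd z)) = expect p f * expect q g"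
proof -
  have "expect (pair_pmf p q) (\<lambda>z. f (fst z) * g (snd z)) =
     (\<Sum>z\<in>set_pmf p \<times> set_pmf q. (\<lambda>(x, y). (pmf p x * f x) * (pmf q y * g y)) z)"
    using assms by (subst expect_finite) (auto simp: pmf_pair intro!: sum.cong)
  also have "\<dots> = expect p f * expect q g"
    using assms by (simp add: sum.cartesian_product[symmetric] sum_product[symmetric] expect_finite)
  finally show ?thesis .
qed

lemma expect_prod_list:
  fixes f :: "'a \<Rightarrow> real"
  assumes "finite (set_pmf p)"
  shows "expect (replicate_pmf n p) (\<lambda>xs. prod_list (map f xs)) = expect p f ^ n"
proof (induction n)
  case (Suc n)
  have "expect (replicate_pmf (Suc n) p) (\<lambda>xs. prod_list (map f xs)) =
    expect (pair_pmf p (replicate_pmf n p)) (\<lambda>z. f (fst z) * prod_list (map f (snd z)))"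
    unfolding replicate_pmf_Suc_pair by (simp add: case_prod_unfold)
  then show ?case
    using expect_pair_mult[OF assms finite_set_replicate_pmf[OF assms, of n], of f "\<lambda>xs. prod_list (map f xs)"]
    by (simp add: Suc)
qed simp

section \<open>Filtered bits\<close>

text \<open>An accepting symbol is one on which neither party abstains; abstentions (\<open>None\<close>) are made
  public, and all positions that are not accepted carry the dummy bit \<open>False\<close>.\<close>

definition accepted :: "bool option \<times> bool option \<times> 'e \<Rightarrow> bool" where
  "accepted = (\<lambda>(a, b, e). a \<noteq> None \<and> b \<noteq> None)"

definition bit_A :: "bool option \<times> bool option \<times> 'e \<Rightarrow> bool" where
  "bit_A = (\<lambda>(a, b, e). b \<noteq> None \<and> a = Some True)"

definition bit_B :: "bool option \<times> bool option \<times> 'e \<Rightarrow> bool" where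
  "bit_B = (\<lambda>(a, b, e). a \<noteq> None \<and> b = Some True)"

definition eve_view :: "bool option \<times> bool option \<times> 'e \<Rightarrow> bool \<times> bool \<times> 'e" where
  "eve_view = (\<lambda>(a, b, e). (a \<noteq> None, b \<noteq> None, e))"

text \<open>An unnormalised binary symmetric channel on accepted positions, with the weight
  \<open>x\<close> of a flipped bit left free for later optimisation. Elsewhere only the dummy bit
  \<open>False\<close> has positive weight.\<close>

definition letter_weight :: "real \<Rightarrow> bool \<times> bool \<Rightarrow> bool \<Rightarrow> real" where
  "letter_weight x = (\<lambda>(c, \<beta>) a. if c then (if a = \<beta> then 1 else x) else of_bool (\<not> a))"

definition word_weight :: "real \<Rightarrow> (bool \<times> bool) list \<Rightarrow> bool list \<Rightarrow> real" where
  "word_weight x bs as = (if length as = length bs then prod_list (map2 (letter_weight x) bs as) else 0)"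

definition bit_words :: "nat \<Rightarrow> bool list set" where
  "bit_words n = {as. length as = n}"

lemma bit_words_Suc: "bit_words (Suc n) = (\<lambda>(a, as). a # as) ` (UNIV \<times> bit_words n)"
  by (force simp: bit_words_def length_Suc_conv)

lemma finite_bit_words: "finite (bit_words n)"
  using finite_lists_length_eq[of "UNIV :: bool set" n] by (simp add: bit_words_def)

lemma word_weight_nonneg: "0 \<le> x \<Longrightarrow> 0 \<le> word_weight x bs as"
  unfolding word_weight_def
  by (auto simp: letter_weight_def intro!: prod_list_nonneg split: if_splits)

lemma sum_word_weight:
  "(\<Sum>as\<in>bit_words (length bs). word_weight x bs as) = prod_list (map (\<lambda>(c, \<beta>). if c then 1 + x else 1) bs)"
proof (induction bs)
  case Nil
  then show ?case by (simp add: bit_words_def word_weight_def)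
next
  case (Cons b bs)
  have inj: "inj_on (\<lambda>(a, as). a # as) (UNIV \<times> bit_words (length bs))" by (auto simp: inj_on_def)
  have "(\<Sum>as\<in>bit_words (length (b # bs)). word_weight x (b # bs) as) =
     (\<Sum>z\<in>UNIV \<times> bit_words (length bs). letter_weight x b (fst z) * word_weight x bs (snd z))"
    unfolding list.size(4) add_Suc_right add_0_right bit_words_Suc sum.reindex[OF inj]
    by (intro sum.cong refl) (auto simp: word_weight_def bit_words_def)
  also have "\<dots> = (\<Sum>a\<in>UNIV. letter_weight x b a) * (\<Sum>as\<in>bit_words (length bs). word_weight x bs as)"
    by (simp add: sum.cartesian_product' sum_product)
  also have "(\<Sum>a\<in>UNIV. letter_weight x b a) = (case b of (c, \<beta>) \<Rightarrow> if c then 1 + x else 1)"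
    by (cases b) (simp add: letter_weight_def UNIV_bool)
  finally show ?case using Cons by simp
qed

text \<open>Outside the accepted positions Alice's bit is the dummy one, so only disagreements at
  accepted positions cost a factor.\<close>

lemma word_weight_map:
  "word_weight x (map (\<lambda>q. (accepted q, bit_B q)) qs) (map bit_A qs) =
     prod_list (map (\<lambda>q. if accepted q \<and> bit_A q \<noteq> bit_B q then x else 1) qs)"
proof -
  have "letter_weight x (accepted q, bit_B q) (bit_A q) = (if accepted q \<and> bit_A q \<noteq> bit_B q then x else 1)"
    for q :: "bool option \<times> bool option \<times> 'a"
    by (cases q) (auto simp: letter_weight_def accepted_def bit_A_def bit_B_def)
  then show ?thesis
    unfolding word_weight_def by (simp add: zip_map_map zip_same_conv_map comp_def)
qed

text \<open>On the symbols \<open>e\<close> of \<open>secret\<close> Eve can exclude neither value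
  of the bit, and each value is supported by mass at least \<open>\<mu> e\<close>. Lower bounds are
  enough, so the other events that lead to the same \<open>e\<close> never need to be
  analysed.\<close>

locale filtered_bits =
  fixes Q :: "(bool option \<times> bool option \<times> 'e) pmf" and acc err m :: real
  assumes fin: "finite (set_pmf Q)"
    and acc: "measure_pmf.prob Q {q. accepted q} \<le> acc"
    and err: "measure_pmf.prob Q {q. accepted q \<and> bit_A q \<noteq> bit_B q} \<le> err"
    and secret: "\<exists>G \<mu>. finite G \<and> m \<le> (\<Sum>e\<in>G. \<mu> e) \<and> (\<forall>e\<in>G. 0 < \<mu> e \<and>
       \<mu> e \<le> pmf Q (Some False, Some False, e) \<and> \<mu> e \<le> pmf Q (Some True, Some True, e))"
begin

text \<open>The total weight of both bit values relative to the weight of the true one: a correct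
  accepted bit contributes 1 + x, a wrong one 1 + 1 / x, any other position 1.\<close>

lemma expect_weight_ratio:
  assumes x: "0 < x"
  shows "expect Q (\<lambda>q. (if accepted q then 1 + x else 1) / (if accepted q \<and> bit_A q \<noteq> bit_B q then x else 1))
    \<le> 1 + acc * x + err / x"
proof -
  let ?C = "{q. accepted q} :: (bool option \<times> bool option \<times> 'e) set"
  let ?D = "{q. accepted q \<and> bit_A q \<noteq> bit_B q} :: (bool option \<times> bool option \<times> 'e) set"
  have "expect Q (\<lambda>q. (if accepted q then 1 + x else 1) / (if accepted q \<and> bit_A q \<noteq> bit_B q then x else 1))
     = expect Q (\<lambda>q. 1 + x * indicator ?C q + (1 / x - x) * indicator ?D q)"
    using x by (intro expect_cong) (auto simp: indicator_def field_simps)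
  also have "\<dots> = 1 + x * measure_pmf.prob Q ?C + (1 / x - x) * measure_pmf.prob Q ?D"
    using fin by (simp add: integrable_finite_pmf)
  also have "\<dots> \<le> 1 + x * acc + (1 / x) * err"
  proof -
    have "x * measure_pmf.prob Q ?C \<le> x * acc" using acc x by (intro mult_left_mono) auto
    moreover have "(1 / x - x) * measure_pmf.prob Q ?D \<le> (1 / x) * measure_pmf.prob Q ?D"
      using x by (intro mult_right_mono) auto
    moreover have "(1 / x) * measure_pmf.prob Q ?D \<le> (1 / x) * err"
      using err x by (intro mult_left_mono) auto
    ultimately show ?thesis by linarith
  qed
  finally show ?thesis by (simp add: mult.commute)
qed

text \<open>If the two bit values have masses s and t in one accepted view, that view lowers the
  mean posterior by 2 s t / (s + t). This is a harmonic mean, hence at least the minimum of s and t.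
  All other views contribute a nonnegative loss.\<close>

lemma expect_posterior:
  "expect Q (\<lambda>q. prob_of Q (\<lambda>q. (bit_A q, eve_view q)) q / prob_of Q eve_view q) \<le> 1 - m"
proof -
  obtain G \<mu> where G: "finite G" "m \<le> (\<Sum>e\<in>G. \<mu> e)" and mu: "\<And>e. e \<in> G \<Longrightarrow> 0 < \<mu> e"
    "\<And>e. e \<in> G \<Longrightarrow> \<mu> e \<le> pmf Q (Some False, Some False, e)"
    "\<And>e. e \<in> G \<Longrightarrow> \<mu> e \<le> pmf Q (Some True, Some True, e)"
    using secret by blast
  let ?f = "\<lambda>q. (bit_A q, eve_view q)"
  define p where "p = pmf (map_pmf ?f Q)"
  define pe where "pe = pmf (map_pmf eve_view Q)"
  have pe_eq: "pe v = p (False, v) + p (True, v)" for v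
    unfolding p_def pe_def pmf_map_sum[OF fin] sum.distrib[symmetric] by (intro sum.cong refl) auto
  have p_nonneg: "0 \<le> p v" for v by (simp add: p_def)
  let ?h = "\<lambda>y. 1 - p y / pe (snd y)"
  have h_nonneg: "0 \<le> ?h y" for y
  proof -
    have "p y \<le> pe (snd y)" unfolding pe_eq using p_nonneg by (cases y; cases "fst y") auto
    then show ?thesis using p_nonneg[of y] by (cases "pe (snd y) = 0") (auto simp: field_simps le_less)
  qed
  have lower: "\<mu> e \<le> p (i, True, True, e)" if "e \<in> G" for i e
  proof -
    have "\<mu> e \<le> pmf Q (Some i, Some i, e)" using mu(2,3)[OF that] by (cases i) auto
    also have "\<dots> = (\<Sum>q\<in>set_pmf Q. if q = (Some i, Some i, e) then pmf Q q else 0)"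
      using fin by (simp add: set_pmf_iff)
    also have "\<dots> \<le> p (i, True, True, e)" unfolding p_def pmf_map_sum[OF fin]
      by (intro sum_mono) (auto simp: bit_A_def eve_view_def)
    finally show ?thesis .
  qed
  have "m \<le> (\<Sum>e\<in>G. \<mu> e)" by (rule G)
  also have "\<dots> \<le> (\<Sum>e\<in>G. \<Sum>i\<in>UNIV. p (i, True, True, e) * ?h (i, True, True, e))"
  proof (rule sum_mono)
    fix e assume e: "e \<in> G"
    define s t where "s = p (False, True, True, e)" and "t = p (True, True, True, e)"
    have st: "\<mu> e \<le> s" "\<mu> e \<le> t" "0 < \<mu> e" using lower[OF e] mu(1)[OF e] by (auto simp: s_def t_def)
    have "\<mu> e * s \<le> t * s" "\<mu> e * t \<le> s * t" using st by (auto intro!: mult_right_mono)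
    then have "\<mu> e * (s + t) \<le> 2 * s * t" by (simp add: algebra_simps)
    then have "\<mu> e \<le> 2 * s * t / (s + t)" using st by (simp add: field_simps)
    also have "\<dots> = s * (1 - s / (s + t)) + t * (1 - t / (s + t))"
      using st by (simp add: divide_simps)
    finally show "\<mu> e \<le> (\<Sum>i\<in>UNIV. p (i, True, True, e) * ?h (i, True, True, e))"
      by (simp add: UNIV_bool s_def t_def pe_eq)
  qed
  also have "\<dots> = (\<Sum>y\<in>(\<lambda>(e, i). (i, True, True, e)) ` (G \<times> UNIV). p y * ?h y)"
    by (subst sum.reindex) (auto simp: inj_on_def sum.cartesian_product case_prod_unfold)
  also have "\<dots> \<le> (\<Sum>y\<in>?f ` set_pmf Q. p y * ?h y)"
  proof (rule sum_mono2)
    show "(\<lambda>(e, i). (i, True, True, e)) ` (G \<times> UNIV) \<subseteq> ?f ` set_pmf Q"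
    proof clarify
      fix e i assume e: "e \<in> G"
      then have "0 < p (i, True, True, e)" using lower[OF e, of i] mu(1)[OF e] by linarith
      then show "(i, True, True, e) \<in> ?f ` set_pmf Q"
        using pmf_map_outside[of "(i, True, True, e)" ?f Q] unfolding p_def by force
    qed
    show "0 \<le> p y * ?h y" for y using p_nonneg[of y] h_nonneg[of y] by (rule mult_nonneg_nonneg)
  qed (use fin in auto)
  also have "\<dots> = expect Q (\<lambda>q. ?h (?f q))"
    unfolding p_def by (rule expect_comp[OF fin, symmetric])
  also have "\<dots> = 1 - expect Q (\<lambda>q. prob_of Q ?f q / prob_of Q eve_view q)"
    using fin by (simp add: p_def pe_def integrable_finite_pmf)
  finally show ?thesis by simp
qed

end

text \<open>One symbol of the derived source is computed locally from \<open>L\<close> symbols of \<open>P\<close>.\<close>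

definition derived :: "('x \<times> 'y \<times> 'z) pmf \<Rightarrow> nat \<Rightarrow> ('x list \<Rightarrow> 'u) \<Rightarrow> ('y list \<Rightarrow> 'v) \<Rightarrow> ('z list \<Rightarrow> 'e)
    \<Rightarrow> ('u \<times> 'v \<times> 'e) pmf" where
  "derived P L fx fy fz = map_pmf (\<lambda>w. (fx (map (\<lambda>(x, y, z). x) w), fy (map (\<lambda>(x, y, z). y) w),
     fz (map (\<lambda>(x, y, z). z) w))) (replicate_pmf L P)"

section \<open>Cutting a word into blocks and a remainder\<close>

primrec chunks :: "nat \<Rightarrow> nat \<Rightarrow> 'a list \<Rightarrow> 'a list list" where
  "chunks L 0 xs = []"
| "chunks L (Suc b) xs = take L xs # chunks L b (drop L xs)"

lemma prod_list_map_divide: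
  "prod_list (map (\<lambda>q. f q / g q) l) = prod_list (map f l) / prod_list (map g l :: real list)"
  by (induction l) auto

lemma length_chunks [simp]: "length (chunks L b xs) = b"
  by (induction b arbitrary: xs) auto

lemma chunks_map: "chunks L b (map f xs) = map (map f) (chunks L b xs)"
  by (induction b arbitrary: xs) (auto simp: take_map drop_map)

lemma concat_chunks: "concat (chunks L b xs) = take (b * L) xs"
  by (induction b arbitrary: xs) (auto simp: take_add)

lemma length_in_chunks: "b * L \<le> length xs \<Longrightarrow> c \<in> set (chunks L b xs) \<Longrightarrow> length c = L"
proof (induction b arbitrary: xs)
  case (Suc b)
  have "b * L \<le> length (drop L xs)" using Suc.prems(1) by simp
  then show ?case using Suc.IH[of "drop L xs"] Suc.prems by auto
qed simp

lemma chunks_eq_iff: "xs = ys \<longleftrightarrow> chunks L b xs = chunks L b ys \<and> drop (b * L) xs = drop (b * L) ys"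
  by (metis append_take_drop_id concat_chunks)

text \<open>The remainder has to be carried along because Eve sees all of \<open>Z\<^sup>n\<close>,
  including the symbols that fill no block.\<close>

lemma map_pmf_chunks:
  "map_pmf (\<lambda>w. (chunks L b w, drop (b * L) w)) (replicate_pmf (b * L + m) P) =
     pair_pmf (replicate_pmf b (replicate_pmf L P)) (replicate_pmf m P)"
proof (induction b)
  case 0
  then show ?case by (simp add: pair_return_pmf1)
next
  case (Suc b)
  let ?R = "replicate_pmf L P" and ?T = "replicate_pmf (b * L + m) P"
  have "Suc b * L + m = L + (b * L + m)" by simp
  then have "map_pmf (\<lambda>w. (chunks L (Suc b) w, drop (Suc b * L) w)) (replicate_pmf (Suc b * L + m) P) =
     map_pmf (\<lambda>z. (chunks L (Suc b) (fst z @ snd z), drop (Suc b * L) (fst z @ snd z))) (pair_pmf ?R ?T)"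
    by (simp only: replicate_pmf_append_pair map_pmf_comp case_prod_unfold)
  also have "\<dots> = map_pmf (\<lambda>z. (fst z # chunks L b (snd z), drop (b * L) (snd z))) (pair_pmf ?R ?T)"
    by (intro map_pmf_cong refl) (auto dest: length_replicate_pmf)
  also have "\<dots> = map_pmf (\<lambda>(u, c, r). (u # c, r)) (map_pmf (\<lambda>(u, v). (u, (chunks L b v, drop (b * L) v))) (pair_pmf ?R ?T))"
    by (simp add: map_pmf_comp case_prod_unfold)
  also have "\<dots> = map_pmf (\<lambda>(u, c, r). (u # c, r)) (pair_pmf ?R (pair_pmf (replicate_pmf b ?R) (replicate_pmf m P)))"
    using map_pair[of "\<lambda>u. u" "\<lambda>v. (chunks L b v, drop (b * L) v)" ?R ?T] by (simp add: Suc)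
  also have "\<dots> = pair_pmf (replicate_pmf (Suc b) ?R) (replicate_pmf m P)"
    by (simp add: pair_pmf_def map_pmf_def bind_assoc_pmf bind_return_pmf)
  finally show ?case .
qed

section \<open>The filtering protocol and its bounds at a fixed number of copies\<close>

definition masked_bits :: "bool option list \<Rightarrow> bool list \<Rightarrow> bool list" where
  "masked_bits os ms = map2 (\<lambda>o' m. m \<and> o' = Some True) os ms"

definition masked_letters :: "bool option list \<Rightarrow> bool list \<Rightarrow> (bool \<times> bool) list" where
  "masked_letters os ms = map2 (\<lambda>o' m. (m \<and> o' \<noteq> None, m \<and> o' = Some True)) os ms"

definition mask_of :: "bool option list \<Rightarrow> bool list" where
  "mask_of os = map (\<lambda>o'. o' \<noteq> None) os"

text \<open>Three rounds: Alice's mask, Bob's mask, the hash \<open>h1\<close> of Alice's masked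
  bits. As the latest message is the head, the final transcript has the hash at index 0, Bob's mask
  at 1 and Alice's mask at 2. The protocol is deterministic, so its private randomness is a point
  mass.\<close>

definition filter_protocol :: "('x list \<Rightarrow> bool option list) \<Rightarrow> ('y list \<Rightarrow> bool option list) \<Rightarrow> nat \<Rightarrow>
    real \<Rightarrow> nat \<Rightarrow> (bool list \<Rightarrow> nat) \<Rightarrow> (bool list \<Rightarrow> nat) \<Rightarrow> ('x, 'y) key_protocol" where
  "filter_protocol \<alpha> \<beta> b x K h1 h2 = \<lparr>crounds = 3, ckeys = K, rand_A = return_pmf 0, rand_B = return_pmf 0,
     msg_A = \<lambda>xs r t. if t = [] then to_nat (mask_of (\<alpha> xs)) else h1 (masked_bits (\<alpha> xs) (from_nat (hd t))),
     msg_B = \<lambda>ys r t. to_nat (mask_of (\<beta> ys)),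
     key_A = \<lambda>xs r t. h2 (masked_bits (\<alpha> xs) (from_nat (t ! 1))),
     key_B = \<lambda>ys r t. h2 (decode (bit_words b) (word_weight x) h1 (masked_letters (\<beta> ys) (from_nat (t ! 2))) (t ! 0))\<rparr>"

lemma run_filter_protocol:
  "run P n (filter_protocol \<alpha> \<beta> b x K h1 h2) =
    map_pmf (\<lambda>w. let as = \<alpha> (map (\<lambda>(x, y, z). x) w); bs = \<beta> (map (\<lambda>(x, y, z). y) w);
        a = masked_bits as (mask_of bs)
      in (h2 a, h2 (decode (bit_words b) (word_weight x) h1 (masked_letters bs (mask_of as)) (h1 a)),
          map (\<lambda>(x, y, z). z) w, [h1 a, to_nat (mask_of bs), to_nat (mask_of as)])) (replicate_pmf n P)"
  unfolding run_def filter_protocol_def map_pmf_def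
  by (simp add: bind_return_pmf Let_def numeral_3_eq_3 numeral_2_eq_2)

text \<open>Everything factorises over the n div L blocks, so both expectations in
  \<open>one_shot_hash\<close> are bounded by powers of single-letter bounds. Injectivity of
  \<open>fz\<close> guarantees that Eve's derived symbol retains her whole block, so
  \<open>Q\<close> does not understate her knowledge.\<close>

lemma (in filtered_bits) filter_protocol_bounds:
  fixes P :: "('x \<times> 'y \<times> 'z :: countable) pmf" and r K :: nat
  assumes finP: "finite (set_pmf P)" and L: "0 < L" and Q: "Q = derived P L fx fy fz"
    and fz: "inj_on fz {zs. length zs = L}" and rK: "0 < r" "0 < K" and x: "0 < x"
    and \<eta>: "\<eta> = (1 + acc * x + err / x) ^ (n div L) / r + real (r * K) * (1 - m) ^ (n div L)"
  shows "\<exists>p. valid_key_protocol p \<and> ckeys p = K \<and>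
    measure_pmf.prob (run P n p) {(ka, kb, zs, f). ka \<noteq> kb} \<le> \<eta> \<and>
    shannon_entropy (run P n p) (\<lambda>(ka, kb, zs, f). ka) \<le> log 2 K \<and>
    0 \<le> mutual_inf (run P n p) (\<lambda>(ka, kb, zs, f). ka) (\<lambda>(ka, kb, zs, f). (zs, f)) \<and>
    log 2 K - shannon_entropy (run P n p) (\<lambda>(ka, kb, zs, f). ka) +
      mutual_inf (run P n p) (\<lambda>(ka, kb, zs, f). ka) (\<lambda>(ka, kb, zs, f). (zs, f)) \<le> \<eta> / ln 2"
proof -
  define b where "b = n div L"
  define W where "W = replicate_pmf n P"
  define Zr where "Zr = replicate_pmf (n mod L) (map_pmf (\<lambda>(x, y, z). z) P)"
  define blk where "blk c = (fx (map (\<lambda>(x, y, z). x) c), fy (map (\<lambda>(x, y, z). y) c), fz (map (\<lambda>(x, y, z). z) c))"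
    for c :: "('x \<times> 'y \<times> 'z) list"
  define qs where "qs w = map blk (chunks L b w)" for w
  define zs where "zs w = map (\<lambda>(x, y, z). z) w" for w :: "('x \<times> 'y \<times> 'z) list"
  define zr where "zr w = map (\<lambda>(x, y, z). z) (drop (b * L) w)" for w :: "('x \<times> 'y \<times> 'z) list"
  define \<alpha> where "\<alpha> xs = map fx (chunks L b xs)" for xs
  define \<beta> where "\<beta> ys = map fy (chunks L b ys)" for ys
  define as where "as w = \<alpha> (map (\<lambda>(x, y, z). x) w)" for w :: "('x \<times> 'y \<times> 'z) list"
  define bs where "bs w = \<beta> (map (\<lambda>(x, y, z). y) w)" for w :: "('x \<times> 'y \<times> 'z) list"
  define A where "A w = masked_bits (as w) (mask_of (bs w))" for w
  define B where "B w = masked_letters (bs w) (mask_of (as w))" for w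
  define E where "E w = (zs w, to_nat (mask_of (bs w)), to_nat (mask_of (as w)))" for w
  have n: "n = b * L + n mod L" by (simp add: b_def)
  have finW: "finite (set_pmf W)" unfolding W_def by (rule finite_set_replicate_pmf[OF finP])
  have finR: "finite (set_pmf (replicate_pmf b Q))" by (rule finite_set_replicate_pmf[OF fin])
  have lenW: "length w = n" if "w \<in> set_pmf W" for w using that by (simp add: W_def length_replicate_pmf)
  have as_qs: "as w = map fst (qs w)" for w
    by (simp add: as_def \<alpha>_def qs_def blk_def chunks_map comp_def)
  have bs_qs: "bs w = map (fst \<circ> snd) (qs w)" for w
    by (simp add: bs_def \<beta>_def qs_def blk_def chunks_map comp_def)
  have A_qs: "A w = map bit_A (qs w)" for w
    by (auto simp: A_def as_qs bs_qs masked_bits_def mask_of_def zip_map_map zip_same_conv_map bit_A_def)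
  have B_qs: "B w = map (\<lambda>q. (accepted q, bit_B q)) (qs w)" for w
    by (auto simp: B_def as_qs bs_qs masked_letters_def mask_of_def zip_map_map zip_same_conv_map bit_B_def accepted_def)
  have len_qs [simp]: "length (qs w) = b" for w by (simp add: qs_def)
  \<comment> \<open>Eve's actual view, consisting of \<open>Z\<^sup>n\<close> and both masks, and
    the letterwise views together with the remainder determine each other on the support.\<close>
  have E_iff: "E w = E w' \<longleftrightarrow> map eve_view (qs w) = map eve_view (qs w') \<and> zr w = zr w'"
    if w: "w \<in> set_pmf W" and w': "w' \<in> set_pmf W" for w w'
  proof -
    let ?c = "\<lambda>w. chunks L b (zs w)"
    have len: "b * L \<le> length (zs v)" if "v \<in> set_pmf W" for v
      using lenW[OF that] n by (simp add: zs_def)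
    have "set (?c w) \<union> set (?c w') \<subseteq> {zs. length zs = L}"
      using length_in_chunks[OF len[OF w]] length_in_chunks[OF len[OF w']] by auto
    then have "inj_on fz (set (?c w) \<union> set (?c w'))" using fz inj_on_subset by blast
    then have "map fz (?c w) = map fz (?c w') \<longleftrightarrow> ?c w = ?c w'" by (metis map_inj_on)
    moreover have "map fz (?c w) = map (snd \<circ> snd) (qs w)" for w
      by (simp add: zs_def chunks_map qs_def blk_def comp_def)
    ultimately have 1: "zs w = zs w' \<longleftrightarrow> map (snd \<circ> snd) (qs w) = map (snd \<circ> snd) (qs w') \<and> zr w = zr w'"
      by (subst chunks_eq_iff[of _ _ L b]) (simp add: zr_def zs_def drop_map)
    have 2: "map eve_view u = map eve_view v \<longleftrightarrow>
       map (snd \<circ> snd) u = map (snd \<circ> snd) v \<and> mask_of (map fst u) = mask_of (map fst v) \<and>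
       mask_of (map (fst \<circ> snd) u) = mask_of (map (fst \<circ> snd) v)"
      if "length u = length v" for u v :: "(bool option \<times> bool option \<times> 'e) list"
      using that by (induction u v rule: list_induct2) (auto simp: eve_view_def mask_of_def)
    show ?thesis
      using 1 2[of "qs w" "qs w'"] by (auto simp: E_def as_qs bs_qs)
  qed
  have law: "map_pmf (\<lambda>w. (qs w, zr w)) W = pair_pmf (replicate_pmf b Q) Zr"
  proof -
    have "map_pmf (\<lambda>w. (qs w, zr w)) W =
      map_pmf (\<lambda>(cs, v). (map blk cs, map (\<lambda>(x, y, z). z) v))
        (map_pmf (\<lambda>w. (chunks L b w, drop (b * L) w)) (replicate_pmf (b * L + n mod L) P))"
      unfolding W_def using n by (simp add: map_pmf_comp qs_def zr_def)
    also have "\<dots> = pair_pmf (map_pmf (map blk) (replicate_pmf b (replicate_pmf L P)))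
        (map_pmf (map (\<lambda>(x, y, z). z)) (replicate_pmf (n mod L) P))"
      unfolding map_pmf_chunks map_pair ..
    also have "map_pmf (map blk) (replicate_pmf b (replicate_pmf L P)) = replicate_pmf b Q"
      unfolding map_replicate_pmf Q derived_def blk_def[abs_def] ..
    finally show ?thesis by (simp add: map_replicate_pmf Zr_def)
  qed
  have expect_qs: "expect W (\<lambda>w. prod_list (map g (qs w))) = expect Q g ^ b" for g :: "_ \<Rightarrow> real"
  proof -
    have "expect W (\<lambda>w. prod_list (map g (qs w))) = expect (map_pmf (\<lambda>w. (qs w, zr w)) W) (\<lambda>z. prod_list (map g (fst z)))"
      by simp
    then show ?thesis
      unfolding law using expectation_pair_pmf_fst[of "replicate_pmf b Q" Zr "\<lambda>u. prod_list (map g u)"]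
      by (simp add: expect_prod_list[OF fin])
  qed
  have prob_qs: "prob_of W (\<lambda>w. (map g (qs w), zr w)) w = prod_list (map (\<lambda>q. prob_of Q g q) (qs w)) * pmf Zr (zr w)"
    for g :: "_ \<Rightarrow> 'k" and w
  proof -
    have "map_pmf (\<lambda>w. (map g (qs w), zr w)) W = map_pmf (\<lambda>(q, z). (map g q, z)) (map_pmf (\<lambda>w. (qs w, zr w)) W)"
      by (simp add: map_pmf_comp)
    also have "\<dots> = pair_pmf (replicate_pmf b (map_pmf g Q)) Zr"
      unfolding law using map_pair[of "map g" "\<lambda>z. z" "replicate_pmf b Q" Zr] by (simp add: map_replicate_pmf)
    finally show ?thesis by (simp add: pmf_pair pmf_replicate_pmf comp_def)
  qed
  let ?c = "\<lambda>q. prob_of Q (\<lambda>q. (bit_A q, eve_view q)) q / prob_of Q eve_view q"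
  have kappa: "expect W (\<lambda>w. prob_of W (\<lambda>w. (A w, E w)) w / prob_of W E w) \<le> (1 - m) ^ b"
  proof -
    have "expect W (\<lambda>w. prob_of W (\<lambda>w. (A w, E w)) w / prob_of W E w) = expect W (\<lambda>w. prod_list (map ?c (qs w)))"
    proof (rule expect_cong)
      fix w assume w: "w \<in> set_pmf W"
      have pair: "map (\<lambda>q. (bit_A q, eve_view q)) u = map (\<lambda>q. (bit_A q, eve_view q)) v \<longleftrightarrow>
        map bit_A u = map bit_A v \<and> map eve_view u = map eve_view v"
        if "length u = length v" for u v :: "(bool option \<times> bool option \<times> 'e) list"
        using that by (induction u v rule: list_induct2) auto
      have AE: "prob_of W (\<lambda>w. (A w, E w)) w = prob_of W (\<lambda>w. (map (\<lambda>q. (bit_A q, eve_view q)) (qs w), zr w)) w"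
        using E_iff[OF _ w] by (intro prob_of_cong finW) (auto simp: A_qs pair)
      have "prob_of W E w = prob_of W (\<lambda>w. (map eve_view (qs w), zr w)) w"
        using E_iff[OF _ w] by (intro prob_of_cong finW) auto
      then have "prob_of W (\<lambda>w. (A w, E w)) w / prob_of W E w =
         (prod_list (map (\<lambda>q. prob_of Q (\<lambda>q. (bit_A q, eve_view q)) q) (qs w)) * pmf Zr (zr w)) /
         (prod_list (map (\<lambda>q. prob_of Q eve_view q) (qs w)) * pmf Zr (zr w))"
        unfolding AE prob_qs by simp
      \<comment> \<open>The remainder contributes the same nonzero factor to numerator and
        denominator and cancels.\<close>
      also have "pmf Zr (zr w) \<noteq> 0"
      proof -
        have "(qs w, zr w) \<in> set_pmf (pair_pmf (replicate_pmf b Q) Zr)"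
          unfolding law[symmetric] using w by auto
        then show ?thesis by (simp add: set_pmf_iff)
      qed
      then have "(prod_list (map (\<lambda>q. prob_of Q (\<lambda>q. (bit_A q, eve_view q)) q) (qs w)) * pmf Zr (zr w)) /
         (prod_list (map (\<lambda>q. prob_of Q eve_view q) (qs w)) * pmf Zr (zr w)) =
         prod_list (map (\<lambda>q. prob_of Q (\<lambda>q. (bit_A q, eve_view q)) q) (qs w)) / prod_list (map (\<lambda>q. prob_of Q eve_view q) (qs w))"
        by simp
      also have "\<dots> = prod_list (map ?c (qs w))"
        by (rule prod_list_map_divide[symmetric])
      finally show "prob_of W (\<lambda>w. (A w, E w)) w / prob_of W E w = prod_list (map ?c (qs w))" .
    qed
    also have "\<dots> = expect Q ?c ^ b" by (rule expect_qs)
    also have "\<dots> \<le> (1 - m) ^ b"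
      using expect_posterior by (intro power_mono Bochner_Integration.integral_nonneg) auto
    finally show ?thesis .
  qed
  let ?g = "\<lambda>q. (if accepted q then 1 + x else 1) / (if accepted q \<and> bit_A q \<noteq> bit_B q then x else 1)"
  have pos: "0 < word_weight x (B w) (A w)" for w
  proof -
    have "0 < prod_list (map (\<lambda>q. if accepted q \<and> bit_A q \<noteq> bit_B q then x else 1) l)"
      for l :: "(bool option \<times> bool option \<times> 'e) list"
      using x by (induction l) auto
    then show ?thesis unfolding A_qs B_qs word_weight_map .
  qed
  have nu: "expect W (\<lambda>w. \<Sum>a\<in>bit_words b. word_weight x (B w) a / word_weight x (B w) (A w)) \<le> (1 + acc * x + err / x) ^ b"
  proof -
    have "(\<Sum>a\<in>bit_words b. word_weight x (B w) a / word_weight x (B w) (A w)) = prod_list (map ?g (qs w))" for w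
    proof -
      have "(\<Sum>a\<in>bit_words b. word_weight x (B w) a) = prod_list (map (\<lambda>q. if accepted q then 1 + x else 1) (qs w))"
        using sum_word_weight[of x "B w"] by (simp add: B_qs comp_def)
      then show ?thesis
        by (simp add: sum_divide_distrib[symmetric] A_qs B_qs word_weight_map prod_list_map_divide)
    qed
    then have "expect W (\<lambda>w. \<Sum>a\<in>bit_words b. word_weight x (B w) a / word_weight x (B w) (A w)) = expect Q ?g ^ b"
      by (simp only: expect_qs)
    also have "\<dots> \<le> (1 + acc * x + err / x) ^ b"
      using expect_weight_ratio[OF x] x by (intro power_mono Bochner_Integration.integral_nonneg) auto
    finally show ?thesis .
  qed
  have AS: "A ` set_pmf W \<subseteq> bit_words b" by (auto simp: A_qs bit_words_def)
  have wt: "0 \<le> word_weight x u v" for u v using x by (intro word_weight_nonneg) simp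
  obtain h1 h2 where h: "\<And>a. h1 a < r" "\<And>a. h2 a < K"
    and err_le: "measure_pmf.prob W {w. decode (bit_words b) (word_weight x) h1 (B w) (h1 (A w)) \<noteq> A w} \<le>
      expect W (\<lambda>w. \<Sum>a\<in>bit_words b. word_weight x (B w) a / word_weight x (B w) (A w)) / r +
      real (r * K) * expect W (\<lambda>w. prob_of W (\<lambda>w. (A w, E w)) w / prob_of W E w)"
    and chi_le: "expect W (\<lambda>w. real (r * K) * prob_of W (\<lambda>w. (h2 (A w), h1 (A w), E w)) w / prob_of W E w) - 1 \<le>
      expect W (\<lambda>w. \<Sum>a\<in>bit_words b. word_weight x (B w) a / word_weight x (B w) (A w)) / r +
      real (r * K) * expect W (\<lambda>w. prob_of W (\<lambda>w. (A w, E w)) w / prob_of W E w)"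
    by (rule one_shot_hash[where W = W and A = A and B = B and E = E and S = "bit_words b" and r = r and
        K = K and wt = "word_weight x", OF finW finite_bit_words AS rK wt pos refl]) (rule that; assumption)
  have eta_le: "expect W (\<lambda>w. \<Sum>a\<in>bit_words b. word_weight x (B w) a / word_weight x (B w) (A w)) / r +
      real (r * K) * expect W (\<lambda>w. prob_of W (\<lambda>w. (A w, E w)) w / prob_of W E w) \<le> \<eta>"
    unfolding \<eta> b_def[symmetric] using nu kappa
    by (intro add_mono divide_right_mono mult_left_mono) auto
  define p where "p = filter_protocol \<alpha> \<beta> b x K h1 h2"
  define \<Psi> where "\<Psi> w = (h2 (A w), h2 (decode (bit_words b) (word_weight x) h1 (B w) (h1 (A w))), zs w,
     [h1 (A w), to_nat (mask_of (bs w)), to_nat (mask_of (as w))])" for w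
  have run: "run P n p = map_pmf \<Psi> W"
    unfolding p_def run_filter_protocol W_def \<Psi>_def A_def B_def as_def bs_def zs_def by (simp add: Let_def)
  have "key_view (run P n p) (\<lambda>(ka, kb, zs, f). ka) K"
    unfolding key_view_def run using finW h by (auto simp: \<Psi>_def)
  then interpret key_view "run P n p" "\<lambda>(ka, kb, zs, f). ka" "\<lambda>(ka, kb, zs, f). (zs, f)" K .
  have "measure_pmf.prob (run P n p) {(ka, kb, zs, f). ka \<noteq> kb} \<le>
     measure_pmf.prob W {w. decode (bit_words b) (word_weight x) h1 (B w) (h1 (A w)) \<noteq> A w}"
    unfolding run measure_map_pmf by (intro measure_pmf.finite_measure_mono) (auto simp: \<Psi>_def)
  \<comment> \<open>In \<open>gap_le_chi\<close> the hash \<open>f ! 0\<close> plays the role of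
    \<open>V\<close>, and Eve's symbols with the two masks that of \<open>E\<close>.\<close>
  moreover have "log 2 K - shannon_entropy (run P n p) (\<lambda>(ka, kb, zs, f). ka) +
      mutual_inf (run P n p) (\<lambda>(ka, kb, zs, f). ka) (\<lambda>(ka, kb, zs, f). (zs, f)) \<le>
     (expect (run P n p) (\<lambda>w. real (r * K) * prob_of (run P n p) (\<lambda>w. ((\<lambda>(ka, kb, zs, f). ka) w,
         (\<lambda>(ka, kb, zs, f). f ! 0) w, (\<lambda>(ka, kb, zs, f). (zs, f ! 1, f ! 2)) w)) w /
         prob_of (run P n p) (\<lambda>(ka, kb, zs, f). (zs, f ! 1, f ! 2)) w) - 1) / ln 2"
    by (rule gap_le_chi) (auto simp: run \<Psi>_def h)
  moreover have "expect (run P n p) (\<lambda>w. real (r * K) * prob_of (run P n p) (\<lambda>w. ((\<lambda>(ka, kb, zs, f). ka) w,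
         (\<lambda>(ka, kb, zs, f). f ! 0) w, (\<lambda>(ka, kb, zs, f). (zs, f ! 1, f ! 2)) w)) w /
         prob_of (run P n p) (\<lambda>(ka, kb, zs, f). (zs, f ! 1, f ! 2)) w) =
     expect W (\<lambda>w. real (r * K) * prob_of W (\<lambda>w. (h2 (A w), h1 (A w), E w)) w / prob_of W E w)"
    unfolding run integral_map_pmf map_pmf_comp by (simp add: \<Psi>_def E_def[abs_def])
  ultimately have "measure_pmf.prob (run P n p) {(ka, kb, zs, f). ka \<noteq> kb} \<le> \<eta>"
    "log 2 K - shannon_entropy (run P n p) (\<lambda>(ka, kb, zs, f). ka) +
      mutual_inf (run P n p) (\<lambda>(ka, kb, zs, f). ka) (\<lambda>(ka, kb, zs, f). (zs, f)) \<le> \<eta> / ln 2"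
    using err_le chi_le eta_le by (auto elim!: order_trans intro!: divide_right_mono)
  moreover have "valid_key_protocol p" "ckeys p = K"
    using rK h by (auto simp: valid_key_protocol_def p_def filter_protocol_def)
  ultimately show ?thesis using entropy_le_log mutual_inf_nonneg by blast
qed

section \<open>From single-letter bounds to a positive rate\<close>

lemma (in filtered_bits) m_le_1: "m \<le> 1"
proof -
  have "0 \<le> expect Q (\<lambda>q. prob_of Q (\<lambda>q. (bit_A q, eve_view q)) q / prob_of Q eve_view q)"
    by (intro Bochner_Integration.integral_nonneg) simp
  then show ?thesis using expect_posterior by linarith
qed

theorem (in filtered_bits) secret_key_rate_pos:
  fixes P :: "('x \<times> 'y \<times> 'z :: countable) pmf"
  assumes finP: "finite (set_pmf P)" and L: "0 < L" and Q: "Q = derived P L fx fy fz"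
    and fz: "inj_on fz {zs. length zs = L}"
    and pos: "0 < acc" "0 \<le> err" "0 < m" and gap: "4 * acc * err < m\<^sup>2"
  shows "0 < secret_key_rate P"
proof -
  \<comment> \<open>This gives acc x = m / 2, and err / x < m / 2 by \<open>gap\<close>, so that
    \<Lambda> < 1 + m. The minimiser sqrt (err / acc) of the bound would also work, but it
    degenerates for err = 0.\<close>
  define x where "x = m / (2 * acc)"
  have x: "0 < x" using pos by (simp add: x_def)
  define \<Lambda> where "\<Lambda> = 1 + acc * x + err / x"
  have "acc * x = m / 2" "err / x = (4 * acc * err) / (2 * m)" using pos by (auto simp: x_def field_simps)
  moreover have "(4 * acc * err) / (2 * m) < m\<^sup>2 / (2 * m)"
    using gap pos by (intro divide_strict_right_mono) auto
  moreover have "m\<^sup>2 / (2 * m) = m / 2" using pos by (simp add: power2_eq_square)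
  ultimately have \<Lambda>: "1 \<le> \<Lambda>" "\<Lambda> < 1 + m" using pos x by (auto simp: \<Lambda>_def intro!: add_nonneg_nonneg)
  \<comment> \<open>The growth \<Lambda> of Bob's ambiguity times Eve's bound 1 - m is below (1 + m)
    (1 - m) < 1, and the rate is taken from this margin. The maximum with 1 / 2 keeps \<rho>
    positive when m = 1.\<close>
  define \<rho> where "\<rho> = max (\<Lambda> * (1 - m)) (1 / 2)"
  have "\<Lambda> * (1 - m) \<le> (1 + m) * (1 - m)" using \<Lambda> m_le_1 by (intro mult_right_mono) auto
  also have "\<dots> < 1" using pos by (simp add: algebra_simps)
  finally have \<rho>: "0 < \<rho>" "\<rho> < 1" "\<Lambda> * (1 - m) \<le> \<rho>" by (auto simp: \<rho>_def)
  \<comment> \<open>The margin is divided into four factors \<theta>: one lets the number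
    \<open>r\<close> of hash values exceed \<Lambda>^b, one is spent on the key, and the other two
    leave a leakage of order \<theta>^(-2b).\<close>
  define \<theta> where "\<theta> = sqrt (sqrt (1 / \<rho>))"
  have "1 < 1 / \<rho>" using \<rho> by simp
  then have \<theta>: "1 < \<theta>" by (simp add: \<theta>_def)
  have "\<theta> ^ 4 = 1 / \<rho>"
  proof -
    have "\<theta> ^ 4 = ((\<theta>\<^sup>2)\<^sup>2)" by (simp flip: power_mult)
    also have "\<dots> = 1 / \<rho>" using \<rho> by (simp add: \<theta>_def)
    finally show ?thesis .
  qed
  then have "\<theta>\<^sup>2 * \<rho> = 1 / \<theta>\<^sup>2"
    using \<rho> \<theta> by (simp add: field_simps flip: power_add)
  also have "\<dots> \<le> 1 / \<theta>" using \<theta> by (intro divide_left_mono) (auto simp: power2_eq_square)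
  finally have \<theta>\<rho>: "\<theta>\<^sup>2 * \<rho> \<le> 1 / \<theta>" .
  define b where "b n = n div L" for n
  define r where "r n = nat \<lceil>(\<Lambda> * \<theta>) ^ b n\<rceil>" for n
  define K where "K n = nat \<lfloor>\<theta> ^ b n\<rfloor>" for n
  define \<eta> where "\<eta> n = \<Lambda> ^ b n / r n + real (r n * K n) * (1 - m) ^ b n" for n
  have \<Lambda>\<theta>: "1 \<le> (\<Lambda> * \<theta>) ^ b n" "1 \<le> \<theta> ^ b n" for n
    using mult_mono[of 1 \<Lambda> 1 \<theta>] \<Lambda> \<theta> by (auto intro!: one_le_power)
  have r_ge: "(\<Lambda> * \<theta>) ^ b n \<le> r n" for n unfolding r_def by linarith
  have r_le: "r n \<le> 2 * (\<Lambda> * \<theta>) ^ b n" for n using \<Lambda>\<theta>(1)[of n] unfolding r_def by linarith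
  have K_le: "K n \<le> \<theta> ^ b n" and K_ge: "\<theta> ^ b n / 2 \<le> K n" for n
  proof -
    have "1 \<le> \<lfloor>\<theta> ^ b n\<rfloor>" using \<Lambda>\<theta>(2)[of n] by simp
    then have "real (K n) = \<lfloor>\<theta> ^ b n\<rfloor>" "1 \<le> real_of_int \<lfloor>\<theta> ^ b n\<rfloor>" by (simp_all add: K_def)
    then show "K n \<le> \<theta> ^ b n" "\<theta> ^ b n / 2 \<le> K n" by linarith+
  qed
  have rK: "0 < r n" "0 < K n" for n
    using r_ge[of n] K_ge[of n] \<Lambda>\<theta>[of n] by (auto intro!: Nat.gr0I)
  have \<eta>_le: "\<eta> n \<le> 3 * (1 / \<theta>) ^ b n" for n
  proof -
    have "\<Lambda> ^ b n / r n \<le> \<Lambda> ^ b n / (\<Lambda> * \<theta>) ^ b n"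
      using r_ge[of n] \<Lambda>\<theta>(1)[of n] rK \<Lambda> by (intro divide_left_mono mult_pos_pos) auto
    also have "\<dots> = (1 / \<theta>) ^ b n" using \<Lambda> by (simp add: power_mult_distrib power_one_over field_simps)
    finally have 1: "\<Lambda> ^ b n / r n \<le> (1 / \<theta>) ^ b n" .
    have "real (r n * K n) * (1 - m) ^ b n \<le> (2 * (\<Lambda> * \<theta>) ^ b n * \<theta> ^ b n) * (1 - m) ^ b n"
      unfolding of_nat_mult using r_le[of n] K_le[of n] m_le_1 \<Lambda>\<theta>[of n]
      by (intro mult_right_mono mult_mono) auto
    also have "\<dots> = 2 * (\<theta>\<^sup>2 * (\<Lambda> * (1 - m))) ^ b n"
      by (simp add: power_mult_distrib power2_eq_square mult_ac)
    also have "\<dots> \<le> 2 * (1 / \<theta>) ^ b n"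
    proof -
      have "\<theta>\<^sup>2 * (\<Lambda> * (1 - m)) \<le> \<theta>\<^sup>2 * \<rho>" using \<rho> by (intro mult_left_mono) auto
      then have "\<theta>\<^sup>2 * (\<Lambda> * (1 - m)) \<le> 1 / \<theta>" using \<theta>\<rho> by linarith
      then show ?thesis using \<Lambda> m_le_1 by (intro mult_left_mono power_mono mult_nonneg_nonneg) auto
    qed
    finally show ?thesis using 1 by (simp add: \<eta>_def)
  qed
  have "filterlim b at_top sequentially" unfolding b_def
    using L by (intro filterlim_at_top[THEN iffD2] allI eventually_sequentiallyI)
      (simp add: less_eq_div_iff_mult_less_eq)
  then have "(\<lambda>n. 3 * (1 / \<theta>) ^ b n) \<longlonglongrightarrow> 3 * 0"
    using \<theta> by (intro tendsto_mult tendsto_const LIMSEQ_power_zero[THEN filterlim_compose]) auto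
  then have lim: "(\<lambda>n. 3 * (1 / \<theta>) ^ b n) \<longlonglongrightarrow> 0" by simp
  have "\<forall>n. \<exists>p. valid_key_protocol p \<and> ckeys p = K n \<and>
    measure_pmf.prob (run P n p) {(ka, kb, zs, f). ka \<noteq> kb} \<le> \<eta> n \<and>
    shannon_entropy (run P n p) (\<lambda>(ka, kb, zs, f). ka) \<le> log 2 (K n) \<and>
    0 \<le> mutual_inf (run P n p) (\<lambda>(ka, kb, zs, f). ka) (\<lambda>(ka, kb, zs, f). (zs, f)) \<and>
    log 2 (K n) - shannon_entropy (run P n p) (\<lambda>(ka, kb, zs, f). ka) +
      mutual_inf (run P n p) (\<lambda>(ka, kb, zs, f). ka) (\<lambda>(ka, kb, zs, f). (zs, f)) \<le> \<eta> n / ln 2"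
    by (intro allI filter_protocol_bounds[OF finP L Q fz rK x]) (simp add: \<eta>_def \<Lambda>_def b_def)
  then obtain p where p: "\<And>n. valid_key_protocol (p n)" "\<And>n. ckeys (p n) = K n"
    "\<And>n. measure_pmf.prob (run P n (p n)) {(ka, kb, zs, f). ka \<noteq> kb} \<le> \<eta> n"
    "\<And>n. shannon_entropy (run P n (p n)) (\<lambda>(ka, kb, zs, f). ka) \<le> log 2 (K n)"
    "\<And>n. 0 \<le> mutual_inf (run P n (p n)) (\<lambda>(ka, kb, zs, f). ka) (\<lambda>(ka, kb, zs, f). (zs, f))"
    "\<And>n. log 2 (K n) - shannon_entropy (run P n (p n)) (\<lambda>(ka, kb, zs, f). ka) +
      mutual_inf (run P n (p n)) (\<lambda>(ka, kb, zs, f). ka) (\<lambda>(ka, kb, zs, f). (zs, f)) \<le> \<eta> n / ln 2"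
    by metis
  have lim2: "(\<lambda>n. 3 * (1 / \<theta>) ^ b n / ln 2) \<longlonglongrightarrow> 0"
    using tendsto_divide[OF lim tendsto_const[of "ln 2"]] by simp
  have gap_le: "log 2 (K n) - shannon_entropy (run P n (p n)) (\<lambda>(ka, kb, zs, f). ka) +
      mutual_inf (run P n (p n)) (\<lambda>(ka, kb, zs, f). ka) (\<lambda>(ka, kb, zs, f). (zs, f)) \<le> 3 * (1 / \<theta>) ^ b n / ln 2" for n
    using p(6)[of n] divide_right_mono[OF \<eta>_le[of n], of "ln 2"] by simp
  have "admissible P p"
    unfolding admissible_def
  proof (intro conjI allI)
    show "valid_key_protocol (p n)" for n by (rule p)
    have eq: "measure_pmf.prob (run P n (p n)) {(ka, kb, zs, f). ka = kb} =
       1 - measure_pmf.prob (run P n (p n)) {(ka, kb, zs, f). ka \<noteq> kb}" for n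
    proof -
      have "{(ka, kb, zs, f). ka = kb} = UNIV - {(ka :: nat, kb, zs :: 'z list, f :: nat list). ka \<noteq> kb}"
        by auto
      then show ?thesis
        using measure_pmf.prob_compl[of "{(ka, kb, zs, f). ka \<noteq> kb}" "run P n (p n)"] by (simp only:) simp
    qed
    have "(\<lambda>n. measure_pmf.prob (run P n (p n)) {(ka, kb, zs, f). ka \<noteq> kb}) \<longlonglongrightarrow> 0"
      using order_trans[OF p(3) \<eta>_le]
      by (intro tendsto_sandwich[OF always_eventually always_eventually tendsto_const lim]) auto
    then have "(\<lambda>n. 1 - measure_pmf.prob (run P n (p n)) {(ka, kb, zs, f). ka \<noteq> kb}) \<longlonglongrightarrow> 1 - 0"
      by (intro tendsto_diff tendsto_const)
    then show "(\<lambda>n. measure_pmf.prob (run P n (p n)) {(ka, kb, zs, f). ka = kb}) \<longlonglongrightarrow> 1"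
      by (simp add: eq)
    show "(\<lambda>n. log 2 (real (ckeys (p n))) - shannon_entropy (run P n (p n)) (\<lambda>(ka, kb, zs, f). ka)) \<longlonglongrightarrow> 0"
    proof (rule tendsto_sandwich[OF always_eventually always_eventually tendsto_const lim2]; rule allI)
      fix n
      show "0 \<le> log 2 (real (ckeys (p n))) - shannon_entropy (run P n (p n)) (\<lambda>(ka, kb, zs, f). ka)"
        using p(4)[of n] p(2)[of n] by simp
      show "log 2 (real (ckeys (p n))) - shannon_entropy (run P n (p n)) (\<lambda>(ka, kb, zs, f). ka) \<le> 3 * (1 / \<theta>) ^ b n / ln 2"
        using gap_le[of n] p(5)[of n] p(2)[of n] by simp
    qed
    show "(\<lambda>n. mutual_inf (run P n (p n)) (\<lambda>(ka, kb, zs, f). ka) (\<lambda>(ka, kb, zs, f). (zs, f))) \<longlonglongrightarrow> 0"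
    proof (rule tendsto_sandwich[OF always_eventually always_eventually tendsto_const lim2]; rule allI)
      fix n
      show "0 \<le> mutual_inf (run P n (p n)) (\<lambda>(ka, kb, zs, f). ka) (\<lambda>(ka, kb, zs, f). (zs, f))"
        by (rule p)
      show "mutual_inf (run P n (p n)) (\<lambda>(ka, kb, zs, f). ka) (\<lambda>(ka, kb, zs, f). (zs, f)) \<le> 3 * (1 / \<theta>) ^ b n / ln 2"
        using gap_le[of n] p(4)[of n] by simp
    qed
  qed
  then have "rate (\<lambda>n. ckeys (p n)) \<le> secret_key_rate P"
    unfolding secret_key_rate_def by (intro SUP_upper) simp
  \<comment> \<open>The rate tends to log \<theta> / L; giving away half of it absorbs the rounding
    of \<open>K\<close> and the incomplete block.\<close>
  moreover have "ereal (log 2 \<theta> / (2 * L)) \<le> rate (\<lambda>n. ckeys (p n))"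
    unfolding rate_def
  proof (rule Liminf_bounded)
    define N where "N = nat \<lceil>2 * L * (log 2 \<theta> + 1) / log 2 \<theta>\<rceil>"
    have l: "0 < log 2 \<theta>" using \<theta> by simp
    have "ereal (log 2 \<theta> / (2 * L)) \<le> ereal (log 2 (ckeys (p n)) / n)" if n: "Suc N \<le> n" for n
    proof -
      have n0: "0 < real n" using n by simp
      have "2 * L * (log 2 \<theta> + 1) / log 2 \<theta> \<le> n" using n unfolding N_def by linarith
      then have big: "log 2 \<theta> + 1 \<le> n * log 2 \<theta> / (2 * L)" using l L by (simp add: field_simps)
      have "n = b n * L + n mod L" by (simp add: b_def)
      moreover have "n mod L < L" using L by simp
      ultimately have "n \<le> (b n + 1) * L" by simp
      then have "real n \<le> real ((b n + 1) * L)" by (simp only: of_nat_le_iff)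
      then have "n / L \<le> b n + 1" using L by (simp add: field_simps)
      then have "(n / L) * log 2 \<theta> \<le> (b n + 1) * log 2 \<theta>" using l by (intro mult_right_mono) auto
      then have "n * log 2 \<theta> / (2 * L) \<le> b n * log 2 \<theta> - 1"
      proof -
        have "(n / L) * log 2 \<theta> = 2 * (n * log 2 \<theta> / (2 * L))" by simp
        moreover have "(b n + 1) * log 2 \<theta> = b n * log 2 \<theta> + log 2 \<theta>" by (simp add: distrib_right)
        ultimately show ?thesis using big \<open>(n / L) * log 2 \<theta> \<le> (b n + 1) * log 2 \<theta>\<close> by linarith
      qed
      also have "\<dots> = log 2 (\<theta> ^ b n / 2)" using \<theta> by (simp add: log_divide log_nat_power)
      also have "\<dots> \<le> log 2 (K n)" using K_ge[of n] \<theta> rK[of n] by (subst log_le_cancel_iff) auto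
      finally have "n * log 2 \<theta> / (2 * L) \<le> log 2 (K n)" .
      then show ?thesis using n0 p(2)[of n] by (simp add: field_simps)
    qed
    then show "\<forall>\<^sub>F n in sequentially. ereal (log 2 \<theta> / (2 * L)) \<le> ereal (log 2 (ckeys (p n)) / n)"
      by (rule eventually_sequentiallyI)
  qed
  moreover have "0 < ereal (log 2 \<theta> / (2 * L))" using \<theta> L by simp
  ultimately show ?thesis by (metis order_less_le_trans)
qed

section \<open>Repetition and sums modulo three\<close>

definition joint :: "('u \<times> 'v \<times> 'e) pmf \<Rightarrow> ('u \<times> 'v) pmf" where
  "joint Q = map_pmf (\<lambda>(a, b, e). (a, b)) Q"

lemma joint_derived:
  "joint (derived P L fx fy fz) = map_pmf (\<lambda>v. (fx (map fst v), fy (map snd v))) (replicate_pmf L (joint P))"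
  by (simp add: joint_def derived_def map_pmf_comp comp_def case_prod_unfold flip: map_replicate_pmf)

lemma finite_joint: "finite (set_pmf Q) \<Longrightarrow> finite (set_pmf (joint Q))"
  by (simp add: joint_def)

lemma finite_derived: "finite (set_pmf P) \<Longrightarrow> finite (set_pmf (derived P L fx fy fz))"
  by (simp add: derived_def finite_set_replicate_pmf)

lemma pmf_map_ge: "pmf M w \<le> pmf (map_pmf f M) (f w)"
  unfolding pmf_map using measure_pmf.finite_measure_mono[of "{w}" "f -` {f w}" M]
  by (simp add: measure_pmf_single)

lemma pmf_map_le:
  assumes "\<And>w. w \<in> set_pmf M \<Longrightarrow> f w = y \<Longrightarrow> w = w0"
  shows "pmf (map_pmf f M) y \<le> pmf M w0"
proof -
  have "measure M (f -` {y}) \<le> measure M {w0}"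
    using assms by (intro measure_pmf.finite_measure_mono_AE) (auto simp: AE_measure_pmf_iff)
  then show ?thesis by (simp add: pmf_map measure_pmf_single)
qed

lemma pmf_derived_ge:
  assumes "length w = L" "fx (map fst w) = a" "fy (map (\<lambda>o'. fst (snd o')) w) = b"
    "fz (map (\<lambda>o'. snd (snd o')) w) = e"
  shows "prod_list (map (pmf P) w) \<le> pmf (derived P L fx fy fz) (a, b, e)"
  using pmf_map_ge[of "replicate_pmf L P" w "\<lambda>w. (fx (map (\<lambda>(x, y, z). x) w), fy (map (\<lambda>(x, y, z). y) w),
     fz (map (\<lambda>(x, y, z). z) w))"] assms
  by (simp add: derived_def pmf_replicate_pmf case_prod_unfold)

text \<open>Layers of local processing compose and Eve's map stays injective, so the three filters
  count as one application of \<open>derived\<close> to the original source.\<close>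

lemma derived_derived:
  "\<exists>fx'' fy'' fz''. derived (derived P L fx fy fz) L' fx' fy' fz' = derived P (L' * L) fx'' fy'' fz'' \<and>
     (inj_on fz {zs. length zs = L} \<longrightarrow> inj_on fz' {zs. length zs = L'} \<longrightarrow>
      inj_on fz'' {zs. length zs = L' * L})"
proof -
  let ?c = "\<lambda>f f' xs. f' (map f (chunks L L' xs))"
  let ?blk = "\<lambda>c. (fx (map (\<lambda>(x, y, z). x) c), fy (map (\<lambda>(x, y, z). y) c), fz (map (\<lambda>(x, y, z). z) c))"
  have "map_pmf (\<lambda>w. (chunks L L' w, drop (L' * L) w)) (replicate_pmf (L' * L + 0) P) =
     pair_pmf (replicate_pmf L' (replicate_pmf L P)) (replicate_pmf 0 P)" by (rule map_pmf_chunks)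
  then have "map_pmf fst (map_pmf (\<lambda>w. (chunks L L' w, drop (L' * L) w)) (replicate_pmf (L' * L) P)) =
     replicate_pmf L' (replicate_pmf L P)" by (simp add: map_fst_pair_pmf)
  then have R: "replicate_pmf L' (replicate_pmf L P) = map_pmf (chunks L L') (replicate_pmf (L' * L) P)"
    by (simp add: map_pmf_comp)
  have "derived (derived P L fx fy fz) L' fx' fy' fz' = derived P (L' * L) (?c fx fx') (?c fy fy') (?c fz fz')"
    unfolding derived_def map_replicate_pmf[symmetric] R
    by (simp add: map_pmf_comp chunks_map comp_def)
  moreover have "inj_on (?c fz fz') {zs. length zs = L' * L}"
    if i: "inj_on fz {zs. length zs = L}" and i': "inj_on fz' {zs. length zs = L'}"
  proof (rule inj_onI; clarify)
    fix u v assume len: "length u = L' * L" "length v = L' * L" and eq: "?c fz fz' u = ?c fz fz' v"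
    have "set (chunks L L' u) \<union> set (chunks L L' v) \<subseteq> {zs. length zs = L}"
      using length_in_chunks[of L' L u] length_in_chunks[of L' L v] len by auto
    then have inj: "inj_on fz (set (chunks L L' u) \<union> set (chunks L L' v))" using i inj_on_subset by blast
    have "map fz (chunks L L' u) = map fz (chunks L L' v)" using i' eq by (rule inj_onD) auto
    then have "chunks L L' u = chunks L L' v" using map_inj_on inj by blast
    then show "u = v" using len by (subst chunks_eq_iff[of _ _ L L']) simp
  qed
  ultimately show ?thesis by blast
qed

definition constant_value :: "'a list \<Rightarrow> 'a option" where
  "constant_value xs = (if xs \<noteq> [] \<and> set xs \<subseteq> {hd xs} then Some (hd xs) else None)"

lemma constant_value_Some: "constant_value xs = Some x \<Longrightarrow> xs = replicate (length xs) x"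
  by (auto simp: constant_value_def replicate_length_same[symmetric] subset_iff split: if_splits)

lemma constant_value_replicate [simp]: "0 < n \<Longrightarrow> constant_value (replicate n x) = Some x"
  by (cases n) (auto simp: constant_value_def)

text \<open>Two constant values determine both underlying words, so the fibre is a single word of
  pairs.\<close>

lemma pmf_joint_constant_value:
  "pmf (joint (derived P N constant_value constant_value fz)) (Some x, Some y) \<le> pmf (joint P) (x, y) ^ N"
proof -
  have "pmf (map_pmf (\<lambda>v. (constant_value (map fst v), constant_value (map snd v))) (replicate_pmf N (joint P)))
      (Some x, Some y) \<le> pmf (replicate_pmf N (joint P)) (replicate N (x, y))"
  proof (rule pmf_map_le)
    fix v assume v: "v \<in> set_pmf (replicate_pmf N (joint P))"
      and "(constant_value (map fst v), constant_value (map snd v)) = (Some x, Some y)"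
    then have "map fst v = replicate N x" "map snd v = replicate N y"
      using constant_value_Some[of "map fst v" x] constant_value_Some[of "map snd v" y] length_replicate_pmf[OF v]
      by auto
    then show "v = replicate N (x, y)" by (metis zip_map_fst_snd zip_replicate min.idem)
  qed
  then show ?thesis by (simp add: joint_derived pmf_replicate_pmf prod_list_replicate)
qed

section \<open>Sums modulo three: upper bounds for their joint law\<close>

definition add3 :: "nat option \<Rightarrow> nat option \<Rightarrow> nat option" where
  "add3 u s = (case (u, s) of (Some x, Some c) \<Rightarrow> Some ((x + c) mod 3) | _ \<Rightarrow> None)"

primrec sum3 :: "nat option list \<Rightarrow> nat option" where
  "sum3 [] = Some 0"
| "sum3 (u # us) = add3 u (sum3 us)"

lemma add3_Some: "add3 u s = Some a \<longleftrightarrow> (\<exists>x c. u = Some x \<and> s = Some c \<and> a = (x + c) mod 3)"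
  by (auto simp: add3_def split: option.splits)

lemma add3_Some_Some [simp]: "add3 (Some x) (Some c) = Some ((x + c) mod 3)"
  by (simp add: add3_def)

lemma sum3_less: "sum3 us = Some c \<Longrightarrow> c < 3"
  by (cases us) (auto simp: add3_Some)

text \<open>The weight of difference pattern \<open>k\<close>, relative to all symbols having \<open>Y = X + 1\<close>: here \<open>x\<close> and \<open>y\<close>
  are the relative weights of \<open>Y = X\<close> (which counts \<open>1\<close> towards \<open>k\<close>) and \<open>Y = X + 2\<close> (which counts
  \<open>- 1\<close>).\<close>

primrec pattern_weight :: "real \<Rightarrow> real \<Rightarrow> nat \<Rightarrow> nat \<Rightarrow> real" where
  "pattern_weight x y 0 k = of_bool (k = 0)"
| "pattern_weight x y (Suc n) k = pattern_weight x y n k + x * pattern_weight x y n ((k + 2) mod 3) +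
     y * pattern_weight x y n ((k + 1) mod 3)"

lemma pattern_weight_Suc:
  "pattern_weight x y (Suc n) 0 = pattern_weight x y n 0 + x * pattern_weight x y n 2 + y * pattern_weight x y n 1"
  "pattern_weight x y (Suc n) 1 = pattern_weight x y n 1 + x * pattern_weight x y n 0 + y * pattern_weight x y n 2"
  "pattern_weight x y (Suc n) 2 = pattern_weight x y n 2 + x * pattern_weight x y n 1 + y * pattern_weight x y n 0"
  by (simp_all add: numeral_2_eq_2)

text \<open>The three residues have total weight S^n. Residue 1 is charged to one letter of weight x
  or y; residue 2 to one letter of weight y, or to a pair of positions one of which has weight x,
  and n^2 / 2 bounds the number of pairs. This 1 / 2 is what makes the product of residues 0 and 2
  smaller than the square of residue 1.\<close>

lemma pattern_weight_bounds:
  assumes "0 \<le> x" "0 \<le> y"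
  defines "S \<equiv> 1 + x + y"
  shows "0 \<le> pattern_weight x y n k" and "k < 3 \<Longrightarrow> pattern_weight x y n k \<le> S ^ n"
    and "pattern_weight x y n 1 \<le> n * (x + y) * S ^ n"
    and "pattern_weight x y n 2 \<le> (x * (x + y) * real n ^ 2 / 2 + n * y) * S ^ n"
proof -
  have S: "1 \<le> S" using assms by simp
  show nonneg: "0 \<le> pattern_weight x y n k" for n k
    using assms by (induction n arbitrary: k) auto
  have total: "pattern_weight x y n 0 + pattern_weight x y n 1 + pattern_weight x y n 2 = S ^ n" for n
  proof (induction n)
    case (Suc n)
    have "pattern_weight x y (Suc n) 0 + pattern_weight x y (Suc n) 1 + pattern_weight x y (Suc n) 2 =
      S * (pattern_weight x y n 0 + pattern_weight x y n 1 + pattern_weight x y n 2)"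
      unfolding pattern_weight_Suc S_def by (simp only: algebra_simps)
    then show ?case by (simp only: Suc power_Suc)
  qed simp
  show le: "k < 3 \<Longrightarrow> pattern_weight x y n k \<le> S ^ n" for n k
    using total[of n] nonneg[of n 0] nonneg[of n 1] nonneg[of n 2]
    by (auto simp: less_Suc_eq numeral_3_eq_3 numeral_2_eq_2)
  have mono: "c * S ^ n \<le> c * S ^ Suc n" if "0 \<le> c" for c n
    using that S by (intro mult_left_mono power_increasing) auto
  show one: "pattern_weight x y n 1 \<le> n * (x + y) * S ^ n" for n
  proof (induction n)
    case (Suc n)
    have "pattern_weight x y (Suc n) 1 \<le> n * (x + y) * S ^ n + x * S ^ n + y * S ^ n"
      unfolding pattern_weight_Suc using Suc le[of 0 n] le[of 2 n] assms
      by (intro add_mono mult_left_mono) auto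
    also have "\<dots> = Suc n * (x + y) * S ^ n" by (simp add: algebra_simps)
    also have "\<dots> \<le> Suc n * (x + y) * S ^ Suc n" using assms by (intro mono) auto
    finally show ?case .
  qed simp
  show "pattern_weight x y n 2 \<le> (x * (x + y) * real n ^ 2 / 2 + n * y) * S ^ n" for n
  proof (induction n)
    case (Suc n)
    have "pattern_weight x y (Suc n) 2 \<le>
      (x * (x + y) * real n ^ 2 / 2 + n * y) * S ^ n + x * (n * (x + y) * S ^ n) + y * S ^ n"
      unfolding pattern_weight_Suc using Suc le[of 0 n] one[of n] assms
      by (intro add_mono mult_left_mono) auto
    also have "\<dots> = (x * (x + y) * (real n ^ 2 + 2 * n) / 2 + Suc n * y) * S ^ n"
      by (simp add: algebra_simps)
    also have "\<dots> \<le> (x * (x + y) * real (Suc n) ^ 2 / 2 + Suc n * y) * S ^ n"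
      using assms by (intro mult_right_mono add_mono divide_right_mono mult_left_mono) (auto simp: power2_eq_square algebra_simps)
    also have "\<dots> \<le> (x * (x + y) * real (Suc n) ^ 2 / 2 + Suc n * y) * S ^ Suc n"
      using assms by (intro mono) auto
    finally show ?case .
  qed simp
qed

abbreviation sum3_law :: "(nat option \<times> nat option) pmf \<Rightarrow> nat \<Rightarrow> (nat option \<times> nat option) pmf" where
  "sum3_law J n \<equiv> map_pmf (\<lambda>v. (sum3 (map fst v), sum3 (map snd v))) (replicate_pmf n J)"

text \<open>Convolution over the first letter: if it is (x, y), the others must sum to a - x and b -
  y, and subtraction modulo 3 is written as adding 2 x and 2 y. The vanishing of \<open>V\<close>
  restricts the sum to values below 3.\<close>

lemma sum3_law_Suc:
  assumes fin: "finite (set_pmf J)"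
    and J: "\<And>x y. pmf J (Some x, Some y) \<le> V x y" "\<And>x y. 3 \<le> x \<or> 3 \<le> y \<Longrightarrow> V x y = 0"
    and a: "a < 3" "b < 3"
  shows "pmf (sum3_law J (Suc n)) (Some a, Some b) \<le>
    (\<Sum>x<3. \<Sum>y<3. V x y * pmf (sum3_law J n) (Some ((a + 2 * x) mod 3), Some ((b + 2 * y) mod 3)))"
proof -
  let ?D = "sum3_law J n"
  let ?g = "\<lambda>z. (add3 (fst (fst z)) (fst (snd z)), add3 (snd (fst z)) (snd (snd z)))"
  let ?i = "\<lambda>(x, y). ((Some x, Some y), (Some ((a + 2 * x) mod 3), Some ((b + 2 * y) mod 3)))"
  have "sum3_law J (Suc n) = map_pmf ?g (map_pmf (\<lambda>(q, z). (q, sum3 (map fst z), sum3 (map snd z))) (pair_pmf J (replicate_pmf n J)))"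
    unfolding replicate_pmf_Suc_pair by (simp add: map_pmf_comp case_prod_unfold)
  also have "\<dots> = map_pmf ?g (pair_pmf J ?D)"
    using map_pair[of "\<lambda>q. q" "\<lambda>z. (sum3 (map fst z), sum3 (map snd z))" J "replicate_pmf n J"] by simp
  finally have eq: "sum3_law J (Suc n) = map_pmf ?g (pair_pmf J ?D)" .
  have finD: "finite (set_pmf (pair_pmf J ?D))"
    using fin by (simp add: finite_set_replicate_pmf)
  have J0: "pmf J (Some x, Some y) = 0" if "3 \<le> x \<or> 3 \<le> y" for x y
    using J(1)[of x y] J(2)[OF that] pmf_nonneg[of J "(Some x, Some y)"] by linarith
  have "pmf (sum3_law J (Suc n)) (Some a, Some b) =
     (\<Sum>z\<in>set_pmf (pair_pmf J ?D). if ?g z = (Some a, Some b) then pmf (pair_pmf J ?D) z else 0)"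
    unfolding eq by (rule pmf_map_sum[OF finD])
  also have "\<dots> = (\<Sum>z\<in>{z \<in> set_pmf (pair_pmf J ?D). ?g z = (Some a, Some b)}. pmf (pair_pmf J ?D) z)"
    using finD by (simp add: sum.inter_filter)
  also have "\<dots> \<le> (\<Sum>z\<in>?i ` ({..<3} \<times> {..<3}). pmf (pair_pmf J ?D) z)"
  proof (rule sum_mono2)
    show "{z \<in> set_pmf (pair_pmf J ?D). ?g z = (Some a, Some b)} \<subseteq> ?i ` ({..<3} \<times> {..<3})"
    proof (rule subsetI)
      fix w assume w: "w \<in> {z \<in> set_pmf (pair_pmf J ?D). ?g z = (Some a, Some b)}"
      obtain u u' s s' where w_eq: "w = ((u, u'), (s, s'))" by (metis prod.exhaust)
      have z: "((u, u'), (s, s')) \<in> set_pmf (pair_pmf J ?D)"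
        and g: "?g ((u, u'), (s, s')) = (Some a, Some b)" using w by (simp_all only: w_eq mem_Collect_eq)
      obtain x y c d where *: "u = Some x" "u' = Some y" "s = Some c" "s' = Some d"
        "a = (x + c) mod 3" "b = (y + d) mod 3"
        using g by (auto simp: add3_Some)
      have "\<not> (3 \<le> x \<or> 3 \<le> y)"
        using z J0[of x y] by (auto simp only: * set_pair_pmf set_pmf_iff mem_Times_iff fst_conv snd_conv)
      then have "x < 3" "y < 3" by auto
      moreover have "c < 3" "d < 3" using z sum3_less by (auto simp: *)
      moreover have "c = ((x + c) mod 3 + 2 * x) mod 3" if "c < 3" for x c :: nat
      proof -
        have "((x + c) mod 3 + 2 * x) mod 3 = (c + 3 * x) mod 3" by (simp add: mod_simps algebra_simps)
        then show ?thesis using that by simp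
      qed
      ultimately show "w \<in> ?i ` ({..<3} \<times> {..<3})"
        by (intro image_eqI[of _ _ "(x, y)"]) (simp_all add: w_eq *)
    qed
  qed auto
  also have "\<dots> = (\<Sum>(x, y)\<in>{..<3} \<times> {..<3}. pmf (pair_pmf J ?D) (?i (x, y)))"
    by (subst sum.reindex) (auto simp: inj_on_def intro!: sum.cong)
  also have "\<dots> = (\<Sum>x<3. \<Sum>y<3. pmf J (Some x, Some y) * pmf ?D (Some ((a + 2 * x) mod 3), Some ((b + 2 * y) mod 3)))"
    by (simp add: sum.cartesian_product pmf_pair)
  also have "\<dots> \<le> (\<Sum>x<3. \<Sum>y<3. V x y * pmf ?D (Some ((a + 2 * x) mod 3), Some ((b + 2 * y) mod 3)))"
    using J by (intro sum_mono mult_right_mono) auto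
  finally show ?thesis .
qed

lemma sum_mod3_shift: "(\<Sum>x<3::nat. \<Sum>y<3::nat. h ((1 + x + 2 * y) mod 3)) = 3 * (h 0 + h 1 + h 2 :: real)"
proof -
  have "{..<3::nat} = {0, 1, 2}" by auto
  then show ?thesis by (simp add: numeral_2_eq_2)
qed

lemma mod3_add: "(m + u mod 3 + 2 * (v mod 3)) mod 3 = (m + u + 2 * v) mod (3 :: nat)"
proof -
  have "m + u + 2 * v = m + (u mod 3 + u div 3 * 3) + 2 * (v mod 3 + v div 3 * 3)"
    by (simp only: mod_div_mult_eq)
  also have "\<dots> = (m + u mod 3 + 2 * (v mod 3)) + (u div 3 + 2 * (v div 3)) * 3"
    by (simp only: distrib_left distrib_right mult_ac add_ac)
  finally show ?thesis by (simp only: mod_mult_self1)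
qed

text \<open>The index is the number of letters minus the total difference b - a, modulo 3, so that
  letters with Y = X + 1 contribute 0 to it. A pattern of n + 1 differences is compatible with 3^n
  choices of Alice's letters of sum a, whence the leading factor.\<close>

lemma sum3_law_le:
  assumes fin: "finite (set_pmf J)" and v: "0 < v0" "0 \<le> x" "0 \<le> y"
    and J: "\<And>a b. pmf J (Some a, Some b) \<le> V a b" "\<And>a b. 3 \<le> a \<or> 3 \<le> b \<Longrightarrow> V a b = 0"
    and V: "\<And>a b. a < 3 \<Longrightarrow> b < 3 \<Longrightarrow> V a b = v0 * pattern_weight x y 1 ((1 + a + 2 * b) mod 3)"
    and a: "a < 3" "b < 3"
  shows "pmf (sum3_law J (Suc n)) (Some a, Some b) \<le>
    3 ^ n * v0 ^ Suc n * pattern_weight x y (Suc n) ((Suc n + a + 2 * b) mod 3)"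
  using a
proof (induction n arbitrary: a b)
  case 0
  have "(a + 2 * x) mod 3 = 0 \<longleftrightarrow> x = a" if "x < 3" "a < 3" for x a :: nat
  proof -
    have "x \<in> {0, 1, 2}" "a \<in> {0, 1, 2}" using that by auto
    then show ?thesis by (elim insertE emptyE) simp_all
  qed
  then have "(\<Sum>x<3. \<Sum>y<3. V x y * pmf (sum3_law J 0) (Some ((a + 2 * x) mod 3), Some ((b + 2 * y) mod 3))) =
    (\<Sum>x<3. \<Sum>y<3. if x = a then (if y = b then V a b else 0) else 0)"
    using 0 by (intro sum.cong refl) (auto simp: pmf_return indicator_def)
  also have "\<dots> = (\<Sum>x<3. if x = a then V a b else 0)"
    using 0 by (intro sum.cong refl) (auto simp: sum.delta)
  also have "\<dots> = V a b" using 0 by (simp add: sum.delta)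
  finally have "pmf (sum3_law J (Suc 0)) (Some a, Some b) \<le> V a b"
    using sum3_law_Suc[OF fin J 0, of 0] by simp
  then show ?case using V[OF 0] by simp
next
  case (Suc n)
  let ?B = "\<lambda>m k. 3 ^ n * v0 ^ Suc n * pattern_weight x y m k"
  let ?k = "(Suc (Suc n) + a + 2 * b) mod 3"
  \<comment> \<open>Adding 2 i subtracts i modulo 3: the first letter has index i and the others
    supply the rest of \<open>?k\<close>.\<close>
  define h where "h i = v0 * pattern_weight x y 1 i * ?B (Suc n) ((?k + 2 * i) mod 3)" for i
  have "pmf (sum3_law J (Suc (Suc n))) (Some a, Some b) \<le>
     (\<Sum>c<3. \<Sum>d<3. V c d * pmf (sum3_law J (Suc n)) (Some ((a + 2 * c) mod 3), Some ((b + 2 * d) mod 3)))"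
    by (rule sum3_law_Suc[OF fin J Suc.prems])
  also have "\<dots> \<le> (\<Sum>c<3. \<Sum>d<3. h ((1 + c + 2 * d) mod 3))"
  proof (intro sum_mono)
    fix c d :: nat assume "c \<in> {..<3}" "d \<in> {..<3}"
    then have cd: "c < 3" "d < 3" by auto
    have "(Suc n + (a + 2 * c) mod 3 + 2 * ((b + 2 * d) mod 3)) mod 3 = (?k + 2 * ((1 + c + 2 * d) mod 3)) mod 3"
    proof -
      have "(?k + 2 * ((1 + c + 2 * d) mod 3)) mod 3 = (Suc (Suc n) + a + 2 * b + 2 * (1 + c + 2 * d)) mod 3"
        using mod3_add[of 0] by simp
      also have "Suc (Suc n) + a + 2 * b + 2 * (1 + c + 2 * d) = (Suc n + (a + 2 * c) + 2 * (b + 2 * d)) + 3" by simp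
      also have "\<dots> mod 3 = (Suc n + (a + 2 * c) mod 3 + 2 * ((b + 2 * d) mod 3)) mod 3"
        unfolding mod3_add by (rule mod_add_self2)
      finally show ?thesis by (rule sym)
    qed
    then have "pmf (sum3_law J (Suc n)) (Some ((a + 2 * c) mod 3), Some ((b + 2 * d) mod 3)) \<le>
       ?B (Suc n) ((?k + 2 * ((1 + c + 2 * d) mod 3)) mod 3)"
      using Suc.IH[of "(a + 2 * c) mod 3" "(b + 2 * d) mod 3"] by simp
    then show "V c d * pmf (sum3_law J (Suc n)) (Some ((a + 2 * c) mod 3), Some ((b + 2 * d) mod 3)) \<le>
      h ((1 + c + 2 * d) mod 3)"
      using v pattern_weight_bounds(1)[OF v(2,3), of 1 "(1 + c + 2 * d) mod 3"] unfolding V[OF cd] h_def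
      by (intro mult_left_mono) (auto intro!: mult_nonneg_nonneg simp del: pattern_weight.simps)
  qed
  also have "\<dots> = 3 ^ Suc n * v0 ^ Suc (Suc n) * (pattern_weight x y (Suc n) ?k +
      x * pattern_weight x y (Suc n) ((?k + 2) mod 3) + y * pattern_weight x y (Suc n) ((?k + 4) mod 3))"
  proof -
    have "pattern_weight x y 1 0 = 1" "pattern_weight x y 1 1 = x" "pattern_weight x y 1 2 = y"
      by (simp_all add: numeral_2_eq_2)
    then have h: "h 0 = v0 * ?B (Suc n) ?k" "h 1 = v0 * (x * ?B (Suc n) ((?k + 2) mod 3))"
      "h 2 = v0 * (y * ?B (Suc n) ((?k + 4) mod 3))"
      unfolding h_def by simp_all
    have "(\<Sum>c<3. \<Sum>d<3. h ((1 + c + 2 * d) mod 3)) = 3 * (h 0 + h 1 + h 2)" by (rule sum_mod3_shift)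
    also have "\<dots> = 3 ^ Suc n * v0 ^ Suc (Suc n) * (pattern_weight x y (Suc n) ?k +
      x * pattern_weight x y (Suc n) ((?k + 2) mod 3) + y * pattern_weight x y (Suc n) ((?k + 4) mod 3))"
      unfolding h power_Suc by (simp only: algebra_simps)
    finally show ?thesis .
  qed
  also have "(?k + 4) mod 3 = (?k + 1) mod 3"
  proof -
    have "(j + 4) mod 3 = (j + 1) mod 3" for j :: nat by presburger
    then show ?thesis .
  qed
  finally show ?case unfolding pattern_weight.simps(2)[of x y "Suc n"] .
qed

section \<open>Eve's words that leave the sum undetermined: lower bounds\<close>

lemma prod_list_ge_power:
  fixes f :: "'a \<Rightarrow> real"
  assumes "0 \<le> \<mu>" "\<And>x. x \<in> set xs \<Longrightarrow> \<mu> \<le> f x"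
  shows "\<mu> ^ length xs \<le> prod_list (map f xs)"
  using assms
proof (induction xs)
  case (Cons x xs)
  have "\<mu> \<le> f x" using Cons.prems by simp
  then show ?case using Cons by (auto intro!: mult_mono intro: order_trans[of 0 \<mu>])
qed simp

text \<open>Eve's views in which exactly one letter is \<open>d\<close>, the others being of the form \<open>\<epsilon> x\<close>.\<close>

primrec plain_views :: "(nat \<Rightarrow> 'e) \<Rightarrow> nat \<Rightarrow> 'e list set" where
  "plain_views \<epsilon> 0 = {[]}"
| "plain_views \<epsilon> (Suc n) = (\<lambda>(x, e). \<epsilon> x # e) ` ({..<3} \<times> plain_views \<epsilon> n)"

primrec single_views :: "(nat \<Rightarrow> 'e) \<Rightarrow> 'e \<Rightarrow> nat \<Rightarrow> 'e list set" where
  "single_views \<epsilon> d 0 = {}"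
| "single_views \<epsilon> d (Suc n) = (#) d ` plain_views \<epsilon> n \<union> (\<lambda>(x, e). \<epsilon> x # e) ` ({..<3} \<times> single_views \<epsilon> d n)"

lemma card_plain_views:
  assumes "inj \<epsilon>"
  shows "finite (plain_views \<epsilon> n) \<and> card (plain_views \<epsilon> n) = 3 ^ n"
proof (induction n)
  case (Suc n)
  have "inj_on (\<lambda>(x, e). \<epsilon> x # e) ({..<3} \<times> plain_views \<epsilon> n)"
    by (auto intro!: inj_onI dest: injD[OF assms])
  then show ?case using Suc by (simp add: card_image card_cartesian_product)
qed simp

text \<open>There are n places for \<open>d\<close> and 3^(n - 1) choices for the other letters; the
  factor 3 avoids the exponent n - 1 at n = 0.\<close>

lemma card_single_views:
  assumes "inj \<epsilon>" "d \<notin> range \<epsilon>"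
  shows "finite (single_views \<epsilon> d n) \<and> 3 * card (single_views \<epsilon> d n) = n * 3 ^ n"
proof (induction n)
  case (Suc n)
  have "inj_on (\<lambda>(x, e). \<epsilon> x # e) ({..<3} \<times> single_views \<epsilon> d n)"
    by (auto intro!: inj_onI dest: injD[OF assms(1)])
  moreover have "(#) d ` plain_views \<epsilon> n \<inter> (\<lambda>(x, e). \<epsilon> x # e) ` ({..<3} \<times> single_views \<epsilon> d n) = {}"
    using assms(2) by auto
  ultimately show ?case
    using Suc card_plain_views[OF assms(1), of n]
    by (simp add: card_Un_disjoint card_image card_cartesian_product)
qed simp

text \<open>Each letter of the view dictates a letter of the word, so \<open>c\<close> is whatever
  these letters add up to. In \<open>single_views_witness\<close> the sum can be prescribed
  instead.\<close>

lemma plain_views_witness: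
  fixes J :: "(nat option \<times> nat option \<times> 'e) pmf"
  assumes "0 \<le> v0" "\<And>x. x < 3 \<Longrightarrow> v0 \<le> pmf J (Some x, Some ((x + 1) mod 3), \<epsilon> x)"
    and "e \<in> plain_views \<epsilon> n"
  shows "\<exists>c<3. \<exists>w. length w = n \<and> sum3 (map fst w) = Some c \<and>
      sum3 (map (\<lambda>o'. fst (snd o')) w) = Some ((c + n) mod 3) \<and> map (\<lambda>o'. snd (snd o')) w = e \<and>
      v0 ^ n \<le> prod_list (map (pmf J) w)"
  using assms(3)
proof (induction n arbitrary: e)
    case (Suc n)
    then obtain x e' where e: "e = \<epsilon> x # e'" "x < 3" "e' \<in> plain_views \<epsilon> n" by auto
    obtain c w where w: "length w = n" "sum3 (map fst w) = Some c"
      "sum3 (map (\<lambda>o'. fst (snd o')) w) = Some ((c + n) mod 3)" "map (\<lambda>o'. snd (snd o')) w = e'"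
      "v0 ^ n \<le> prod_list (map (pmf J) w)" using Suc.IH[OF e(3)] by blast
    have "((x + 1) mod 3 + (c + n) mod 3) mod 3 = ((x + 1) + (c + n)) mod 3" by (rule mod_add_eq)
    also have "(x + 1) + (c + n) = (x + c) + Suc n" by simp
    also have "\<dots> mod 3 = ((x + c) mod 3 + Suc n) mod 3" by (rule mod_add_left_eq[symmetric])
    finally have "((x + 1) mod 3 + (c + n) mod 3) mod 3 = ((x + c) mod 3 + Suc n) mod 3" .
    moreover have "v0 ^ Suc n \<le> pmf J (Some x, Some ((x + 1) mod 3), \<epsilon> x) * prod_list (map (pmf J) w)"
      using assms(2)[OF e(2)] w(5) assms(1) by (auto intro!: mult_mono)
    ultimately show ?case
      by (intro exI[of _ "(x + c) mod 3"] conjI exI[of _ "(Some x, Some ((x + 1) mod 3), \<epsilon> x) # w"]) (simp_all add: w e)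
  qed simp

text \<open>The letter \<open>d\<close> is compatible with every common value of X and Y, and this
  value can be adjusted so that Alice's sum is any prescribed \<open>a\<close>. Bob's sum then
  follows at distance n - 1, written as n + 2 modulo 3. This freedom is the source of the
  secrecy.\<close>

lemma single_views_witness:
  fixes J :: "(nat option \<times> nat option \<times> 'e) pmf"
  assumes v: "0 \<le> v0" "0 \<le> v1"
    and J: "\<And>x. x < 3 \<Longrightarrow> v0 \<le> pmf J (Some x, Some ((x + 1) mod 3), \<epsilon> x)"
      "\<And>x. x < 3 \<Longrightarrow> v1 \<le> pmf J (Some x, Some x, d)"
    and "e \<in> single_views \<epsilon> d n" "a < 3"
  shows "\<exists>w. length w = n \<and> sum3 (map fst w) = Some a \<and>
      sum3 (map (\<lambda>o'. fst (snd o')) w) = Some ((a + n + 2) mod 3) \<and> map (\<lambda>o'. snd (snd o')) w = e \<and>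
      v1 * v0 ^ (n - 1) \<le> prod_list (map (pmf J) w)"
  using assms(5,6)
proof (induction n arbitrary: e a)
    case (Suc n)
    from Suc.prems(1) consider e' where "e = d # e'" "e' \<in> plain_views \<epsilon> n"
      | x e' where "e = \<epsilon> x # e'" "x < 3" "e' \<in> single_views \<epsilon> d n" by auto
    then show ?case
    proof cases
      case 1
      obtain c w where c: "c < 3" and w: "length w = n" "sum3 (map fst w) = Some c"
        "sum3 (map (\<lambda>o'. fst (snd o')) w) = Some ((c + n) mod 3)" "map (\<lambda>o'. snd (snd o')) w = e'"
        "v0 ^ n \<le> prod_list (map (pmf J) w)" using plain_views_witness[OF v(1) J(1) 1(2)] by blast
      \<comment> \<open>The value hidden behind \<open>d\<close>, solving x + c = a modulo
        3.\<close>
      define x where "x = (a + 2 * c) mod 3"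
      have x: "x < 3" by (simp add: x_def)
      have "(x + c) mod 3 = (a + 3 * c) mod 3" unfolding x_def by (simp add: mod_simps add_ac)
      then have xa: "(x + c) mod 3 = a" using Suc.prems by simp
      have "(x + (c + n) mod 3) mod 3 = ((x + c) mod 3 + n) mod 3" by (simp add: mod_simps add_ac)
      also have "\<dots> = (a + n + 3) mod 3" unfolding xa by simp
      finally have "(x + (c + n) mod 3) mod 3 = (a + Suc n + 2) mod 3" by simp
      moreover have "v1 * v0 ^ n \<le> pmf J (Some x, Some x, d) * prod_list (map (pmf J) w)"
        using J(2)[OF x] w(5) v by (auto intro!: mult_mono)
      ultimately show ?thesis
        by (intro exI[of _ "(Some x, Some x, d) # w"]) (simp add: w 1 xa)
    next
      case 2
      define a' where "a' = (a + 2 * x) mod 3"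
      have a': "a' < 3" by (simp add: a'_def)
      obtain w where w: "length w = n" "sum3 (map fst w) = Some a'"
        "sum3 (map (\<lambda>o'. fst (snd o')) w) = Some ((a' + n + 2) mod 3)" "map (\<lambda>o'. snd (snd o')) w = e'"
        "v1 * v0 ^ (n - 1) \<le> prod_list (map (pmf J) w)" using Suc.IH[OF 2(3) a'] by blast
      have "(x + a') mod 3 = (a + 3 * x) mod 3" unfolding a'_def by (simp add: mod_simps add_ac)
      then have xa: "(x + a') mod 3 = a" using Suc.prems by simp
      have "((x + 1) mod 3 + (a' + n + 2) mod 3) mod 3 = ((x + 1) + (a' + n + 2)) mod 3" by (rule mod_add_eq)
      also have "(x + 1) + (a' + n + 2) = (x + a') + (n + 3)" by simp
      also have "\<dots> mod 3 = ((x + a') mod 3 + (n + 3)) mod 3" by (rule mod_add_left_eq[symmetric])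
      also have "(x + a') mod 3 + (n + 3) = a + Suc n + 2" unfolding xa by simp
      finally have "((x + 1) mod 3 + (a' + n + 2) mod 3) mod 3 = (a + Suc n + 2) mod 3" .
      moreover have "v1 * v0 ^ (Suc n - 1) \<le> pmf J (Some x, Some ((x + 1) mod 3), \<epsilon> x) * prod_list (map (pmf J) w)"
      proof -
        have "n \<noteq> 0" using 2(3) by (cases n) auto
        then have "v1 * v0 ^ (Suc n - 1) = v0 * (v1 * v0 ^ (n - 1))" by (cases n) auto
        also have "\<dots> \<le> pmf J (Some x, Some ((x + 1) mod 3), \<epsilon> x) * prod_list (map (pmf J) w)"
          using J(1)[OF 2(2)] w(5) v by (intro mult_mono) auto
        finally show ?thesis .
      qed
      ultimately show ?thesis
        by (intro exI[of _ "(Some x, Some ((x + 1) mod 3), \<epsilon> x) # w"]) (simp add: w 2 xa)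
    qed
qed simp

section \<open>The Horodecki source\<close>

definition two_block_word :: "nat \<Rightarrow> nat \<Rightarrow> nat \<Rightarrow> nat list" where
  "two_block_word M s t = replicate M s @ replicate M t"

definition word_bit :: "nat \<Rightarrow> nat \<Rightarrow> nat \<Rightarrow> nat option list \<Rightarrow> bool option" where
  "word_bit M s t us = (if us = map Some (two_block_word M s t) then Some False
     else if us = map Some (two_block_word M t s) then Some True else None)"

abbreviation bit_word :: "nat \<Rightarrow> nat \<Rightarrow> nat \<Rightarrow> bool \<Rightarrow> nat list" where
  "bit_word M s t i \<equiv> (if i then two_block_word M t s else two_block_word M s t)"

lemma two_block_word_eq_iff: "0 < M \<Longrightarrow> two_block_word M s t = two_block_word M s' t' \<longleftrightarrow> s = s' \<and> t = t'"
  by (auto simp: two_block_word_def replicate_eq_replicate)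

lemma word_bit_Some_iff:
  assumes "0 < M" "s \<noteq> t"
  shows "word_bit M s t us = Some i \<longleftrightarrow> us = map Some (bit_word M s t i)"
  using assms by (auto simp: word_bit_def two_block_word_eq_iff inj_map_eq_map)

text \<open>Equal bits align s with s' and t with t'; different bits align s with t' and t with s'.
  A wrong bit has to pay for both misalignments, so the product of their weights counts and not the
  larger one. This is why a bit is encoded by the order of two blocks.\<close>

lemma pmf_joint_word_bit:
  assumes M: "0 < M" and st: "s \<noteq> t" "s' \<noteq> t'"
  shows "pmf (joint (derived Q (2 * M) (word_bit M s t) (word_bit M s' t') fz)) (Some i, Some j) \<le>
    (pmf (joint Q) (Some s, Some (if i = j then s' else t')) * pmf (joint Q) (Some t, Some (if i = j then t' else s'))) ^ M"
proof -
  let ?u = "zip (map Some (bit_word M s t i)) (map Some (bit_word M s' t' j))"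
  have "pmf (joint (derived Q (2 * M) (word_bit M s t) (word_bit M s' t') fz)) (Some i, Some j) \<le>
    pmf (replicate_pmf (2 * M) (joint Q)) ?u"
    unfolding joint_derived
  proof (rule pmf_map_le)
    fix v assume "(word_bit M s t (map fst v), word_bit M s' t' (map snd v)) = (Some i, Some j)"
    then have "map fst v = map Some (bit_word M s t i)" "map snd v = map Some (bit_word M s' t' j)"
      using word_bit_Some_iff[OF M] st by auto
    then show "v = ?u" by (metis zip_map_fst_snd)
  qed
  also have "pmf (replicate_pmf (2 * M) (joint Q)) ?u = prod_list (map (pmf (joint Q)) ?u)"
    by (rule pmf_replicate_pmf) (simp add: two_block_word_def)
  also have "\<dots> = (pmf (joint Q) (Some s, Some (if i = j then s' else t')) *
      pmf (joint Q) (Some t, Some (if i = j then t' else s'))) ^ M"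
    by (auto simp: two_block_word_def zip_append zip_replicate prod_list_replicate power_mult_distrib)
  finally show ?thesis .
qed

lemma prob_accepted_le:
  fixes Q :: "(bool option \<times> bool option \<times> 'e) pmf"
  assumes "\<And>i j. pmf (joint Q) (Some i, Some j) \<le> (if i = j then u else v)"
  shows "measure_pmf.prob Q {q. accepted q} \<le> 2 * (u + v)"
    "measure_pmf.prob Q {q. accepted q \<and> bit_A q \<noteq> bit_B q} \<le> 2 * v"
proof -
  let ?S = "{(Some False, Some False), (Some True, Some True)} :: (bool option \<times> bool option) set"
  let ?D = "{(Some False, Some True), (Some True, Some False)} :: (bool option \<times> bool option) set"
  have joint: "measure_pmf.prob Q {q. (\<lambda>(a, b, e). (a, b)) q \<in> T} = measure_pmf.prob (joint Q) T" for T
    by (simp add: joint_def vimage_def)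
  have sum: "measure_pmf.prob (joint Q) T = (\<Sum>z\<in>T. pmf (joint Q) z)" if "finite T" for T
    using that by (rule measure_measure_pmf_finite)
  have "{q :: bool option \<times> bool option \<times> 'e. accepted q} = {q. (\<lambda>(a, b, e). (a, b)) q \<in> ?S \<union> ?D}"
    by (auto simp: accepted_def)
  then have "measure_pmf.prob Q {q. accepted q} = measure_pmf.prob (joint Q) (?S \<union> ?D)" by (simp only: joint)
  also have "\<dots> = (\<Sum>z\<in>?S \<union> ?D. pmf (joint Q) z)" by (rule sum) simp
  also have "\<dots> \<le> 2 * (u + v)"
    using assms[of False False] assms[of True True] assms[of False True] assms[of True False] by simp
  finally show "measure_pmf.prob Q {q. accepted q} \<le> 2 * (u + v)" .
  have "{q :: bool option \<times> bool option \<times> 'e. accepted q \<and> bit_A q \<noteq> bit_B q} = {q. (\<lambda>(a, b, e). (a, b)) q \<in> ?D}"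
    by (auto simp: accepted_def bit_A_def bit_B_def)
  then have "measure_pmf.prob Q {q. accepted q \<and> bit_A q \<noteq> bit_B q} = measure_pmf.prob (joint Q) ?D"
    by (simp only: joint)
  also have "\<dots> = (\<Sum>z\<in>?D. pmf (joint Q) z)" by (rule sum) simp
  also have "\<dots> \<le> 2 * v"
    using assms[of False True] assms[of True False] by simp
  finally show "measure_pmf.prob Q {q. accepted q \<and> bit_A q \<noteq> bit_B q} \<le> 2 * v" .
qed

text \<open>The 16 is the factor 4 of the gap criterion times a factor 2 in each of
  \<open>acc\<close> and \<open>err\<close>. The exponents belong to blocks of length 10: a wrong
  bit then has relative weight about 2^(-10), which beats 16 with room for the error terms.\<close>

lemma filter_parameters:
  fixes \<alpha> :: real
  assumes "3 < \<alpha>" "\<alpha> \<le> 5"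
  obtains N n where "0 < N" "0 < n"
    "\<And>f. f = pattern_weight ((2 / \<alpha>) ^ N) (((5 - \<alpha>) / \<alpha>) ^ N) n \<Longrightarrow>
      16 * (f 1 ^ 20 + (f 0 * f 2) ^ 10) * (f 0 * f 2) ^ 10 < (n * (2 / \<alpha>) ^ N) ^ 40"
proof -
  \<comment> \<open>The ratio of the weights of Y = X + 2 and Y = X; it is below 1 because 3 <
    \<alpha>.\<close>
  define r where "r = (5 - \<alpha>) / 2"
  have r: "0 \<le> r" "r < 1" and \<alpha>: "0 < 2 / \<alpha>" "2 / \<alpha> < 1" using assms by (auto simp: r_def)
  have lim: "(\<lambda>N. r ^ N) \<longlonglongrightarrow> 0" "(\<lambda>N. (2 / \<alpha>) ^ N) \<longlonglongrightarrow> 0"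
    using r \<alpha> by (auto intro!: LIMSEQ_power_zero)
  have "\<forall>\<^sub>F N in sequentially. r ^ N < 1 / 10000" "\<forall>\<^sub>F N in sequentially. (2 / \<alpha>) ^ N < 4 / 1000"
    by (rule order_tendstoD(2)[OF lim(1)], simp) (rule order_tendstoD(2)[OF lim(2)], simp)
  then have "\<forall>\<^sub>F N in sequentially. r ^ N < 1 / 10000 \<and> (2 / \<alpha>) ^ N < 4 / 1000 \<and> 0 < N"
    using eventually_gt_at_top[of 0] by eventually_elim simp
  then obtain N where N: "r ^ N < 1 / 10000" "(2 / \<alpha>) ^ N < 4 / 1000" "0 < N"
    using eventually_happens by fastforce
  define x where "x = (2 / \<alpha>) ^ N"
  define \<epsilon> where "\<epsilon> = r ^ N"
  define y where "y = ((5 - \<alpha>) / \<alpha>) ^ N"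
  have x: "0 < x" "x < 4 / 1000" using \<alpha> N by (auto simp: x_def)
  have \<epsilon>: "0 \<le> \<epsilon>" "\<epsilon> < 1 / 10000" using r N by (auto simp: \<epsilon>_def)
  have "(5 - \<alpha>) / \<alpha> = (2 / \<alpha>) * r" using assms by (simp add: r_def divide_simps)
  then have y: "y = x * \<epsilon>" unfolding x_def y_def \<epsilon>_def by (simp only: power_mult_distrib)
  \<comment> \<open>The least n with n x above sqrt \<epsilon>. Then l = n x is still small, while
    \<epsilon> \<le> l / 100 makes the contribution n y = l \<epsilon> negligible against
    l^2.\<close>
  define n where "n = nat \<lfloor>sqrt \<epsilon> / x\<rfloor> + 1"
  define l where "l = n * x"
  have sq: "0 \<le> sqrt \<epsilon>" "sqrt \<epsilon> < 1 / 100"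
    using \<epsilon> real_sqrt_less_mono[of \<epsilon> "1 / 10000"] by (auto simp: real_sqrt_divide)
  have "0 \<le> sqrt \<epsilon> / x" using sq x by simp
  then have "sqrt \<epsilon> / x < n" "n \<le> sqrt \<epsilon> / x + 1" unfolding n_def by linarith+
  then have "sqrt \<epsilon> < l" "l \<le> sqrt \<epsilon> + x" unfolding l_def using x by (auto simp: field_simps)
  then have l: "sqrt \<epsilon> < l" "0 < l" "l < 14 / 1000" using sq x by linarith+
  have "\<epsilon> = sqrt \<epsilon> * sqrt \<epsilon>" using \<epsilon> by simp
  also have "\<dots> \<le> l * (1 / 100)" using l(1) less_imp_le[OF l(2)] sq by (intro mult_mono) linarith+
  finally have \<epsilon>l: "\<epsilon> \<le> l / 100" by simp
  define S where "S = (1 + x + y) ^ n"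
  have S: "1 \<le> S" "S \<le> 103 / 100"
  proof -
    show "1 \<le> S" unfolding S_def using x \<epsilon> by (auto intro!: one_le_power simp: y)
    have "0 \<le> x * \<epsilon>" using x \<epsilon> by simp
    then have "1 + x + y \<le> exp (x + y)" "0 \<le> 1 + x + y"
      using exp_ge_add_one_self[of "x + y"] x unfolding y by linarith+
    then have "S \<le> exp (x + y) ^ n" unfolding S_def by (intro power_mono)
    also have "\<dots> = exp (n * (x + y))" by (simp only: exp_of_nat_mult)
    also have "n * (x + y) = l * (1 + \<epsilon>)" by (simp add: y l_def algebra_simps)
    also have "exp (l * (1 + \<epsilon>)) \<le> exp (15 / 1000)"
    proof -
      have "l * (1 + \<epsilon>) \<le> (14 / 1000) * (1 + 1 / 10000)" using l \<epsilon> less_imp_le[OF l(2)] by (intro mult_mono) linarith+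
      then show ?thesis by simp
    qed
    also have "\<dots> \<le> 1 + 15 / 1000 + (15 / 1000)\<^sup>2" by (rule exp_bound) auto
    also have "\<dots> \<le> 103 / 100" by (simp add: power2_eq_square)
    finally show "S \<le> 103 / 100" .
  qed
  have "16 * (f 1 ^ 20 + (f 0 * f 2) ^ 10) * (f 0 * f 2) ^ 10 < l ^ 40" if f: "f = pattern_weight x y n" for f
  proof -
    have y0: "0 \<le> y" using x \<epsilon> by (simp add: y)
    note b = pattern_weight_bounds[OF less_imp_le[OF x(1)] y0, where n = n]
    have f1: "0 \<le> f 1" "f 1 \<le> (104 / 100) * l"
    proof -
      have "f 1 \<le> n * (x + y) * S" using b(3) by (simp add: f S_def)
      also have "\<dots> = (S * (1 + \<epsilon>)) * l" by (simp add: y l_def algebra_simps)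
      also have "S * (1 + \<epsilon>) \<le> (103 / 100) * (1 + 1 / 10000)" using S \<epsilon> by (intro mult_mono) linarith+
      then have "S * (1 + \<epsilon>) \<le> 104 / 100" by (rule order_trans) simp
      then have "(S * (1 + \<epsilon>)) * l \<le> (104 / 100) * l" using less_imp_le[OF l(2)] by (intro mult_right_mono) linarith+
      finally show "f 1 \<le> (104 / 100) * l" .
    qed (simp add: f b(1))
    have f2: "f 2 \<le> (52 / 100) * l\<^sup>2 * S"
    proof -
      have "f 2 \<le> (x * (x + y) * real n ^ 2 / 2 + n * y) * S" using b(4) by (simp add: f S_def)
      also have "x * (x + y) * real n ^ 2 / 2 + n * y = l\<^sup>2 * (1 + \<epsilon>) / 2 + l * \<epsilon>"
        by (simp add: y l_def power2_eq_square algebra_simps)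
      also have "\<dots> \<le> l\<^sup>2 * (1 + 1 / 10000) / 2 + l * (l / 100)"
        using less_imp_le[OF l(2)] \<epsilon> \<epsilon>l by (intro add_mono mult_left_mono divide_right_mono zero_le_power2) linarith+
      also have "\<dots> \<le> (52 / 100) * l\<^sup>2" by (simp add: power2_eq_square)
      finally show ?thesis using S by (simp add: mult_right_mono)
    qed
    have f02: "0 \<le> f 0 * f 2" "f 0 * f 2 \<le> (6 / 10) * l\<^sup>2"
    proof -
      have "f 0 \<le> S" unfolding f S_def by (rule b(2)) simp
      then have "f 0 * f 2 \<le> S * ((52 / 100) * l\<^sup>2 * S)" using f2 S b(1)[where k = 2] by (intro mult_mono) (simp_all add: f)
      also have "\<dots> = (S * S) * (52 / 100) * l\<^sup>2" by simp
      also have "\<dots> \<le> ((103 / 100) * (103 / 100)) * (52 / 100) * l\<^sup>2"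
        using S by (intro mult_right_mono mult_mono) auto
      also have "\<dots> \<le> (6 / 10) * l\<^sup>2" by (intro mult_right_mono) auto
      finally show "f 0 * f 2 \<le> (6 / 10) * l\<^sup>2" .
    qed (auto simp: f b(1))
    have mono: "16 * (w ^ 20 + u ^ 10) * u ^ 10 \<le> 16 * (w' ^ 20 + u' ^ 10) * u' ^ 10"
      if "0 \<le> w" "w \<le> w'" "0 \<le> u" "u \<le> u'" for u u' w w' :: real
    proof -
      have "w ^ 20 \<le> w' ^ 20" "u ^ 10 \<le> u' ^ 10" using that by (auto intro!: power_mono)
      moreover have "0 \<le> w ^ 20" "0 \<le> u ^ 10" using that by auto
      ultimately show ?thesis by (intro mult_mono) auto
    qed
    have "16 * (f 1 ^ 20 + (f 0 * f 2) ^ 10) * (f 0 * f 2) ^ 10 \<le>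
      16 * (((104 / 100) * l) ^ 20 + ((6 / 10) * l\<^sup>2) ^ 10) * ((6 / 10) * l\<^sup>2) ^ 10"
      by (rule mono[OF f1 f02])
    also have "\<dots> = (16 * ((104 / 100) ^ 20 + (6 / 10) ^ 10) * (6 / 10) ^ 10) * l ^ 40"
    proof -
      have "16 * ((c * l) ^ 20 + (d * l\<^sup>2) ^ 10) * (d * l\<^sup>2) ^ 10 = (16 * (c ^ 20 + d ^ 10) * d ^ 10) * l ^ 40" for c d
      proof -
        have "(d * l\<^sup>2) ^ 10 = d ^ 10 * l ^ 20" "(c * l) ^ 20 = c ^ 20 * l ^ 20" "l ^ 40 = l ^ 20 * l ^ 20"
          by (simp_all add: power_mult_distrib flip: power_mult power_add)
        then show ?thesis by (simp only: algebra_simps)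
      qed
      then show ?thesis .
    qed
    \<comment> \<open>The numerical factor is about 0.21.\<close>
    also have "\<dots> < 1 * l ^ 40"
      using l by (intro mult_strict_right_mono) (auto simp: field_simps)
    finally show ?thesis by simp
  qed
  then show ?thesis using N that[of N n] by (simp add: n_def x_def y_def l_def)
qed

section \<open>The three filters applied to the source\<close>

lemma map_comp_fst_zip: "length as = length es \<Longrightarrow> map (\<lambda>z. g (fst z)) (zip as es) = map g as"
  by (induction as es rule: list_induct2) auto

lemma finite_horodecki_source:
  assumes "2 \<le> \<alpha>" "\<alpha> \<le> 5"
  shows "finite (set_pmf (horodecki_source \<alpha>))"
proof -
  have "set_pmf (embed_pmf (xy_prob \<alpha>)) \<subseteq> {..<3} \<times> {..<3}"
    unfolding set_pmf_eq pmf_xy[OF assms] by (auto simp: xy_prob_def split: if_splits)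
  then show ?thesis by (simp add: horodecki_source_def finite_subset)
qed

lemma pmf_joint_horodecki_source:
  assumes "2 \<le> \<alpha>" "\<alpha> \<le> 5"
  shows "pmf (joint (horodecki_source \<alpha>)) = xy_prob \<alpha>"
proof -
  have "joint (horodecki_source \<alpha>) = embed_pmf (xy_prob \<alpha>)"
    by (simp add: joint_def horodecki_source_def map_pmf_comp case_prod_unfold)
  then show ?thesis by (simp add: pmf_xy[OF assms])
qed

lemma pmf_horodecki_source_ge:
  assumes "2 \<le> \<alpha>" "\<alpha> \<le> 5"
  shows "xy_prob \<alpha> (x, y) \<le> pmf (horodecki_source \<alpha>) (x, y, if x = y then None else Some (x, y))"
  unfolding horodecki_source_def
  using pmf_map_ge[of "embed_pmf (xy_prob \<alpha>)" "(x, y)" "\<lambda>(x, y). (x, y, if x = y then None else Some (x, y))"]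
  by (simp add: pmf_xy[OF assms])

theorem secret_key_rate_horodecki_source_pos:
  assumes \<alpha>: "3 < \<alpha>" "\<alpha> \<le> 5"
  shows "0 < secret_key_rate (horodecki_source \<alpha>)"
proof -
  let ?P = "horodecki_source \<alpha>"
  have \<alpha>': "2 \<le> \<alpha>" "\<alpha> \<le> 5" using \<alpha> by auto
  obtain N n where N: "0 < N" "0 < n" and param:
    "\<And>f. f = pattern_weight ((2 / \<alpha>) ^ N) (((5 - \<alpha>) / \<alpha>) ^ N) n \<Longrightarrow>
      16 * (f 1 ^ 20 + (f 0 * f 2) ^ 10) * (f 0 * f 2) ^ 10 < (n * (2 / \<alpha>) ^ N) ^ 40"
    using filter_parameters[OF \<alpha>] by blast
  define x where "x = (2 / \<alpha>) ^ N"
  define y where "y = ((5 - \<alpha>) / \<alpha>) ^ N"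
  define v0 where "v0 = (\<alpha> / 21) ^ N"
  define v1 where "v1 = (2 / 21 :: real) ^ N"
  define f where "f = pattern_weight x y n"
  have x: "0 < x" and y: "0 \<le> y" and v: "0 < v0" "0 < v1" using \<alpha> by (auto simp: x_def y_def v0_def v1_def)
  have v1: "v1 = x * v0" unfolding x_def v0_def v1_def power_mult_distrib[symmetric] using \<alpha> by simp
  have v2: "((5 - \<alpha>) / 21) ^ N = y * v0" unfolding y_def v0_def power_mult_distrib[symmetric] using \<alpha> by simp
  define Q1 where "Q1 = derived ?P N constant_value constant_value (\<lambda>z. z)"
  define Q2 where "Q2 = derived Q1 n sum3 sum3 (\<lambda>z. z)"
  \<comment> \<open>Bob's letters are Alice's letters 0 and 1 shifted by n - 1, written as n + 2:
    this is the total difference when exactly one of n blocks has X = Y and the others have Y = X +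
    1.\<close>
  define s where "s = (n + 2) mod 3"
  define t where "t = (1 + n + 2) mod 3"
  define Q3 where "Q3 = derived Q2 (2 * 10) (word_bit 10 0 1) (word_bit 10 s t) (\<lambda>z. z)"
  \<comment> \<open>Eve's symbols for repeated blocks: \<open>\<epsilon> a\<close> betrays X = a and
    Y = a + 1, whereas \<open>d\<close> says only that X = Y.\<close>
  define \<epsilon> where "\<epsilon> a = replicate N (Some (a :: nat, (a + 1) mod 3))" for a
  define d where "d = replicate N (None :: (nat \<times> nat) option)"
  have three: "a < 3 \<Longrightarrow> a = 0 \<or> a = 1 \<or> a = 2" for a :: nat by linarith
  have J1_ge: "v0 \<le> pmf Q1 (Some a, Some ((a + 1) mod 3), \<epsilon> a)" "v1 \<le> pmf Q1 (Some a, Some a, d)" if a: "a < 3" for a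
  proof -
    have "xy_prob \<alpha> (a, (a + 1) mod 3) = \<alpha> / 21" "a \<noteq> (a + 1) mod 3"
      using three[OF a] by (auto simp: xy_prob_def)
    then have "\<alpha> / 21 \<le> pmf ?P (a, (a + 1) mod 3, Some (a, (a + 1) mod 3))"
      using pmf_horodecki_source_ge[OF \<alpha>', of a "(a + 1) mod 3"] by simp
    then have "v0 \<le> prod_list (map (pmf ?P) (replicate N (a, (a + 1) mod 3, Some (a, (a + 1) mod 3))))"
      unfolding v0_def using \<alpha> by (simp add: prod_list_replicate power_mono)
    also have "\<dots> \<le> pmf Q1 (Some a, Some ((a + 1) mod 3), \<epsilon> a)"
      unfolding Q1_def using N by (intro pmf_derived_ge) (auto simp: \<epsilon>_def)
    finally show "v0 \<le> pmf Q1 (Some a, Some ((a + 1) mod 3), \<epsilon> a)" .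
    have "xy_prob \<alpha> (a, a) = 2 / 21" using a by (auto simp: xy_prob_def)
    then have "2 / 21 \<le> pmf ?P (a, a, None)"
      using pmf_horodecki_source_ge[OF \<alpha>', of a a] by simp
    then have "v1 \<le> prod_list (map (pmf ?P) (replicate N (a, a, None)))"
      unfolding v1_def by (simp add: prod_list_replicate power_mono)
    also have "\<dots> \<le> pmf Q1 (Some a, Some a, d)"
      unfolding Q1_def using N by (intro pmf_derived_ge) (auto simp: d_def)
    finally show "v1 \<le> pmf Q1 (Some a, Some a, d)" .
  qed
  have finP: "finite (set_pmf ?P)" by (rule finite_horodecki_source[OF \<alpha>'])
  define C where "C = 3 ^ (n - 1) * v0 ^ n"
  have C: "0 < C" using v by (simp add: C_def)
  have T_le: "pmf (joint Q2) (Some a, Some b) \<le> C * f ((n + a + 2 * b) mod 3)" if ab: "a < 3" "b < 3" for a b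
  proof -
    obtain k where k: "n = Suc k" using N(2) by (cases n) auto
    have "pmf (sum3_law (joint Q1) (Suc k)) (Some a, Some b) \<le>
      3 ^ k * v0 ^ Suc k * pattern_weight x y (Suc k) ((Suc k + a + 2 * b) mod 3)"
    proof (rule sum3_law_le[where V = "\<lambda>a b. xy_prob \<alpha> (a, b) ^ N"])
      show "finite (set_pmf (joint Q1))" unfolding Q1_def by (intro finite_joint finite_derived finP)
      show "pmf (joint Q1) (Some a, Some b) \<le> xy_prob \<alpha> (a, b) ^ N" for a b
        unfolding Q1_def using pmf_joint_constant_value[of ?P N "\<lambda>z. z" a b] by (simp add: pmf_joint_horodecki_source[OF \<alpha>'])
      show "3 \<le> a \<or> 3 \<le> b \<Longrightarrow> xy_prob \<alpha> (a, b) ^ N = 0" for a b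
        using N by (auto simp: xy_prob_def)
      show "xy_prob \<alpha> (a, b) ^ N = v0 * pattern_weight x y 1 ((1 + a + 2 * b) mod 3)" if "a < 3" "b < 3" for a b
        using three[OF that(1)] three[OF that(2)]
        by (elim disjE) (simp_all add: xy_prob_def numeral_2_eq_2 v1[unfolded v1_def] v2 v0_def[symmetric])
    qed (use v x y ab in auto)
    then show ?thesis by (simp add: k Q2_def joint_derived C_def f_def)
  qed
  define u where "u = (C * f 1) ^ 20"
  define w where "w = ((C * f 0) * (C * f 2)) ^ 10"
  \<comment> \<open>The correct alignments have pattern index 1. The two alignments of a wrong bit
    have indices 0 and 2, whose weights multiply.\<close>
  have idx: "(n + 0 + 2 * s) mod 3 = 1" "(n + 1 + 2 * t) mod 3 = 1" "(n + 0 + 2 * t) mod 3 = 0" "(n + 1 + 2 * s) mod 3 = 2"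
  proof -
    have red: "(m + 2 * (l mod 3)) mod 3 = (m + 2 * l) mod 3" for m l :: nat
      using mod3_add[of m 0 l] by simp
    have *: "n + 0 + 2 * (n + 2) = 1 + (n + 1) * 3" "n + 1 + 2 * (1 + n + 2) = 1 + (n + 2) * 3"
      "n + 0 + 2 * (1 + n + 2) = 0 + (n + 2) * 3" "n + 1 + 2 * (n + 2) = 2 + (n + 1) * 3" by simp_all
    show "(n + 0 + 2 * s) mod 3 = 1" "(n + 1 + 2 * t) mod 3 = 1" "(n + 0 + 2 * t) mod 3 = 0" "(n + 1 + 2 * s) mod 3 = 2"
      unfolding s_def t_def red * mod_mult_self1 by simp_all
  qed
  have st: "s < 3" "t < 3" "s \<noteq> t" using idx by (auto simp: s_def t_def)
  have f_nonneg: "0 \<le> f k" for k unfolding f_def using x y by (intro pattern_weight_bounds(1)) auto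
  have J3: "pmf (joint Q3) (Some i, Some j) \<le> (if i = j then u else w)" for i j
  proof -
    have "pmf (joint Q3) (Some i, Some j) \<le>
      (pmf (joint Q2) (Some 0, Some (if i = j then s else t)) * pmf (joint Q2) (Some 1, Some (if i = j then t else s))) ^ 10"
      unfolding Q3_def by (rule pmf_joint_word_bit) (use st in auto)
    also have "\<dots> \<le> (if i = j then ((C * f 1) * (C * f 1)) ^ 10 else w)"
    proof -
      have gen: "(p * q) ^ 10 \<le> (p' * q') ^ 10" if "0 \<le> p" "0 \<le> q" "p \<le> p'" "q \<le> q'" for p q p' q' :: real
        using that by (intro power_mono mult_mono) auto
      have T: "pmf (joint Q2) (Some 0, Some s) \<le> C * f 1" "pmf (joint Q2) (Some 1, Some t) \<le> C * f 1"
        "pmf (joint Q2) (Some 0, Some t) \<le> C * f 0" "pmf (joint Q2) (Some 1, Some s) \<le> C * f 2"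
        using T_le[of 0 s, unfolded idx] T_le[of 1 t, unfolded idx] T_le[of 0 t, unfolded idx] T_le[of 1 s, unfolded idx] st
        by simp_all
      show ?thesis
        using gen[OF pmf_nonneg pmf_nonneg T(1,2)] gen[OF pmf_nonneg pmf_nonneg T(3,4)]
        by (simp only: w_def if_True if_False split: if_split) simp
    qed
    also have "((C * f 1) * (C * f 1)) ^ 10 = u" unfolding u_def by (simp flip: power2_eq_square power_mult)
    finally show ?thesis .
  qed
  \<comment> \<open>The weight of one word of \<open>G\<close>: 20 sums, each with one block X = Y
    and n - 1 blocks Y = X + 1. It is the same for both bits because
    \<open>single_views_witness\<close> leaves Alice's sum free.\<close>
  define \<mu> where "\<mu> = (v1 * v0 ^ (n - 1)) ^ 20"
  have \<mu>: "0 < \<mu>" using v by (simp add: \<mu>_def)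
  define G where "G = {es. set es \<subseteq> single_views \<epsilon> d n \<and> length es = 20}"
  define m where "m = card G * \<mu>"
  have inj: "inj \<epsilon>" "d \<notin> range \<epsilon>" using N by (auto simp: inj_def \<epsilon>_def d_def)
  have fin: "finite (single_views \<epsilon> d n)" using card_single_views[OF inj, of n] by simp
  have card: "real (card (single_views \<epsilon> d n)) = n * 3 ^ (n - 1)"
  proof -
    have "3 * card (single_views \<epsilon> d n) = 3 * (n * 3 ^ (n - 1))"
      using card_single_views[OF inj, of n] N(2) by (cases n) auto
    then have "card (single_views \<epsilon> d n) = n * 3 ^ (n - 1)" by simp
    then show ?thesis by simp
  qed
  have m_eq: "m = (C * (n * x)) ^ 20"
  proof -
    have "card G = card (single_views \<epsilon> d n) ^ 20" unfolding G_def by (rule card_lists_length_eq[OF fin])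
    then have "m = (n * 3 ^ (n - 1) * (v1 * v0 ^ (n - 1))) ^ 20"
      unfolding m_def \<mu>_def power_mult_distrib[of _ "v1 * v0 ^ (n - 1)"] using card by simp
    also have "n * 3 ^ (n - 1) * (v1 * v0 ^ (n - 1)) = C * (n * x)"
      unfolding C_def v1 using N(2) by (cases n) (simp_all add: algebra_simps)
    finally show ?thesis .
  qed
  have G_le: "\<mu> \<le> pmf Q3 (Some i, Some i, es)" if es: "es \<in> G" for es i
  proof -
    let ?h = "\<lambda>a e. (Some a, Some ((a + n + 2) mod 3), e)"
    let ?w = "map2 ?h (bit_word 10 0 1 i) es"
    have len: "length es = 20" "length (bit_word 10 0 1 i) = 20" using es by (auto simp: G_def two_block_word_def)
    have Q2: "v1 * v0 ^ (n - 1) \<le> pmf Q2 (?h a e)" if e: "e \<in> single_views \<epsilon> d n" and a: "a < 3" for a e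
    proof -
      obtain w where w: "length w = n" "sum3 (map fst w) = Some a"
        "sum3 (map (\<lambda>o'. fst (snd o')) w) = Some ((a + n + 2) mod 3)" "map (\<lambda>o'. snd (snd o')) w = e"
        "v1 * v0 ^ (n - 1) \<le> prod_list (map (pmf Q1) w)"
        using single_views_witness[OF less_imp_le[OF v(1)] less_imp_le[OF v(2)] J1_ge e a] by blast
      note w(5)
      also have "prod_list (map (pmf Q1) w) \<le> pmf Q2 (?h a e)"
        unfolding Q2_def by (rule pmf_derived_ge) (rule w(1-4))+
      finally show ?thesis .
    qed
    have "\<mu> = (v1 * v0 ^ (n - 1)) ^ length ?w" using len by (simp add: \<mu>_def)
    also have "\<dots> \<le> prod_list (map (pmf Q2) ?w)"
    proof (rule prod_list_ge_power)
      fix q assume "q \<in> set ?w"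
      then obtain a e where "q = ?h a e" "a \<in> set (bit_word 10 0 1 i)" "e \<in> set es"
        by (auto dest: set_zip_leftD set_zip_rightD)
      moreover then have "a < 3" "e \<in> single_views \<epsilon> d n"
        using es by (auto simp: two_block_word_def G_def split: if_splits)
      ultimately show "v1 * v0 ^ (n - 1) \<le> pmf Q2 q" using Q2 by simp
    qed (use v in simp)
    also have "\<dots> \<le> pmf Q3 (Some i, Some i, es)"
      unfolding Q3_def
    proof (rule pmf_derived_ge)
      have "map fst ?w = map Some (bit_word 10 0 1 i)"
        using map_comp_fst_zip[of "bit_word 10 0 1 i" es Some] len by (simp add: comp_def case_prod_unfold)
      then show "word_bit 10 0 1 (map fst ?w) = Some i" by (simp add: word_bit_Some_iff)
      have "map (\<lambda>o'. fst (snd o')) ?w = map (\<lambda>a. Some ((a + n + 2) mod 3)) (bit_word 10 0 1 i)"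
      proof -
        have "map (\<lambda>o'. fst (snd o')) ?w = map (\<lambda>z. (\<lambda>a. Some ((a + n + 2) mod 3)) (fst z)) (zip (bit_word 10 0 1 i) es)"
          by (simp only: map_map comp_def case_prod_unfold fst_conv snd_conv)
        also have "\<dots> = map (\<lambda>a. Some ((a + n + 2) mod 3)) (bit_word 10 0 1 i)"
          by (rule map_comp_fst_zip) (simp only: len)
        finally show ?thesis .
      qed
      also have "\<dots> = map Some (bit_word 10 s t i)" by (simp add: two_block_word_def s_def t_def)
      finally show "word_bit 10 s t (map (\<lambda>o'. fst (snd o')) ?w) = Some i" using st by (simp add: word_bit_Some_iff)
      show "map (\<lambda>o'. snd (snd o')) ?w = es" using len by (simp add: comp_def case_prod_unfold)
    qed (use len in simp)
    finally show ?thesis .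
  qed
  define acc where "acc = 2 * (u + w)"
  define err where "err = 2 * w"
  interpret filtered_bits Q3 acc err m
  proof
    show "finite (set_pmf Q3)" unfolding Q3_def Q2_def Q1_def by (intro finite_derived finP)
    show "measure_pmf.prob Q3 {q. accepted q} \<le> acc" unfolding acc_def by (rule prob_accepted_le(1)[OF J3])
    show "measure_pmf.prob Q3 {q. accepted q \<and> bit_A q \<noteq> bit_B q} \<le> err" unfolding err_def
      by (rule prob_accepted_le(2)[OF J3])
    have "finite G" unfolding G_def by (rule finite_lists_length_eq[OF fin])
    then show "\<exists>G \<mu>. finite G \<and> m \<le> (\<Sum>e\<in>G. \<mu> e) \<and> (\<forall>e\<in>G. 0 < \<mu> e \<and>
       \<mu> e \<le> pmf Q3 (Some False, Some False, e) \<and> \<mu> e \<le> pmf Q3 (Some True, Some True, e))"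
      using G_le \<mu> by (intro exI[of _ G] exI[of _ "\<lambda>_. \<mu>"]) (simp add: m_def)
  qed
  obtain fx fy fz where Q3': "Q3 = derived ?P (20 * (n * N)) fx fy fz"
    and fz: "inj_on fz {zs. length zs = 20 * (n * N)}"
  proof -
    obtain gx gy gz where g: "Q2 = derived ?P (n * N) gx gy gz" "inj_on gz {zs. length zs = n * N}"
      using derived_derived[of ?P N constant_value constant_value "\<lambda>z. z" n sum3 sum3 "\<lambda>z. z"]
      unfolding Q2_def Q1_def by auto
    then show ?thesis
      using derived_derived[of ?P "n * N" gx gy gz "2 * 10" "word_bit 10 0 1" "word_bit 10 s t" "\<lambda>z. z"] that
      unfolding Q3_def by auto
  qed
  have "16 * (f 1 ^ 20 + (f 0 * f 2) ^ 10) * (f 0 * f 2) ^ 10 < (n * x) ^ 40"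
    unfolding x_def by (rule param) (simp add: f_def x_def y_def)
  then have "C ^ 40 * (16 * (f 1 ^ 20 + (f 0 * f 2) ^ 10) * (f 0 * f 2) ^ 10) < C ^ 40 * (n * x) ^ 40"
    using C by (intro mult_strict_left_mono) auto
  also have "C ^ 40 * (16 * (f 1 ^ 20 + (f 0 * f 2) ^ 10) * (f 0 * f 2) ^ 10) = 4 * acc * err"
  proof -
    have "u = C ^ 20 * f 1 ^ 20" "w = C ^ 20 * (f 0 * f 2) ^ 10" "C ^ 40 = C ^ 20 * C ^ 20"
      unfolding u_def w_def by (simp_all add: power_mult_distrib mult_ac flip: power_add)
    then show ?thesis unfolding acc_def err_def by (simp only: algebra_simps)
  qed
  also have "C ^ 40 * (n * x) ^ 40 = m\<^sup>2"
    unfolding m_eq by (simp add: power_mult_distrib flip: power_mult)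
  finally have gap: "4 * acc * err < m\<^sup>2" .
  have m: "0 < m" unfolding m_eq using C N x by simp
  have w: "0 \<le> w" unfolding w_def using C f_nonneg by simp
  \<comment> \<open>The secret events are accepted, so \<mu> \<le> u, which excludes
    \<open>f 1 = 0\<close>.\<close>
  have "0 < acc"
  proof -
    have "0 \<noteq> f 1"
    proof
      assume "0 = f 1"
      moreover have "\<mu> \<le> u"
      proof -
        have "G \<noteq> {}" using m by (auto simp: m_def)
        then obtain es where "es \<in> G" by auto
        then have "\<mu> \<le> pmf Q3 (Some True, Some True, es)" by (rule G_le)
        also have "\<dots> \<le> pmf (joint Q3) (Some True, Some True)"
          unfolding joint_def using pmf_map_ge[of Q3 "(Some True, Some True, es)" "\<lambda>(a, b, e). (a, b)"] by simp
        also have "\<dots> \<le> u" using J3[of True True] by simp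
        finally show ?thesis .
      qed
      ultimately show False using \<mu> by (simp add: u_def)
    qed
    then have "0 < u" unfolding u_def using C f_nonneg[of 1] by simp
    then show ?thesis using w by (simp add: acc_def)
  qed
  then show ?thesis
    using secret_key_rate_pos[OF finP _ Q3' fz _ _ m gap] N w by (simp add: err_def)
qed

section \<open>Trace norms of orthogonal decompositions\<close>

definition op_apply :: "'i set \<Rightarrow> 'i op \<Rightarrow> ('i \<Rightarrow> complex) \<Rightarrow> 'i \<Rightarrow> complex" where
  "op_apply I R v = (\<lambda>i. \<Sum>j\<in>I. R i j * v j)"

definition inner_prod :: "'i set \<Rightarrow> ('i \<Rightarrow> complex) \<Rightarrow> ('i \<Rightarrow> complex) \<Rightarrow> complex" where
  "inner_prod I v w = (\<Sum>i\<in>I. cnj (v i) * w i)"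

lemma op_positive_iff:
  "op_positive I R \<longleftrightarrow> (\<forall>v. Im (inner_prod I v (op_apply I R v)) = 0 \<and> 0 \<le> Re (inner_prod I v (op_apply I R v)))"
  by (simp add: op_positive_def inner_prod_def op_apply_def sum_distrib_left mult.assoc Let_def)

lemma inner_prod_self: "inner_prod I v v = complex_of_real (\<Sum>i\<in>I. (cmod (v i))\<^sup>2)"
  by (simp add: inner_prod_def complex_norm_square mult.commute flip: of_real_power)

lemma inner_prod_self_eq_0: "finite I \<Longrightarrow> inner_prod I v v = 0 \<Longrightarrow> i \<in> I \<Longrightarrow> v i = 0"
  unfolding inner_prod_self of_real_eq_0_iff by (subst (asm) sum_nonneg_eq_0_iff) auto

lemma op_apply_mult:
  "op_apply I R (op_apply I R' v) = op_apply I (op_mult I R R') v"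
proof
  fix i
  have "op_apply I (op_mult I R R') v i = (\<Sum>j\<in>I. \<Sum>k\<in>I. R i k * R' k j * v j)"
    by (simp add: op_apply_def op_mult_def sum_distrib_right)
  also have "\<dots> = (\<Sum>k\<in>I. \<Sum>j\<in>I. R i k * R' k j * v j)" by (rule sum.swap)
  finally show "op_apply I R (op_apply I R' v) i = op_apply I (op_mult I R R') v i"
    by (simp add: op_apply_def sum_distrib_left mult.assoc)
qed

lemma op_apply_diff: "op_apply I R (\<lambda>i. f i - c * g i) i = op_apply I R f i - c * op_apply I R g i"
  by (simp add: op_apply_def sum_subtractf sum_distrib_left right_diff_distrib mult.left_commute)

lemma inner_prod_diff: "inner_prod I w (\<lambda>i. f i - g i) = inner_prod I w f - inner_prod I w g"
  by (simp add: inner_prod_def sum_subtractf right_diff_distrib)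

lemma inner_prod_sum: "inner_prod I w (\<lambda>i. \<Sum>k\<in>S. a k * f k i) = (\<Sum>k\<in>S. a k * inner_prod I w (f k))"
proof -
  have "inner_prod I w (\<lambda>i. \<Sum>k\<in>S. a k * f k i) = (\<Sum>i\<in>I. \<Sum>k\<in>S. a k * (cnj (w i) * f k i))"
    by (simp add: inner_prod_def sum_distrib_left mult.left_commute)
  also have "\<dots> = (\<Sum>k\<in>S. \<Sum>i\<in>I. a k * (cnj (w i) * f k i))" by (rule sum.swap)
  finally show ?thesis by (simp add: inner_prod_def sum_distrib_left)
qed

lemma cnj_inner_prod: "cnj (inner_prod I v w) = inner_prod I w v"
  by (simp add: inner_prod_def mult.commute)

text \<open>Testing positivity on \<open>v + \<i> * R v\<close> makes Hermiticity of \<open>R\<close> unnecessary here.\<close>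

lemma op_positive_kernel:
  assumes I: "finite I" and R: "op_positive I R"
    and RR: "\<And>i. i \<in> I \<Longrightarrow> op_apply I R (op_apply I R v) i = 0" and i: "i \<in> I"
  shows "op_apply I R v i = 0"
proof -
  define w where "w = op_apply I R v"
  define v' where "v' = (\<lambda>i. v i + \<i> * w i)"
  have "op_apply I R v' j = w j" if "j \<in> I" for j
  proof -
    have "op_apply I R v' j = op_apply I R v j + \<i> * op_apply I R w j"
      by (simp add: v'_def op_apply_def sum.distrib sum_distrib_left algebra_simps)
    then show ?thesis using RR[OF that] by (simp add: w_def)
  qed
  then have "inner_prod I v' (op_apply I R v') = inner_prod I v' w"
    unfolding inner_prod_def by (intro sum.cong) auto
  also have "\<dots> = inner_prod I v w - \<i> * inner_prod I w w"
    by (simp add: v'_def inner_prod_def algebra_simps sum_subtractf sum_distrib_left)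
  finally have "Im (inner_prod I v w - \<i> * inner_prod I w w) = 0" using R op_positive_iff[of I R] by metis
  moreover have "Im (inner_prod I v w) = 0" using R op_positive_iff[of I R] unfolding w_def by metis
  ultimately have "Re (inner_prod I w w) = 0" by simp
  then have "inner_prod I w w = 0" unfolding inner_prod_self by simp
  then show ?thesis using inner_prod_self_eq_0[OF I _ i] unfolding w_def by blast
qed

text \<open>The difference w = R u - l u satisfies R w = - l w, which positivity of \<open>R\<close>
  forbids unless w = 0. This needs l > 0; for l = 0 the claim is
  \<open>op_positive_kernel\<close>.\<close>

lemma op_positive_eigenvector:
  assumes I: "finite I" and R: "op_positive I R" and l: "0 \<le> l"
    and RR: "\<And>i. i \<in> I \<Longrightarrow> op_apply I R (op_apply I R u) i = complex_of_real (l * l) * u i" and i: "i \<in> I"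
  shows "op_apply I R u i = complex_of_real l * u i"
proof (cases "l = 0")
  case True
  then show ?thesis using op_positive_kernel[OF I R _ i, of u] RR by simp
next
  case False
  define w where "w = (\<lambda>i. op_apply I R u i - complex_of_real l * u i)"
  have Rw: "op_apply I R w i = - complex_of_real l * w i" if "i \<in> I" for i
  proof -
    have "op_apply I R w i = op_apply I R (op_apply I R u) i - complex_of_real l * op_apply I R u i"
      unfolding w_def by (rule op_apply_diff)
    then show ?thesis using RR[OF that] by (simp add: w_def algebra_simps)
  qed
  have "inner_prod I w (op_apply I R w) = - complex_of_real l * inner_prod I w w"
    using Rw by (simp add: inner_prod_def sum_distrib_left mult_ac cong: sum.cong)
  moreover have "0 \<le> Re (inner_prod I w (op_apply I R w))" using R op_positive_iff[of I R] by metis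
  ultimately have "l * Re (inner_prod I w w) \<le> 0" by simp
  moreover have "0 \<le> Re (inner_prod I w w)" unfolding inner_prod_self by (simp add: sum_nonneg)
  ultimately have "Re (inner_prod I w w) = 0" using l False by (simp add: mult_le_0_iff)
  then have "inner_prod I w w = 0" unfolding inner_prod_self by simp
  then have "w i = 0" using inner_prod_self_eq_0[OF I _ i] by blast
  then show ?thesis by (simp add: w_def)
qed

text \<open>The vectors are orthogonal but not normalised, and \<open>\<nu> k\<close> may be 0, as
  happens for letters of probability 0 at \<alpha> = 5.\<close>

locale orthogonal_decomposition =
  fixes I :: "'i set" and S :: "'k set" and u :: "'k \<Rightarrow> 'i \<Rightarrow> complex" and \<nu> c :: "'k \<Rightarrow> real" and M :: "'i op"
  assumes I: "finite I" and S: "finite S"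
    and orth: "\<And>k l. k \<in> S \<Longrightarrow> l \<in> S \<Longrightarrow> inner_prod I (u k) (u l) = (if k = l then complex_of_real (\<nu> k) else 0)"
    and M: "\<And>i j. i \<in> I \<Longrightarrow> j \<in> I \<Longrightarrow> M i j = (\<Sum>k\<in>S. complex_of_real (c k) * u k i * cnj (u k j))"
begin

definition spectral :: "('k \<Rightarrow> real) \<Rightarrow> 'i op" where
  "spectral b = (\<lambda>i j. \<Sum>k\<in>S. complex_of_real (b k) * u k i * cnj (u k j))"

lemma nu_nonneg: "k \<in> S \<Longrightarrow> 0 \<le> \<nu> k"
proof -
  assume "k \<in> S"
  then have "complex_of_real (\<nu> k) = complex_of_real (\<Sum>i\<in>I. (cmod (u k i))\<^sup>2)"
    using orth[of k k] inner_prod_self[of I "u k"] by simp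
  then show ?thesis by (simp only: of_real_eq_iff) (simp add: sum_nonneg)
qed

lemma spectral_apply:
  "op_apply I (spectral b) v i = (\<Sum>k\<in>S. complex_of_real (b k) * u k i * inner_prod I (u k) v)"
proof -
  have "op_apply I (spectral b) v i = (\<Sum>j\<in>I. \<Sum>k\<in>S. complex_of_real (b k) * u k i * (cnj (u k j) * v j))"
    by (simp add: op_apply_def spectral_def sum_distrib_right mult.assoc)
  also have "\<dots> = (\<Sum>k\<in>S. \<Sum>j\<in>I. complex_of_real (b k) * u k i * (cnj (u k j) * v j))" by (rule sum.swap)
  finally show ?thesis by (simp add: inner_prod_def sum_distrib_left)
qed

lemma spectral_mult: "op_mult I (spectral a) (spectral b) = spectral (\<lambda>k. a k * b k * \<nu> k)"
proof (intro ext)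
  fix i j
  have "op_mult I (spectral a) (spectral b) i j = op_apply I (spectral a) (\<lambda>m. spectral b m j) i"
    by (simp add: op_mult_def op_apply_def)
  also have "\<dots> = (\<Sum>k\<in>S. complex_of_real (a k) * u k i * (\<Sum>l\<in>S. complex_of_real (b l) * cnj (u l j) * inner_prod I (u k) (u l)))"
  proof -
    have "(\<lambda>m. spectral b m j) = (\<lambda>m. \<Sum>l\<in>S. (complex_of_real (b l) * cnj (u l j)) * u l m)"
      by (auto simp: spectral_def mult_ac)
    then show ?thesis unfolding spectral_apply by (simp only: inner_prod_sum)
  qed
  also have "\<dots> = (\<Sum>k\<in>S. complex_of_real (a k) * u k i * (complex_of_real (b k) * cnj (u k j) * complex_of_real (\<nu> k)))"
    using S by (intro sum.cong refl) (simp add: orth if_distrib[of "(*) _"] sum.delta' sum.delta cong: if_cong)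
  finally show "op_mult I (spectral a) (spectral b) i j = spectral (\<lambda>k. a k * b k * \<nu> k) i j"
    by (simp add: spectral_def mult_ac)
qed

lemma spectral_positive:
  assumes "\<And>k. k \<in> S \<Longrightarrow> 0 \<le> b k"
  shows "op_positive I (spectral b)"
proof -
  have "inner_prod I v (op_apply I (spectral b) v) = complex_of_real (\<Sum>k\<in>S. b k * (cmod (inner_prod I (u k) v))\<^sup>2)" for v
  proof -
    have "inner_prod I v (op_apply I (spectral b) v) =
       (\<Sum>k\<in>S. \<Sum>i\<in>I. complex_of_real (b k) * inner_prod I (u k) v * (cnj (v i) * u k i))"
      unfolding inner_prod_def[of I v] spectral_apply sum_distrib_left
      by (subst sum.swap) (simp add: mult_ac)
    also have "\<dots> = (\<Sum>k\<in>S. complex_of_real (b k) * inner_prod I (u k) v * inner_prod I v (u k))"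
      by (simp only: sum_distrib_left[symmetric] inner_prod_def[of I v])
    also have "\<dots> = (\<Sum>k\<in>S. complex_of_real (b k) * (inner_prod I (u k) v * cnj (inner_prod I (u k) v)))"
      by (simp only: cnj_inner_prod mult.assoc)
    finally show ?thesis by (simp only: of_real_sum of_real_mult complex_norm_square)
  qed
  then show ?thesis unfolding op_positive_iff using assms by (simp add: sum_nonneg)
qed

lemma spectral_eigen: "k \<in> S \<Longrightarrow> op_apply I (spectral b) (u k) i = complex_of_real (b k * \<nu> k) * u k i"
  using S by (simp add: spectral_apply orth if_distrib[of "(*) _"] sum.delta' sum.delta mult_ac cong: if_cong)

text \<open>A basis vector is split into its projection onto the span of the \<open>u k\<close>, on
  which \<open>R\<close> acts by known eigenvalues, and a vector \<open>v\<close> orthogonal to all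
  of them. There R^2 v = 0, hence R v = 0 by positivity. So \<open>R\<close> is determined
  entrywise, without a general spectral theorem.\<close>

lemma sqrt_unique:
  assumes b: "\<And>k. k \<in> S \<Longrightarrow> 0 \<le> b k" and R: "op_positive I R"
    and RR: "\<And>i j. i \<in> I \<Longrightarrow> j \<in> I \<Longrightarrow> op_mult I R R i j = spectral (\<lambda>k. b k * b k * \<nu> k) i j"
    and ij: "i \<in> I" "j \<in> I"
  shows "R i j = spectral b i j"
proof -
  have app: "op_apply I R (op_apply I R v) i = op_apply I (spectral (\<lambda>k. b k * b k * \<nu> k)) v i" if "i \<in> I" for v i
    unfolding op_apply_mult using RR[OF that] by (simp add: op_apply_def cong: sum.cong)
  have eig: "op_apply I R (u k) i = complex_of_real (b k * \<nu> k) * u k i" if "k \<in> S" "i \<in> I" for k i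
    using that nu_nonneg b
    by (intro op_positive_eigenvector[OF I R _ _ that(2)]) (simp_all add: app spectral_eigen mult_ac)
  \<comment> \<open>The coefficients of the projection. For \<open>\<nu> k = 0\<close> the quotient
    is 0 by convention, which is consistent because \<open>u k\<close> then vanishes on
    \<open>I\<close>.\<close>
  define a where "a k = cnj (u k j) / complex_of_real (\<nu> k)" for k
  define v where "v = (\<lambda>m. (if m = j then 1 else 0) - (\<Sum>k\<in>S. a k * u k m))"
  have null: "u k m = 0" if "k \<in> S" "\<nu> k = 0" "m \<in> I" for k m
    using inner_prod_self_eq_0[OF I _ that(3), of "u k"] orth[OF that(1,1)] that(2) by simp
  have perp: "inner_prod I (u k) v = 0" if k: "k \<in> S" for k
  proof -
    have "inner_prod I (u k) v = (\<Sum>m\<in>I. if m = j then cnj (u k m) else 0) - (\<Sum>l\<in>S. a l * inner_prod I (u k) (u l))"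
    proof -
      have "inner_prod I (u k) (\<lambda>m. if m = j then 1 else 0) = (\<Sum>m\<in>I. if m = j then cnj (u k m) else 0)"
        unfolding inner_prod_def by (intro sum.cong) auto
      then show ?thesis unfolding v_def inner_prod_diff inner_prod_sum by simp
    qed
    also have "\<dots> = cnj (u k j) - a k * complex_of_real (\<nu> k)"
      using I S ij k by (simp add: orth if_distrib[of "(*) _"] sum.delta sum.delta' cong: if_cong)
    also have "\<dots> = 0" using null[OF k _ ij(2)] by (simp add: a_def)
    finally show ?thesis .
  qed
  have "op_apply I R v i = 0"
    using op_positive_kernel[OF I R _ ij(1), of v] app spectral_apply perp by simp
  moreover have "op_apply I R v i = R i j - (\<Sum>k\<in>S. a k * op_apply I R (u k) i)"
  proof -
    have "op_apply I R v i = (\<Sum>m\<in>I. if m = j then R i m else 0) - (\<Sum>m\<in>I. \<Sum>k\<in>S. a k * (R i m * u k m))"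
      by (simp add: op_apply_def v_def right_diff_distrib sum_subtractf sum_distrib_left if_distrib[of "(*) _"] mult_ac cong: if_cong)
    also have "(\<Sum>m\<in>I. \<Sum>k\<in>S. a k * (R i m * u k m)) = (\<Sum>k\<in>S. a k * op_apply I R (u k) i)"
      unfolding op_apply_def sum_distrib_left by (rule sum.swap)
    finally show ?thesis using I ij by simp
  qed
  ultimately have "R i j = (\<Sum>k\<in>S. a k * op_apply I R (u k) i)" by simp
  also have "\<dots> = spectral b i j"
    unfolding spectral_def
  proof (intro sum.cong refl)
    fix k assume k: "k \<in> S"
    show "a k * op_apply I R (u k) i = complex_of_real (b k) * u k i * cnj (u k j)"
      using null[OF k _ ij(2)] by (cases "\<nu> k = 0") (simp_all add: eig[OF k ij(1)] a_def)
  qed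
  finally show ?thesis .
qed

text \<open>The modulus of \<open>M\<close> has the same vectors with coefficients
  \<open>\<bar>c k\<bar>\<close>, and \<open>sqrt_unique\<close> identifies it with the operator
  described by \<open>op_sqrt\<close>. It is cut off outside \<open>I\<close> to match the
  normalisation there.\<close>

theorem trace_norm_eq: "trace_norm I M = (\<Sum>k\<in>S. \<bar>c k\<bar> * \<nu> k)"
proof -
  define b where "b k = \<bar>c k\<bar>" for k
  define N where "N = op_mult I (op_adj M) M"
  define R0 where "R0 = (\<lambda>i j. if i \<in> I \<and> j \<in> I then spectral b i j else 0)"
  have Madj: "op_adj M i j = spectral c i j" "M i j = spectral c i j" if "i \<in> I" "j \<in> I" for i j
    using M[OF that] M[OF that(2,1)] by (simp_all add: op_adj_def spectral_def mult_ac)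
  have N: "N i j = spectral (\<lambda>k. b k * b k * \<nu> k) i j" if "i \<in> I" "j \<in> I" for i j
  proof -
    have "N i j = op_mult I (spectral c) (spectral c) i j"
      unfolding N_def op_mult_def using Madj that by (intro sum.cong) auto
    then show ?thesis by (simp add: spectral_mult b_def)
  qed
  have R0: "op_mult I R0 R0 i j = spectral (\<lambda>k. b k * b k * \<nu> k) i j" if "i \<in> I" "j \<in> I" for i j
  proof -
    have "op_mult I R0 R0 i j = op_mult I (spectral b) (spectral b) i j"
      unfolding op_mult_def R0_def using that by (intro sum.cong) auto
    then show ?thesis by (simp add: spectral_mult)
  qed
  have "op_positive I R0"
  proof -
    have "op_positive I (spectral b)" by (rule spectral_positive) (simp add: b_def)
    then show ?thesis unfolding op_positive_def R0_def by (simp cong: sum.cong)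
  qed
  then have R0_sqrt: "op_positive I R0 \<and> (\<forall>i j. i \<notin> I \<or> j \<notin> I \<longrightarrow> R0 i j = 0) \<and> (\<forall>i\<in>I. \<forall>j\<in>I. op_mult I R0 R0 i j = N i j)"
    using R0 N by (simp add: R0_def[abs_def] del: split_paired_All)
  have "op_sqrt I N = R0"
    unfolding op_sqrt_def
  proof (rule the_equality, rule R0_sqrt)
    fix R assume R: "op_positive I R \<and> (\<forall>i j. i \<notin> I \<or> j \<notin> I \<longrightarrow> R i j = 0) \<and> (\<forall>i\<in>I. \<forall>j\<in>I. op_mult I R R i j = N i j)"
    show "R = R0"
    proof (intro ext)
      fix i j
      show "R i j = R0 i j"
      proof (cases "i \<in> I \<and> j \<in> I")
        case True
        have "R i j = spectral b i j"
        proof (rule sqrt_unique)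
          show "0 \<le> b k" for k by (simp add: b_def)
          show "op_positive I R" using R by (rule conjunct1)
          show "op_mult I R R i j = spectral (\<lambda>k. b k * b k * \<nu> k) i j" if "i \<in> I" "j \<in> I" for i j
            using conjunct2[OF conjunct2[OF R]] that unfolding N[OF that, symmetric] by blast
        qed (use True in auto)
        then show ?thesis using True by (simp add: R0_def)
      next
        case False
        then have "R i j = 0" using R by blast
        then show ?thesis using False by (auto simp: R0_def)
      qed
    qed
  qed
  then have "trace_norm I M = Re (\<Sum>i\<in>I. \<Sum>k\<in>S. complex_of_real (b k) * (cnj (u k i) * u k i))"
    unfolding trace_norm_def N_def[symmetric] op_trace_def by (simp add: R0_def spectral_def mult_ac)
  also have "(\<Sum>i\<in>I. \<Sum>k\<in>S. complex_of_real (b k) * (cnj (u k i) * u k i)) = (\<Sum>k\<in>S. complex_of_real (b k) * inner_prod I (u k) (u k))"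
    unfolding inner_prod_def sum_distrib_left by (rule sum.swap)
  also have "\<dots> = complex_of_real (\<Sum>k\<in>S. \<bar>c k\<bar> * \<nu> k)" by (simp add: orth b_def)
  finally show ?thesis by simp
qed

end

section \<open>Coherent simulation of classical protocols\<close>

text \<open>The coherent simulation of a classical protocol: the private randomness is sampled in two extra
  rounds with trivial message \<open>0\<close>, after which the local basis labels are a seed followed by the
  measured word. Messages that cannot occur are replaced by \<open>0\<close>, since \<open>M\<close> bounds the messages.\<close>

definition seeded :: "nat pmf \<Rightarrow> nat \<Rightarrow> nat \<Rightarrow> nat list set" where
  "seeded p d n = (\<lambda>(r, w). r # w) ` (set_pmf p \<times> words d n)"

definition clip :: "nat \<Rightarrow> nat \<Rightarrow> nat" where
  "clip M m = (if m < M then m else 0)"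

text \<open>The oldest messages stand last, so this strips the two sampling messages and recovers
  the classical transcript.\<close>

definition core :: "nat list \<Rightarrow> nat list" where
  "core t = take (length t - 2) t"

definition sampling_kraus :: "nat pmf \<Rightarrow> nat \<Rightarrow> nat list op" where
  "sampling_kraus p m = (\<lambda>c a. if m = 0 \<and> c \<noteq> [] \<and> tl c = a then complex_of_real (sqrt (pmf p (hd c))) else 0)"

definition message_kraus :: "nat \<Rightarrow> (nat list \<Rightarrow> nat \<Rightarrow> nat list \<Rightarrow> nat) \<Rightarrow> nat list \<Rightarrow> nat \<Rightarrow> nat list op" where
  "message_kraus M msg t m = (\<lambda>c a. if c = a \<and> m = clip M (msg (tl a) (hd a) (core t)) then 1 else 0)"

definition key_effect :: "(nat list \<Rightarrow> nat \<Rightarrow> nat list \<Rightarrow> nat) \<Rightarrow> nat list \<Rightarrow> nat \<Rightarrow> nat list op" where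
  "key_effect key t k = (\<lambda>a' a. if a' = a \<and> key (tl a) (hd a) (core t) = k then 1 else 0)"

definition simulation :: "nat \<Rightarrow> nat \<Rightarrow> nat \<Rightarrow> nat \<Rightarrow> (nat, nat) key_protocol \<Rightarrow> locc_protocol" where
  "simulation dA dB n M p = \<lparr>qrounds = crounds p + 2, qkeys = ckeys p, qmsgs = M, qkraus = 1,
     reg_A = \<lambda>t. if t = [] then words dA n else seeded (rand_A p) dA n,
     reg_B = \<lambda>t. if length t \<le> 1 then words dB n else seeded (rand_B p) dB n,
     kraus = \<lambda>t m j. if t = [] then sampling_kraus (rand_A p) m
        else if length t = 1 then sampling_kraus (rand_B p) m
        else if even (length t) then message_kraus M (msg_A p) t m
        else message_kraus M (msg_B p) t m,
     meas_A = key_effect (key_A p), meas_B = key_effect (key_B p)\<rparr>"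

lemma finite_words: "finite (words d n)"
  using finite_lists_length_eq[of "{..<d}" n] by (simp add: words_def conj_commute)

lemma finite_seeded: "finite (set_pmf p) \<Longrightarrow> finite (seeded p d n)"
  by (simp add: seeded_def finite_words)

lemma sum_seeded:
  "(\<Sum>c\<in>seeded p d n. f c) = (\<Sum>r\<in>set_pmf p. \<Sum>w\<in>words d n. f (r # w))"
  unfolding seeded_def
  by (subst sum.reindex) (auto simp: inj_on_def sum.cartesian_product case_prod_unfold)

lemma instrument_sampling:
  assumes "finite (set_pmf p)" "0 < M"
  shows "instrument (words d n) (\<lambda>m. seeded p d n) M 1 (\<lambda>m j. sampling_kraus p m)"
  unfolding instrument_def
proof (intro ballI)
  fix a a' assume a: "a \<in> words d n" "a' \<in> words d n"
  have "(\<Sum>m<M. \<Sum>j<1::nat. \<Sum>c\<in>seeded p d n. cnj (sampling_kraus p m c a) * sampling_kraus p m c a') =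
    (\<Sum>m<M. if m = 0 then (\<Sum>r\<in>set_pmf p. \<Sum>w\<in>words d n. if w = a then (if a = a' then complex_of_real (pmf p r) else 0) else 0) else 0)"
  proof -
    have "cnj (sampling_kraus p m (r # w) a) * sampling_kraus p m (r # w) a' =
      (if m = 0 then (if w = a then (if a = a' then complex_of_real (pmf p r) else 0) else 0) else 0)" for m r w
      by (auto simp: sampling_kraus_def simp flip: of_real_mult)
    then show ?thesis by (simp only: sum_seeded) (intro sum.cong refl, simp)
  qed
  also have "\<dots> = (\<Sum>r\<in>set_pmf p. if a = a' then complex_of_real (pmf p r) else 0)"
    using assms a by (simp add: sum.delta finite_words)
  also have "\<dots> = (if a = a' then 1 else 0)"
    using assms sum_pmf_eq_1[of "set_pmf p" p] by (simp flip: of_real_sum)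
  finally show "(\<Sum>m<M. \<Sum>j<1::nat. \<Sum>c\<in>seeded p d n. cnj (sampling_kraus p m c a) * sampling_kraus p m c a') =
    (if a = a' then 1 else 0)" .
qed

lemma instrument_message:
  assumes "finite S" "0 < M"
  shows "instrument S (\<lambda>m. S) M 1 (\<lambda>m j. message_kraus M msg t m)"
  unfolding instrument_def
proof (intro ballI)
  fix a a' assume a: "a \<in> S" "a' \<in> S"
  have "(\<Sum>m<M. \<Sum>j<1::nat. \<Sum>c\<in>S. cnj (message_kraus M msg t m c a) * message_kraus M msg t m c a') =
    (\<Sum>m<M. \<Sum>c\<in>S. if c = a then (if a = a' then (if m = clip M (msg (tl a) (hd a) (core t)) then 1 else 0) else 0) else 0)"
    by (auto simp: message_kraus_def intro!: sum.cong)
  also have "\<dots> = (\<Sum>m<M. if m = clip M (msg (tl a) (hd a) (core t)) then (if a = a' then 1 else 0) else 0)"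
    using assms a by (intro sum.cong refl) (simp add: sum.delta)
  also have "\<dots> = (if a = a' then 1 else 0)"
  proof -
    have "clip M (msg (tl a) (hd a) (core t)) < M" using assms by (simp add: clip_def)
    then show ?thesis by (simp add: sum.delta)
  qed
  finally show "(\<Sum>m<M. \<Sum>j<1::nat. \<Sum>c\<in>S. cnj (message_kraus M msg t m c a) * message_kraus M msg t m c a') =
    (if a = a' then 1 else 0)" .
qed

lemma povm_key_effect:
  assumes "finite S" "\<And>xs r t. key xs r t < K"
  shows "povm S K (key_effect key t)"
  unfolding povm_def
proof (intro conjI allI impI ballI)
  fix k
  have "(\<Sum>i\<in>S. \<Sum>j\<in>S. cnj (v i) * key_effect key t k i j * v j) =
    complex_of_real (\<Sum>i\<in>S. if key (tl i) (hd i) (core t) = k then (cmod (v i))\<^sup>2 else 0)" for v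
  proof -
    have "(\<Sum>i\<in>S. \<Sum>j\<in>S. cnj (v i) * key_effect key t k i j * v j) =
      (\<Sum>i\<in>S. \<Sum>j\<in>S. if j = i then (if key (tl i) (hd i) (core t) = k then cnj (v i) * v i else 0) else 0)"
      by (auto simp: key_effect_def intro!: sum.cong)
    also have "\<dots> = (\<Sum>i\<in>S. if key (tl i) (hd i) (core t) = k then cnj (v i) * v i else 0)"
      using assms(1) by (intro sum.cong refl) (simp add: sum.delta)
    also have "\<dots> = (\<Sum>i\<in>S. complex_of_real (if key (tl i) (hd i) (core t) = k then (cmod (v i))\<^sup>2 else 0))"
      by (intro sum.cong refl) (auto simp: complex_norm_square mult.commute simp del: of_real_power)
    finally show ?thesis by simp
  qed
  then show "op_positive S (key_effect key t k)"
    unfolding op_positive_def by (simp add: sum_nonneg)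
next
  fix a a' assume a: "a \<in> S" "a' \<in> S"
  have "(\<Sum>k<K. key_effect key t k a a') = (\<Sum>k<K. if k = key (tl a') (hd a') (core t) then (if a = a' then 1 else 0) else 0)"
    by (auto simp: key_effect_def intro!: sum.cong)
  then show "(\<Sum>k<K. key_effect key t k a a') = (if a = a' then 1 else 0)"
    using assms(2) by (simp add: sum.delta)
qed

text \<open>Sampling takes one round of each party, so every classical round keeps its parity and
  hence its speaker.\<close>

lemma valid_simulation:
  assumes p: "valid_key_protocol p" and M: "0 < M"
  shows "valid_locc dA dB n (simulation dA dB n M p)"
  unfolding valid_locc_def
proof (intro conjI allI impI ballI)
  let ?s = "simulation dA dB n M p"
  have fin: "finite (set_pmf (rand_A p))" "finite (set_pmf (rand_B p))" and key: "\<And>xs r t. key_A p xs r t < ckeys p"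
    "\<And>xs r t. key_B p xs r t < ckeys p" and K: "0 < ckeys p"
    using p by (auto simp: valid_key_protocol_def)
  show "0 < qkeys ?s" "reg_A ?s [] = words dA n" "reg_B ?s [] = words dB n" using K by (simp_all add: simulation_def)
  show finA: "finite (reg_A ?s t)" and finB: "finite (reg_B ?s t)" for t
    using fin by (simp_all add: simulation_def finite_words finite_seeded)
  show "povm (reg_A ?s t) (qkeys ?s) (meas_A ?s t)" "povm (reg_B ?s t) (qkeys ?s) (meas_B ?s t)" for t
    using povm_key_effect[OF finA[of t], of "key_A p" "ckeys p" t] povm_key_effect[OF finB[of t], of "key_B p" "ckeys p" t] key
    by (simp_all add: simulation_def)
  fix k t assume t: "t \<in> words (qmsgs ?s) k"
  have len: "length t = k" using t by (simp add: words_def)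
  show "if even k
        then instrument (reg_A ?s t) (\<lambda>m. reg_A ?s (m # t)) (qmsgs ?s) (qkraus ?s) (kraus ?s t) \<and>
             (\<forall>m<qmsgs ?s. reg_B ?s (m # t) = reg_B ?s t)
        else instrument (reg_B ?s t) (\<lambda>m. reg_B ?s (m # t)) (qmsgs ?s) (qkraus ?s) (kraus ?s t) \<and>
             (\<forall>m<qmsgs ?s. reg_A ?s (m # t) = reg_A ?s t)"
  proof -
    consider "k = 0" | "k = 1" | "2 \<le> k" by linarith
    then show ?thesis
    proof cases
      case 1
      then have "t = []" using len by simp
      then show ?thesis using 1 instrument_sampling[OF fin(1) M, of dA n] by (simp add: simulation_def)
    next
      case 2
      then show ?thesis using len instrument_sampling[OF fin(2) M, of dB n] by (auto simp: simulation_def)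
    next
      case 3
      then have "t \<noteq> []" "length t \<noteq> 1" "\<not> length t \<le> 1" "\<not> length t \<le> 0" using len by auto
      then show ?thesis
        using len instrument_message[OF finite_seeded[OF fin(1), of dA n] M, of "msg_A p" t]
          instrument_message[OF finite_seeded[OF fin(2), of dB n] M, of "msg_B p" t]
        by (simp add: simulation_def)
    qed
  qed
qed

lemma core_append: "core (t @ [x, y]) = t"
  by (simp add: core_def)

lemma length_transcript [simp]: "length (transcript p xs ra ys rb k) = k"
  by (induction k) (auto simp: Let_def)

text \<open>Only entries diagonal in Alice's and Bob's labels are computed, because the key effects
  are diagonal. The message operators are diagonal too, so these entries evolve among themselves
  like classical probabilities, and no separate measurement of words or seeds has to be
  inserted.\<close>

lemma post_state_simulation:
  fixes \<rho> :: "(nat list \<times> nat list \<times> nat list) op"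
  assumes p: "valid_key_protocol p" and M: "0 < M"
    and bound: "\<And>k. k \<le> crounds p \<Longrightarrow> set (transcript p xs ra ys rb k) \<subseteq> {..<M}"
    and a: "ra \<in> set_pmf (rand_A p)" "xs \<in> words dA n" "rb \<in> set_pmf (rand_B p)" "ys \<in> words dB n"
    and k: "k \<le> crounds p" "length t = k + 2"
  shows "post_state (simulation dA dB n M p) \<rho> t (ra # xs, rb # ys, e) (ra # xs, rb # ys, e') =
    (if t = transcript p xs ra ys rb k @ [0, 0]
     then complex_of_real (pmf (rand_A p) ra * pmf (rand_B p) rb) * \<rho> (xs, ys, e) (xs, ys, e') else 0)"
  using k
proof (induction k arbitrary: t)
  case 0
  then obtain m1 m0 where t: "t = [m1, m0]" by (auto simp: length_Suc_conv numeral_2_eq_2)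
  have fw: "finite (words d n)" for d by (rule finite_words)
  let ?s = "simulation dA dB n M p"
  let ?A = "complex_of_real (sqrt (pmf (rand_A p) ra))" and ?B = "complex_of_real (sqrt (pmf (rand_B p) rb))"
  \<comment> \<open>Bob's labels are kept apart here, since his sampling round sums over
    \<open>y\<close> and \<open>y'\<close> independently.\<close>
  have 1: "post_state ?s \<rho> [m0] (ra # xs, b, e) (ra # xs, b', e') =
     (if m0 = 0 then ?A * ?A * \<rho> (xs, b, e) (xs, b', e') else 0)" for b b'
  proof -
    have "post_state ?s \<rho> [m0] (ra # xs, b, e) (ra # xs, b', e') =
      (\<Sum>x\<in>words dA n. \<Sum>x'\<in>words dA n. if x' = xs then (if x = xs then (if m0 = 0 then ?A * ?A * \<rho> (xs, b, e) (xs, b', e') else 0) else 0) else 0)"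
    proof -
      have "post_state ?s \<rho> [m0] (ra # xs, b, e) (ra # xs, b', e') =
        (\<Sum>x\<in>words dA n. \<Sum>x'\<in>words dA n. sampling_kraus (rand_A p) m0 (ra # xs) x *
          \<rho> (x, b, e) (x', b', e') * cnj (sampling_kraus (rand_A p) m0 (ra # xs) x'))"
        by (simp add: simulation_def)
      then show ?thesis by (simp only:) (intro sum.cong refl, auto simp: sampling_kraus_def)
    qed
    also have "\<dots> = (\<Sum>x\<in>words dA n. if x = xs then (if m0 = 0 then ?A * ?A * \<rho> (xs, b, e) (xs, b', e') else 0) else 0)"
      using a fw by (intro sum.cong refl) (simp add: sum.delta)
    finally show ?thesis using a fw by (simp add: sum.delta)
  qed
  have "post_state ?s \<rho> t (ra # xs, rb # ys, e) (ra # xs, rb # ys, e') =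
    (\<Sum>y\<in>words dB n. \<Sum>y'\<in>words dB n. if y' = ys then (if y = ys then (if m1 = 0 then ?B * ?B * post_state ?s \<rho> [m0] (ra # xs, ys, e) (ra # xs, ys, e') else 0) else 0) else 0)"
  proof -
    have "post_state ?s \<rho> t (ra # xs, rb # ys, e) (ra # xs, rb # ys, e') =
      (\<Sum>y\<in>words dB n. \<Sum>y'\<in>words dB n. sampling_kraus (rand_B p) m1 (rb # ys) y *
        post_state ?s \<rho> [m0] (ra # xs, y, e) (ra # xs, y', e') * cnj (sampling_kraus (rand_B p) m1 (rb # ys) y'))"
      unfolding t post_state.simps(2)[of _ _ m1] by (simp add: simulation_def del: post_state.simps)
    then show ?thesis by (simp only:) (intro sum.cong refl, auto simp: sampling_kraus_def simp del: post_state.simps)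
  qed
  also have "\<dots> = (\<Sum>y\<in>words dB n. if y = ys then (if m1 = 0 then ?B * ?B * post_state ?s \<rho> [m0] (ra # xs, ys, e) (ra # xs, ys, e') else 0) else 0)"
    using a fw by (intro sum.cong refl) (simp add: sum.delta)
  also have "\<dots> = (if m1 = 0 then ?B * ?B * post_state ?s \<rho> [m0] (ra # xs, ys, e) (ra # xs, ys, e') else 0)"
    using a fw by (simp add: sum.delta)
  also have "\<dots> = (if m1 = 0 \<and> m0 = 0 then (?A * ?A) * (?B * ?B) * \<rho> (xs, ys, e) (xs, ys, e') else 0)"
    unfolding 1 by simp
  also have "(?A * ?A) * (?B * ?B) = complex_of_real (pmf (rand_A p) ra * pmf (rand_B p) rb)"
    by (simp flip: of_real_mult)
  finally show ?case by (simp add: t)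
next
  case (Suc k)
  then obtain m t' where t: "t = m # t'" "length t' = k + 2" by (cases t) auto
  let ?s = "simulation dA dB n M p" and ?tr = "transcript p xs ra ys rb"
  define S where "S = (if even k then seeded (rand_A p) dA n else seeded (rand_B p) dB n)"
  define l where "l = (if even k then ra # xs else rb # ys)"
  define msg where "msg = (if even k then msg_A p xs ra (core t') else msg_B p ys rb (core t'))"
  have fin: "finite (seeded (rand_A p) dA n)" "finite (seeded (rand_B p) dB n)"
    using p by (auto simp: valid_key_protocol_def intro: finite_seeded)
  have mem: "ra # xs \<in> seeded (rand_A p) dA n" "rb # ys \<in> seeded (rand_B p) dB n"
    using a by (auto simp: seeded_def)
  have ne: "t' \<noteq> []" "length t' \<noteq> 1" "\<not> length t' \<le> 1" "even (length t') = even k" using t(2) by auto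
  let ?P = "post_state ?s \<rho> t' (ra # xs, rb # ys, e) (ra # xs, rb # ys, e')"
  have "post_state ?s \<rho> t (ra # xs, rb # ys, e) (ra # xs, rb # ys, e') =
     (\<Sum>x\<in>S. \<Sum>x'\<in>S. if x' = l then (if x = l then (if m = clip M msg then ?P else 0) else 0) else 0)"
  proof (cases "even k")
    case True
    have "post_state ?s \<rho> t (ra # xs, rb # ys, e) (ra # xs, rb # ys, e') =
      (\<Sum>x\<in>seeded (rand_A p) dA n. \<Sum>x'\<in>seeded (rand_A p) dA n. message_kraus M (msg_A p) t' m (ra # xs) x *
        post_state ?s \<rho> t' (x, rb # ys, e) (x', rb # ys, e') * cnj (message_kraus M (msg_A p) t' m (ra # xs) x'))"
      using ne True unfolding t(1) by (simp add: simulation_def)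
    then show ?thesis
      by (simp only:) (simp only: S_def l_def msg_def True if_True, intro sum.cong refl, auto simp: message_kraus_def)
  next
    case False
    have "post_state ?s \<rho> t (ra # xs, rb # ys, e) (ra # xs, rb # ys, e') =
      (\<Sum>x\<in>seeded (rand_B p) dB n. \<Sum>x'\<in>seeded (rand_B p) dB n. message_kraus M (msg_B p) t' m (rb # ys) x *
        post_state ?s \<rho> t' (ra # xs, x, e) (ra # xs, x', e') * cnj (message_kraus M (msg_B p) t' m (rb # ys) x'))"
      using ne False unfolding t(1) by (simp add: simulation_def)
    then show ?thesis
      by (simp only:) (simp only: S_def l_def msg_def False if_False, intro sum.cong refl, auto simp: message_kraus_def)
  qed
  also have "\<dots> = (\<Sum>x\<in>S. if x = l then (if m = clip M msg then ?P else 0) else 0)"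
    using fin mem by (intro sum.cong refl) (auto simp: S_def l_def sum.delta)
  also have "\<dots> = (if m = clip M msg then ?P else 0)"
    using fin mem by (auto simp: S_def l_def sum.delta)
  also have "\<dots> = (if m = clip M msg \<and> t' = ?tr k @ [0, 0] then
      complex_of_real (pmf (rand_A p) ra * pmf (rand_B p) rb) * \<rho> (xs, ys, e) (xs, ys, e') else 0)"
  proof -
    have "?P = (if t' = ?tr k @ [0, 0]
      then complex_of_real (pmf (rand_A p) ra * pmf (rand_B p) rb) * \<rho> (xs, ys, e) (xs, ys, e') else 0)"
      by (rule Suc.IH) (use Suc.prems(1) t(2) in simp_all)
    then show ?thesis by (simp only:) simp
  qed
  also have "(m = clip M msg \<and> t' = ?tr k @ [0, 0]) \<longleftrightarrow> t = ?tr (Suc k) @ [0, 0]"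
  proof (cases "t' = ?tr k @ [0, 0]")
    case True
    then have tr: "?tr (Suc k) = msg # ?tr k" by (simp add: msg_def core_append Let_def)
    \<comment> \<open>On an actual transcript \<open>bound\<close> makes \<open>clip\<close> the
      identity.\<close>
    then have "msg < M" using bound[OF Suc.prems(1)] by auto
    then show ?thesis using True tr t(1) by (simp add: clip_def)
  next
    case False
    then show ?thesis by (auto simp: t(1) Let_def)
  qed
  finally show ?case .
qed

section \<open>Eve's vectors in a purification of the Horodecki state\<close>

lemma words_Suc: "words d (Suc n) = (\<lambda>(e, es). e # es) ` ({..<d} \<times> words d n)"
  by (auto simp: words_def length_Suc_conv)

lemma sum_words_prod:
  "(\<Sum>es\<in>words d n. \<Prod>i<n. g i (es ! i)) = (\<Prod>i<n. \<Sum>e<d. g i e :: complex)"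
proof (induction n arbitrary: g)
  case 0
  have "words d 0 = {[]}" by (auto simp: words_def)
  then show ?case by simp
next
  case (Suc n)
  have inj: "inj_on (\<lambda>(e, es). e # es) ({..<d} \<times> words d n)" by (auto simp: inj_on_def)
  have "(\<Sum>es\<in>words d (Suc n). \<Prod>i<Suc n. g i (es ! i)) =
    (\<Sum>z\<in>{..<d} \<times> words d n. g 0 (fst z) * (\<Prod>i<n. g (Suc i) (snd z ! i)))"
    unfolding words_Suc sum.reindex[OF inj] by (intro sum.cong refl) (auto simp del: prod.lessThan_Suc simp add: prod.lessThan_Suc_shift)
  also have "\<dots> = (\<Sum>e<d. g 0 e) * (\<Sum>es\<in>words d n. \<Prod>i<n. g (Suc i) (es ! i))"
    by (simp add: sum.cartesian_product' sum_product)
  finally show ?case using Suc[of "\<lambda>i. g (Suc i)"] by (simp del: prod.lessThan_Suc add: prod.lessThan_Suc_shift)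
qed

definition eve_letter :: "nat \<times> nat \<Rightarrow> (nat \<times> nat) option" where
  "eve_letter = (\<lambda>(x, y). if x = y then None else Some (x, y))"

definition letters :: "(nat \<times> nat) option set" where
  "letters = eve_letter ` ({..<3} \<times> {..<3})"

text \<open>The squared norm of Eve's vector for a letter, not the probability of the letter: for
  \<open>None\<close> it is 2 / 21, the probability of each single pair with X = Y. The three such
  pairs are accounted for by counting words in \<open>coef\<close>.\<close>

definition letter_prob :: "real \<Rightarrow> (nat \<times> nat) option \<Rightarrow> real" where
  "letter_prob \<alpha> z = (case z of None \<Rightarrow> 2 / 21 | Some v \<Rightarrow> xy_prob \<alpha> v)"

lemma letter_prob_eve_letter: "v \<in> {..<3} \<times> {..<3} \<Longrightarrow> letter_prob \<alpha> (eve_letter v) = xy_prob \<alpha> v"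
  by (auto simp: letter_prob_def eve_letter_def xy_prob_def)

text \<open>The coherent part has entries 2 / 7 times 1 / 3, so all nine entries between labels (a,
  a) and (a', a') equal 2 / 21.\<close>

lemma horodecki_state_entries:
  assumes "a < 3" "b < 3" "a' < 3" "b' < 3"
  shows "horodecki_state \<alpha> (a, b) (a', b') =
    complex_of_real (if a = b \<and> a' = b' then 2 / 21 else if (a, b) = (a', b') then xy_prob \<alpha> (a, b) else 0)"
proof -
  have three: "a < 3 \<Longrightarrow> a = 0 \<or> a = 1 \<or> a = 2" for a :: nat by linarith
  have Phi: "Phi3 (a, b) = (if a = b then 1 / complex_of_real (sqrt 3) else 0)" if "a < 3" "b < 3" for a b
    using three[OF that(1)] three[OF that(2)] by (auto simp: Phi3_def ket_def)
  have sq: "(1 / complex_of_real (sqrt 3)) * cnj (1 / complex_of_real (sqrt 3)) = 1 / 3"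
    by (simp flip: of_real_mult)
  have PP: "proj Phi3 (a, b) (a', b') = (if a = b \<and> a' = b' then 1 / 3 else 0)"
    unfolding proj_def Phi[OF assms(1,2)] Phi[OF assms(3,4)] using sq by auto
  have range: "{..<3::nat} = {0, 1, 2}" by auto
  have K1: "(\<Sum>i<3. proj (ket (i, (i + 1) mod 3)) (a, b) (a', b')) = (if (a, b) = (a', b') \<and> b = (a + 1) mod 3 then 1 else 0)"
    unfolding range using three[OF assms(1)] three[OF assms(3)] by (auto simp: proj_def ket_def)
  have K2: "(\<Sum>i<3. proj (ket ((i + 1) mod 3, i)) (a, b) (a', b')) = (if (a, b) = (a', b') \<and> a = (b + 1) mod 3 then 1 else 0)"
    unfolding range using three[OF assms(2)] three[OF assms(4)] by (auto simp: proj_def ket_def)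
  show ?thesis
  proof (cases "(a, b) = (a', b')")
    case True
    have succ: "a \<noteq> b \<Longrightarrow> (a = (b + 1) mod 3) = (b \<noteq> (a + 1) mod 3)" "a = b \<Longrightarrow> b \<noteq> (a + 1) mod 3"
      using three[OF assms(1)] three[OF assms(2)] by (elim disjE; simp)+
    have xy: "xy_prob \<alpha> (a, b) = (if a = b then 2 / 21 else if b = (a + 1) mod 3 then \<alpha> / 21 else (5 - \<alpha>) / 21)"
      using three[OF assms(1)] three[OF assms(2)] by (elim disjE) (simp_all add: xy_prob_def)
    show ?thesis
    proof (cases "a = b")
      case eq: True
      then have "b \<noteq> (a + 1) mod 3" "a \<noteq> (b + 1) mod 3" using succ by auto
      then show ?thesis unfolding horodecki_state_def PP K1 K2 using eq True by simp
    next
      case ne: False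
      show ?thesis unfolding horodecki_state_def PP K1 K2 xy succ(1)[OF ne] using ne True by simp
    qed
  next
    case False
    then have ne: "((a, b) = (a', b')) = False" by blast
    show ?thesis unfolding horodecki_state_def PP K1 K2 ne by simp
  qed
qed

locale horodecki_purification =
  fixes \<alpha> :: real and dE :: nat and \<Psi> :: "nat \<times> nat \<times> nat \<Rightarrow> complex"
  assumes purification: "purification 3 3 (horodecki_state \<alpha>) dE \<Psi>"
begin

definition eve_vec :: "(nat \<times> nat) option \<Rightarrow> nat \<Rightarrow> complex" where
  "eve_vec z e = (case z of None \<Rightarrow> \<Psi> (0, 0, e) | Some (x, y) \<Rightarrow> \<Psi> (x, y, e))"

lemma gram:
  assumes "a < 3" "b < 3" "a' < 3" "b' < 3"
  shows "inner_prod {..<dE} (\<lambda>e. \<Psi> (a, b, e)) (\<lambda>e. \<Psi> (a', b', e)) = horodecki_state \<alpha> (a', b') (a, b)"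
proof -
  have "(\<Sum>e<dE. proj \<Psi> (a', b', e) (a, b, e)) = horodecki_state \<alpha> (a', b') (a, b)"
    using purification assms unfolding purification_def by blast
  then show ?thesis by (simp add: inner_prod_def proj_def mult.commute)
qed

text \<open>The vectors for (x, x) and (0, 0) have the same squared norm 2 / 21, and their inner
  product has this value too, so their difference has norm 0.\<close>

lemma eve_vec_eq:
  assumes "x < 3" "y < 3" "e < dE"
  shows "\<Psi> (x, y, e) = eve_vec (eve_letter (x, y)) e"
proof (cases "x = y")
  case True
  let ?v = "\<lambda>e. \<Psi> (x, x, e)" and ?w = "\<lambda>e. \<Psi> (0, 0, e)"
  let ?d = "\<lambda>e. ?v e - ?w e"
  have g: "inner_prod {..<dE} ?v ?v = 2 / 21" "inner_prod {..<dE} ?v ?w = 2 / 21"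
    "inner_prod {..<dE} ?w ?v = 2 / 21" "inner_prod {..<dE} ?w ?w = 2 / 21"
    using assms by (simp_all add: gram horodecki_state_entries)
  have "inner_prod {..<dE} ?d ?v = 0" "inner_prod {..<dE} ?d ?w = 0"
    using cnj_inner_prod[of "{..<dE}" ?v ?d] cnj_inner_prod[of "{..<dE}" ?w ?d]
    by (simp_all only: inner_prod_diff g diff_self complex_cnj_zero)
  then have "inner_prod {..<dE} ?d ?d = 0" unfolding inner_prod_diff[of _ ?d] by simp
  then have "?d e = 0" using inner_prod_self_eq_0[of "{..<dE}" ?d e] assms(3) by simp
  then show ?thesis using True by (simp add: eve_vec_def eve_letter_def)
next
  case False
  then show ?thesis by (simp add: eve_vec_def eve_letter_def)
qed

lemma eve_vec_orthogonal:
  assumes "z \<in> letters" "z' \<in> letters"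
  shows "inner_prod {..<dE} (eve_vec z) (eve_vec z') = (if z = z' then complex_of_real (letter_prob \<alpha> z) else 0)"
proof -
  define rep where "rep z = (case z of None \<Rightarrow> (0, 0) | Some v \<Rightarrow> v)" for z :: "(nat \<times> nat) option"
  have vec: "eve_vec z = (\<lambda>e. \<Psi> (fst (rep z), snd (rep z), e))" for z
    by (auto simp: eve_vec_def rep_def split: option.splits)
  have lt: "fst (rep z) < 3" "snd (rep z) < 3" if "z \<in> letters" for z
    using that by (auto simp: letters_def eve_letter_def rep_def)
  have diag: "fst (rep z) = snd (rep z) \<longleftrightarrow> z = None" if "z \<in> letters" for z
    using that by (auto simp: letters_def eve_letter_def rep_def split: if_splits)
  have "inner_prod {..<dE} (eve_vec z) (eve_vec z') = horodecki_state \<alpha> (rep z') (rep z)"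
    unfolding vec using gram[OF lt[OF assms(1)] lt[OF assms(2)]] by simp
  also have "\<dots> = (if z = z' then complex_of_real (letter_prob \<alpha> z) else 0)"
    using horodecki_state_entries[OF lt[OF assms(2)] lt[OF assms(1)], of \<alpha>] diag[OF assms(1)] diag[OF assms(2)]
    by (cases z; cases z') (auto simp: rep_def letter_prob_def)
  finally show ?thesis .
qed

definition eve_word :: "(nat \<times> nat) option list \<Rightarrow> nat list \<Rightarrow> complex" where
  "eve_word zs es = (\<Prod>i<length zs. eve_vec (zs ! i) (es ! i))"

lemma copies_eq:
  assumes "length v = n" "set v \<subseteq> {..<3} \<times> {..<3}" "es \<in> words dE n"
  shows "copies n \<Psi> (map fst v, map snd v, es) = eve_word (map eve_letter v) es"
  unfolding copies_def eve_word_def prod.case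
proof (rule prod.cong)
  fix i assume "i \<in> {..<length (map eve_letter v)}"
  then have i: "i < n" using assms(1) by simp
  then have "v ! i \<in> {..<3} \<times> {..<3}" "es ! i < dE"
    using assms nth_mem[of i v] nth_mem[of i es] by (auto simp: words_def simp del: nth_mem)
  then show "\<Psi> (map fst v ! i, map snd v ! i, es ! i) = eve_vec (map eve_letter v ! i) (es ! i)"
    using eve_vec_eq[of "fst (v ! i)" "snd (v ! i)" "es ! i"] i assms(1) by (auto simp: mem_Times_iff)
qed (use assms in simp)

lemma eve_word_orthogonal:
  assumes "length zs = n" "length zs' = n" "set zs \<subseteq> letters" "set zs' \<subseteq> letters"
  shows "inner_prod (words dE n) (eve_word zs) (eve_word zs') =
    (if zs = zs' then complex_of_real (prod_list (map (letter_prob \<alpha>) zs)) else 0)"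
proof -
  have "inner_prod (words dE n) (eve_word zs) (eve_word zs') =
    (\<Sum>es\<in>words dE n. \<Prod>i<n. cnj (eve_vec (zs ! i) (es ! i)) * eve_vec (zs' ! i) (es ! i))"
    unfolding inner_prod_def eve_word_def using assms by (simp add: prod.distrib)
  also have "\<dots> = (\<Prod>i<n. inner_prod {..<dE} (eve_vec (zs ! i)) (eve_vec (zs' ! i)))"
    unfolding inner_prod_def by (rule sum_words_prod[of "\<lambda>i e. cnj (eve_vec (zs ! i) e) * eve_vec (zs' ! i) e"])
  also have "\<dots> = (\<Prod>i<n. if zs ! i = zs' ! i then complex_of_real (letter_prob \<alpha> (zs ! i)) else 0)"
    using assms by (intro prod.cong refl eve_vec_orthogonal) (auto simp: subset_iff)
  also have "\<dots> = (if zs = zs' then complex_of_real (\<Prod>i<n. letter_prob \<alpha> (zs ! i)) else 0)"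
  proof (cases "zs = zs'")
    case True
    then show ?thesis by simp
  next
    case False
    then obtain i where "i < n" "zs ! i \<noteq> zs' ! i" using assms nth_equalityI by metis
    then have "(\<Prod>i<n. if zs ! i = zs' ! i then complex_of_real (letter_prob \<alpha> (zs ! i)) else 0) = 0"
      by (intro prod_zero) auto
    then show ?thesis using False by simp
  qed
  also have "(\<Prod>i<n. letter_prob \<alpha> (zs ! i)) = prod_list (map (letter_prob \<alpha>) zs)"
    using assms(1) by (simp add: prod.list_conv_set_nth atLeast0LessThan)
  finally show ?thesis .
qed

end

section \<open>The final state of a simulated run\<close>

definition pair_words :: "nat \<Rightarrow> (nat \<times> nat) list set" where
  "pair_words n = {v. length v = n \<and> set v \<subseteq> {..<3} \<times> {..<3}}"

lemma finite_pair_words: "finite (pair_words n)"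
  using finite_lists_length_eq[of "{..<3::nat} \<times> {..<3::nat}" n] by (simp add: pair_words_def conj_commute)

lemma sum_words_pair:
  "(\<Sum>xs\<in>words 3 n. \<Sum>ys\<in>words 3 n. g xs ys) = (\<Sum>v\<in>pair_words n. g (map fst v) (map snd v))"
proof -
  have "(\<Sum>xs\<in>words 3 n. \<Sum>ys\<in>words 3 n. g xs ys) = (\<Sum>z\<in>words 3 n \<times> words 3 n. g (fst z) (snd z))"
    by (simp add: sum.cartesian_product case_prod_unfold)
  also have "\<dots> = (\<Sum>v\<in>pair_words n. g (map fst v) (map snd v))"
  proof (rule sum.reindex_bij_witness[of _ "\<lambda>v. (map fst v, map snd v)" "\<lambda>z. zip (fst z) (snd z)"])
    fix z assume "z \<in> words 3 n \<times> words 3 n"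
    then show "zip (fst z) (snd z) \<in> pair_words n"
      by (auto simp: pair_words_def words_def subset_iff dest: set_zip_leftD set_zip_rightD)
  qed (auto simp: words_def pair_words_def zip_map_fst_snd)
  finally show ?thesis .
qed

lemma pair_words_letters: "v \<in> pair_words n \<Longrightarrow> length (map eve_letter v) = n \<and> set (map eve_letter v) \<subseteq> letters"
  by (auto simp: pair_words_def letters_def)

definition letter_words :: "nat \<Rightarrow> (nat \<times> nat) option list set" where
  "letter_words n = {zs. length zs = n \<and> set zs \<subseteq> letters}"

lemma finite_letter_words: "finite (letter_words n)"
  using finite_lists_length_eq[of letters n] by (simp add: letter_words_def conj_commute letters_def)

locale simulated_run = horodecki_purification +
  fixes p :: "(nat, nat) key_protocol" and n M :: nat
  assumes \<alpha>: "2 \<le> \<alpha>" "\<alpha> \<le> 5" and valid: "valid_key_protocol p" and M: "0 < M"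
    and bound: "\<And>xs ys ra rb k. xs \<in> words 3 n \<Longrightarrow> ys \<in> words 3 n \<Longrightarrow> ra \<in> set_pmf (rand_A p) \<Longrightarrow>
      rb \<in> set_pmf (rand_B p) \<Longrightarrow> k \<le> crounds p \<Longrightarrow> set (transcript p xs ra ys rb k) \<subseteq> {..<M}"
begin

text \<open>The transcript ends in the messages of the two sampling rounds.\<close>

definition outcome :: "(nat \<times> nat) list \<Rightarrow> nat \<Rightarrow> nat \<Rightarrow> nat \<times> nat \<times> (nat \<times> nat) option list \<times> nat list" where
  "outcome v ra rb = (let f = transcript p (map fst v) ra (map snd v) rb (crounds p)
     in (key_A p (map fst v) ra f, key_B p (map snd v) rb f, map eve_letter v, f @ [0, 0]))"

definition padded_run :: "(nat \<times> nat \<times> (nat \<times> nat) option list \<times> nat list) pmf" where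
  "padded_run = map_pmf (\<lambda>(ka, kb, zs, f). (ka, kb, zs, f @ [0, 0])) (run (horodecki_source \<alpha>) n p)"

text \<open>The probability of an outcome with the source factored out. Source words with the same
  Eve word are equally likely, so the joint law is this coefficient times a product of
  \<open>letter_prob\<close>.\<close>

definition coef :: "nat \<times> nat \<times> (nat \<times> nat) option list \<times> nat list \<Rightarrow> real" where
  "coef \<tau> = (\<Sum>v\<in>pair_words n. \<Sum>ra\<in>set_pmf (rand_A p). \<Sum>rb\<in>set_pmf (rand_B p).
     if outcome v ra rb = \<tau> then pmf (rand_A p) ra * pmf (rand_B p) rb else 0)"

lemma finite_rand: "finite (set_pmf (rand_A p))" "finite (set_pmf (rand_B p))"
  using valid by (auto simp: valid_key_protocol_def)

lemma padded_run_eq: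
  "padded_run = map_pmf (\<lambda>(v, ra, rb). outcome v ra rb)
     (pair_pmf (replicate_pmf n (embed_pmf (xy_prob \<alpha>))) (pair_pmf (rand_A p) (rand_B p)))"
proof -
  let ?E = "embed_pmf (xy_prob \<alpha>)"
  have src: "replicate_pmf n (horodecki_source \<alpha>) =
    map_pmf (map (\<lambda>(x, y). (x, y, if x = y then None else Some (x, y)))) (replicate_pmf n ?E)"
    by (simp add: horodecki_source_def map_replicate_pmf)
  have maps: "map (\<lambda>(x, y, z). x) (map (\<lambda>(x, y). (x, y, if x = y then None else Some (x, y))) v) = map fst v"
    "map (\<lambda>(x, y, z). y) (map (\<lambda>(x, y). (x, y, if x = y then None else Some (x, y))) v) = map snd v"
    "map (\<lambda>(x, y, z). z) (map (\<lambda>(x, y). (x, y, if x = y then None else Some (x, y))) v) = map eve_letter v" for v :: "(nat \<times> nat) list"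
    by (auto simp: eve_letter_def)
  show ?thesis
    unfolding padded_run_def run_def src bind_map_pmf maps Let_def
    by (simp add: pair_pmf_def map_pmf_def bind_assoc_pmf bind_return_pmf outcome_def Let_def)
qed

lemma set_xy: "set_pmf (replicate_pmf n (embed_pmf (xy_prob \<alpha>))) \<subseteq> pair_words n"
proof -
  have "set_pmf (embed_pmf (xy_prob \<alpha>)) \<subseteq> {..<3} \<times> {..<3}"
    unfolding set_pmf_eq pmf_xy[OF \<alpha>] by (auto simp: xy_prob_def split: if_splits)
  then show ?thesis by (auto simp: set_replicate_pmf pair_words_def)
qed

lemma finite_padded_run: "finite (set_pmf padded_run)"
  unfolding padded_run_eq using finite_rand finite_subset[OF set_xy finite_pair_words] by simp

lemma pmf_padded_run:
  "pmf padded_run (ka, kb, zs, f) = prod_list (map (letter_prob \<alpha>) zs) * coef (ka, kb, zs, f)"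
proof -
  let ?R = "replicate_pmf n (embed_pmf (xy_prob \<alpha>))" and ?\<tau> = "(ka, kb, zs, f)"
  let ?T = "set_pmf (rand_A p) \<times> set_pmf (rand_B p)"
  let ?g = "\<lambda>z. if (case z of (v, ra, rb) \<Rightarrow> outcome v ra rb) = ?\<tau> then pmf (pair_pmf ?R (pair_pmf (rand_A p) (rand_B p))) z else 0"
  have finR: "finite (set_pmf ?R)" by (rule finite_subset[OF set_xy finite_pair_words])
  have "pmf padded_run ?\<tau> = (\<Sum>z\<in>set_pmf ?R \<times> ?T. ?g z)"
    unfolding padded_run_eq using finR finite_rand by (subst pmf_map_sum) auto
  also have "\<dots> = (\<Sum>z\<in>pair_words n \<times> ?T. ?g z)"
    using finite_rand set_xy finite_pair_words by (intro sum.mono_neutral_left) (auto simp: pmf_pair set_pmf_iff)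
  also have "\<dots> = (\<Sum>v\<in>pair_words n. \<Sum>ra\<in>set_pmf (rand_A p). \<Sum>rb\<in>set_pmf (rand_B p). ?g (v, ra, rb))"
    by (simp only: sum.cartesian_product')
  also have "\<dots> = (\<Sum>v\<in>pair_words n. \<Sum>ra\<in>set_pmf (rand_A p). \<Sum>rb\<in>set_pmf (rand_B p).
     prod_list (map (letter_prob \<alpha>) zs) * (if outcome v ra rb = ?\<tau> then pmf (rand_A p) ra * pmf (rand_B p) rb else 0))"
  proof (intro sum.cong refl)
    fix v ra rb assume v: "v \<in> pair_words n"
    have "pmf ?R v = prod_list (map (letter_prob \<alpha>) (map eve_letter v))"
    proof -
      have "pmf ?R v = prod_list (map (xy_prob \<alpha>) v)"
        using v by (subst pmf_replicate_pmf) (simp_all add: pair_words_def pmf_xy[OF \<alpha>])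
      also have "map (xy_prob \<alpha>) v = map (letter_prob \<alpha>) (map eve_letter v)"
        using v letter_prob_eve_letter[of _ \<alpha>] by (auto simp: pair_words_def subset_iff)
      finally show ?thesis .
    qed
    moreover have "map eve_letter v = zs" if "outcome v ra rb = ?\<tau>"
      using that by (simp add: outcome_def Let_def)
    ultimately show "?g (v, ra, rb) = prod_list (map (letter_prob \<alpha>) zs) *
      (if outcome v ra rb = ?\<tau> then pmf (rand_A p) ra * pmf (rand_B p) rb else 0)"
      by (auto simp: pmf_pair)
  qed
  finally show ?thesis by (simp add: coef_def sum_distrib_left)
qed

abbreviation "sim \<equiv> simulation 3 3 n M p"
abbreviation "\<rho> \<equiv> proj (copies n \<Psi>)"

text \<open>By \<open>copies_eq\<close>, source words with the same Eve word leave Eve in the same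
  vector. Given keys and transcript, her state is therefore a combination of the projectors on her
  product vectors, with the classical weights \<open>coef\<close>.\<close>

lemma final_state_eq:
  assumes f: "f \<in> words M (crounds p + 2)" and e: "e \<in> words dE n" "e' \<in> words dE n"
  shows "final_state sim \<rho> (ka, kb, e, f) (ka', kb', e', f') =
    (if ka = ka' \<and> kb = kb' \<and> f = f' then
       \<Sum>zs\<in>letter_words n. complex_of_real (coef (ka, kb, zs, f)) * eve_word zs e * cnj (eve_word zs e') else 0)"
proof (cases "ka = ka' \<and> kb = kb' \<and> f = f'")
  case True
  have len: "length f = crounds p + 2" using f by (simp add: words_def)
  then have regs: "reg_A sim f = seeded (rand_A p) 3 n" "reg_B sim f = seeded (rand_B p) 3 n"
    by (auto simp: simulation_def)
  have meas: "meas_A sim = key_effect (key_A p)" "meas_B sim = key_effect (key_B p)"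
    by (simp_all add: simulation_def)
  have fin: "finite (seeded (rand_A p) 3 n)" "finite (seeded (rand_B p) 3 n)"
    by (intro finite_seeded finite_rand)+
  define ps where "ps a b = post_state sim \<rho> f (a, b, e) (a, b, e')" for a b
  define A where "A a \<longleftrightarrow> key_A p (tl a) (hd a) (core f) = ka" for a
  define B where "B b \<longleftrightarrow> key_B p (tl b) (hd b) (core f) = kb" for b
  have "final_state sim \<rho> (ka, kb, e, f) (ka', kb', e', f') =
    (\<Sum>a\<in>seeded (rand_A p) 3 n. \<Sum>a'\<in>seeded (rand_A p) 3 n. \<Sum>b\<in>seeded (rand_B p) 3 n. \<Sum>b'\<in>seeded (rand_B p) 3 n.
       key_effect (key_A p) f ka a' a * key_effect (key_B p) f kb b' b * post_state sim \<rho> f (a, b, e) (a', b', e'))"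
    unfolding final_state_def prod.case if_P[OF True] meas regs by (rule refl)
  also have "\<dots> = (\<Sum>a\<in>seeded (rand_A p) 3 n. \<Sum>a'\<in>seeded (rand_A p) 3 n. if a' = a then
      (\<Sum>b\<in>seeded (rand_B p) 3 n. \<Sum>b'\<in>seeded (rand_B p) 3 n. if b' = b then (if A a \<and> B b then ps a b else 0) else 0) else 0)"
  proof (intro sum.cong refl)
    fix a a'
    have e: "key_effect (key_A p) f ka a' a * key_effect (key_B p) f kb b' b * post_state sim \<rho> f (a, b, e) (a', b', e') =
      (if a' = a then if b' = b then if A a \<and> B b then ps a b else 0 else 0 else 0)" for b b'
      by (auto simp: key_effect_def A_def B_def ps_def)
    show "(\<Sum>b\<in>seeded (rand_B p) 3 n. \<Sum>b'\<in>seeded (rand_B p) 3 n.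
        key_effect (key_A p) f ka a' a * key_effect (key_B p) f kb b' b * post_state sim \<rho> f (a, b, e) (a', b', e')) =
      (if a' = a then (\<Sum>b\<in>seeded (rand_B p) 3 n. \<Sum>b'\<in>seeded (rand_B p) 3 n.
        if b' = b then (if A a \<and> B b then ps a b else 0) else 0) else 0)"
      unfolding e by (cases "a' = a") simp_all
  qed
  also have "\<dots> = (\<Sum>a\<in>seeded (rand_A p) 3 n. \<Sum>b\<in>seeded (rand_B p) 3 n. if A a \<and> B b then ps a b else 0)"
    using fin by (simp add: sum.delta)
  also have "\<dots> = (\<Sum>ra\<in>set_pmf (rand_A p). \<Sum>xs\<in>words 3 n. \<Sum>rb\<in>set_pmf (rand_B p). \<Sum>ys\<in>words 3 n.
      if A (ra # xs) \<and> B (rb # ys) then ps (ra # xs) (rb # ys) else 0)"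
    by (simp only: sum_seeded)
  also have "\<dots> = (\<Sum>ra\<in>set_pmf (rand_A p). \<Sum>rb\<in>set_pmf (rand_B p). \<Sum>xs\<in>words 3 n. \<Sum>ys\<in>words 3 n.
      if A (ra # xs) \<and> B (rb # ys) then ps (ra # xs) (rb # ys) else 0)"
    by (intro sum.cong refl) (rule sum.swap)
  also have "\<dots> = (\<Sum>ra\<in>set_pmf (rand_A p). \<Sum>rb\<in>set_pmf (rand_B p). \<Sum>v\<in>pair_words n.
      if A (ra # map fst v) \<and> B (rb # map snd v) then ps (ra # map fst v) (rb # map snd v) else 0)"
    by (simp only: sum_words_pair)
  also have "\<dots> = (\<Sum>ra\<in>set_pmf (rand_A p). \<Sum>rb\<in>set_pmf (rand_B p). \<Sum>v\<in>pair_words n. \<Sum>zs\<in>letter_words n.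
      complex_of_real (if outcome v ra rb = (ka, kb, zs, f) then pmf (rand_A p) ra * pmf (rand_B p) rb else 0) * (eve_word zs e * cnj (eve_word zs e')))"
  proof (intro sum.cong refl)
    fix ra rb v assume r: "ra \<in> set_pmf (rand_A p)" "rb \<in> set_pmf (rand_B p)" and v: "v \<in> pair_words n"
    let ?tr = "transcript p (map fst v) ra (map snd v) rb"
    let ?c = "complex_of_real (pmf (rand_A p) ra * pmf (rand_B p) rb)"
    let ?z = "map eve_letter v"
    have w: "map fst v \<in> words 3 n" "map snd v \<in> words 3 n" using v by (auto simp: pair_words_def words_def)
    have rho: "\<rho> (map fst v, map snd v, e) (map fst v, map snd v, e') = eve_word ?z e * cnj (eve_word ?z e')"
      using v e by (simp add: proj_def copies_eq pair_words_def)
    have "ps (ra # map fst v) (rb # map snd v) = (if f = ?tr (crounds p) @ [0, 0]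
       then ?c * (eve_word ?z e * cnj (eve_word ?z e')) else 0)"
      unfolding ps_def rho[symmetric]
      using post_state_simulation[OF valid M bound[OF w r] r(1) w(1) r(2) w(2) order_refl len] .
    then have "(if A (ra # map fst v) \<and> B (rb # map snd v) then ps (ra # map fst v) (rb # map snd v) else 0) =
      (if outcome v ra rb = (ka, kb, ?z, f) then ?c * (eve_word ?z e * cnj (eve_word ?z e')) else 0)"
      by (auto simp: A_def B_def outcome_def Let_def core_append)
    also have "\<dots> = (\<Sum>zs\<in>letter_words n. if zs = ?z then
        (if outcome v ra rb = (ka, kb, ?z, f) then ?c * (eve_word ?z e * cnj (eve_word ?z e')) else 0) else 0)"
      using pair_words_letters[OF v] finite_letter_words by (simp add: sum.delta letter_words_def)
    also have "\<dots> = (\<Sum>zs\<in>letter_words n. complex_of_real (if outcome v ra rb = (ka, kb, zs, f)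
        then pmf (rand_A p) ra * pmf (rand_B p) rb else 0) * (eve_word zs e * cnj (eve_word zs e')))"
      by (intro sum.cong refl) (auto simp: outcome_def Let_def)
    finally show "(if A (ra # map fst v) \<and> B (rb # map snd v) then ps (ra # map fst v) (rb # map snd v) else 0) =
      (\<Sum>zs\<in>letter_words n. complex_of_real (if outcome v ra rb = (ka, kb, zs, f)
        then pmf (rand_A p) ra * pmf (rand_B p) rb else 0) * (eve_word zs e * cnj (eve_word zs e')))" .
  qed
  also have "\<dots> = (\<Sum>zs\<in>letter_words n. \<Sum>v\<in>pair_words n. \<Sum>ra\<in>set_pmf (rand_A p). \<Sum>rb\<in>set_pmf (rand_B p).
      complex_of_real (if outcome v ra rb = (ka, kb, zs, f) then pmf (rand_A p) ra * pmf (rand_B p) rb else 0) * (eve_word zs e * cnj (eve_word zs e')))"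
    (is "(\<Sum>ra\<in>?X. \<Sum>rb\<in>?Y. \<Sum>v\<in>?V. \<Sum>zs\<in>?Z. ?h ra rb v zs) = _")
  proof -
    have "(\<Sum>ra\<in>?X. \<Sum>rb\<in>?Y. \<Sum>v\<in>?V. \<Sum>zs\<in>?Z. ?h ra rb v zs) = (\<Sum>ra\<in>?X. \<Sum>rb\<in>?Y. \<Sum>zs\<in>?Z. \<Sum>v\<in>?V. ?h ra rb v zs)"
      by (intro sum.cong refl) (rule sum.swap)
    also have "\<dots> = (\<Sum>ra\<in>?X. \<Sum>zs\<in>?Z. \<Sum>rb\<in>?Y. \<Sum>v\<in>?V. ?h ra rb v zs)"
      by (intro sum.cong refl) (rule sum.swap)
    also have "\<dots> = (\<Sum>zs\<in>?Z. \<Sum>ra\<in>?X. \<Sum>rb\<in>?Y. \<Sum>v\<in>?V. ?h ra rb v zs)" by (rule sum.swap)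
    also have "\<dots> = (\<Sum>zs\<in>?Z. \<Sum>ra\<in>?X. \<Sum>v\<in>?V. \<Sum>rb\<in>?Y. ?h ra rb v zs)"
      by (intro sum.cong refl) (rule sum.swap)
    also have "\<dots> = (\<Sum>zs\<in>?Z. \<Sum>v\<in>?V. \<Sum>ra\<in>?X. \<Sum>rb\<in>?Y. ?h ra rb v zs)"
      by (intro sum.cong refl) (rule sum.swap)
    finally show ?thesis .
  qed
  also have "\<dots> = (\<Sum>zs\<in>letter_words n. complex_of_real (coef (ka, kb, zs, f)) * eve_word zs e * cnj (eve_word zs e'))"
    unfolding coef_def of_real_sum sum_distrib_right by (simp only: mult.assoc)
  finally show ?thesis using True by simp
next
  case False
  then show ?thesis by (auto simp: final_state_def)
qed

definition ideal_coef :: "nat \<times> nat \<times> (nat \<times> nat) option list \<times> nat list \<Rightarrow> real" where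
  "ideal_coef = (\<lambda>(ka, kb, zs, f). if ka = kb then (\<Sum>k<ckeys p. \<Sum>l<ckeys p. coef (k, l, zs, f)) / ckeys p else 0)"

lemma ideal_state_eq:
  assumes f: "f \<in> words M (crounds p + 2)" and e: "e \<in> words dE n" "e' \<in> words dE n"
  shows "ideal_state sim \<rho> (ka, kb, e, f) (ka', kb', e', f') =
    (if ka = ka' \<and> kb = kb' \<and> f = f' then
       \<Sum>zs\<in>letter_words n. complex_of_real (ideal_coef (ka, kb, zs, f)) * eve_word zs e * cnj (eve_word zs e') else 0)"
proof -
  let ?h = "\<lambda>zs. eve_word zs e * cnj (eve_word zs e')"
  have K: "qkeys sim = ckeys p" by (simp add: simulation_def)
  have total: "(\<Sum>k<ckeys p. \<Sum>l<ckeys p. final_state sim \<rho> (k, l, e, f) (k, l, e', f')) =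
    (if f = f' then (\<Sum>zs\<in>letter_words n. complex_of_real (\<Sum>k<ckeys p. \<Sum>l<ckeys p. coef (k, l, zs, f)) * ?h zs) else 0)"
  proof -
    have "(\<Sum>k<ckeys p. \<Sum>l<ckeys p. \<Sum>zs\<in>letter_words n. complex_of_real (coef (k, l, zs, f)) * ?h zs) =
      (\<Sum>k<ckeys p. \<Sum>zs\<in>letter_words n. \<Sum>l<ckeys p. complex_of_real (coef (k, l, zs, f)) * ?h zs)"
      by (intro sum.cong refl) (rule sum.swap)
    also have "\<dots> = (\<Sum>zs\<in>letter_words n. \<Sum>k<ckeys p. \<Sum>l<ckeys p. complex_of_real (coef (k, l, zs, f)) * ?h zs)"
      by (rule sum.swap)
    also have "\<dots> = (\<Sum>zs\<in>letter_words n. complex_of_real (\<Sum>k<ckeys p. \<Sum>l<ckeys p. coef (k, l, zs, f)) * ?h zs)"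
      by (simp only: of_real_sum sum_distrib_right)
    finally show ?thesis by (cases "f' = f") (simp_all add: final_state_eq[OF assms] mult.assoc)
  qed
  define S where "S zs = (\<Sum>k<ckeys p. \<Sum>l<ckeys p. coef (k, l, zs, f))" for zs
  have ideal: "ideal_coef (ka, kb, zs, f) = (if ka = kb then S zs / ckeys p else 0)" for ka kb zs
    by (simp add: ideal_coef_def S_def)
  show ?thesis
    unfolding ideal_state_def prod.case K total unfolding S_def[symmetric] ideal
    by (auto simp: sum_distrib_left mult.assoc sum_divide_distrib intro!: sum.cong)
qed

text \<open>The vectors \<open>eve_word zs\<close>, placed at the labels of keys and transcript, are
  orthogonal and diagonalise both states at once. Their squared norms restore the source
  probabilities, so the trace norm becomes an l1 distance of classical weights.\<close>

lemma trace_distance_eq: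
  "trace_distance (final_basis dE n sim) (final_state sim \<rho>) (ideal_state sim \<rho>) =
    (\<Sum>(ka, kb, zs, f)\<in>{..<ckeys p} \<times> {..<ckeys p} \<times> letter_words n \<times> words M (crounds p + 2).
       \<bar>pmf padded_run (ka, kb, zs, f) - (if ka = kb then
         (\<Sum>k<ckeys p. \<Sum>l<ckeys p. pmf padded_run (k, l, zs, f)) / ckeys p else 0)\<bar>) / 2"
proof -
  let ?K = "{..<ckeys p}" and ?F = "words M (crounds p + 2)"
  let ?T = "?K \<times> ?K \<times> letter_words n \<times> ?F" and ?I = "?K \<times> ?K \<times> words dE n \<times> ?F"
  define w where "w = (\<lambda>(ka :: nat, kb :: nat, zs, f :: nat list) (ka', kb', e, f'). if ka = ka' \<and> kb = kb' \<and> f = f' then eve_word zs e else (0 :: complex))"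
  define c where "c \<tau> = coef \<tau> - ideal_coef \<tau>" for \<tau>
  define \<nu> where "\<nu> = (\<lambda>(ka :: nat, kb :: nat, zs, f :: nat list). prod_list (map (letter_prob \<alpha>) zs))"
  have basis: "final_basis dE n sim = ?I" by (simp add: final_basis_def simulation_def)
  have "orthogonal_decomposition ?I ?T w \<nu> c (\<lambda>i j. final_state sim \<rho> i j - ideal_state sim \<rho> i j)"
  proof
    show "finite ?I" "finite ?T" by (simp_all add: finite_words finite_letter_words)
    fix \<tau> \<tau>' assume t: "\<tau> \<in> ?T" "\<tau>' \<in> ?T"
    obtain ka kb zs f where \<tau>: "\<tau> = (ka, kb, zs, f)" by (cases \<tau>)
    obtain ka' kb' zs' f' where \<tau>': "\<tau>' = (ka', kb', zs', f')" by (cases \<tau>')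
    have "inner_prod ?I (w \<tau>) (w \<tau>') = (\<Sum>i\<in>?I. if fst i = ka \<and> fst (snd i) = kb \<and> snd (snd (snd i)) = f then
       (if ka = ka' \<and> kb = kb' \<and> f = f' then cnj (eve_word zs (fst (snd (snd i)))) * eve_word zs' (fst (snd (snd i))) else 0) else 0)"
      unfolding inner_prod_def by (intro sum.cong refl) (auto simp: w_def \<tau> \<tau>')
    also have "\<dots> = (\<Sum>i\<in>(\<lambda>e. (ka, kb, e, f)) ` words dE n.
       (if ka = ka' \<and> kb = kb' \<and> f = f' then cnj (eve_word zs (fst (snd (snd i)))) * eve_word zs' (fst (snd (snd i))) else 0))"
      using t by (intro sum.mono_neutral_cong_right) (auto simp: finite_words \<tau>)
    also have "\<dots> = (if ka = ka' \<and> kb = kb' \<and> f = f' then inner_prod (words dE n) (eve_word zs) (eve_word zs') else 0)"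
      by (subst sum.reindex) (auto simp: inj_on_def inner_prod_def)
    also have "\<dots> = (if \<tau> = \<tau>' then complex_of_real (\<nu> \<tau>) else 0)"
      using t by (auto simp: eve_word_orthogonal letter_words_def \<tau> \<tau>' \<nu>_def)
    finally show "inner_prod ?I (w \<tau>) (w \<tau>') = (if \<tau> = \<tau>' then complex_of_real (\<nu> \<tau>) else 0)" .
  next
    fix i j assume ij: "i \<in> ?I" "j \<in> ?I"
    obtain ka kb e f where i: "i = (ka, kb, e, f)" by (cases i)
    obtain ka' kb' e' f' where j: "j = (ka', kb', e', f')" by (cases j)
    have mem: "f \<in> ?F" "e \<in> words dE n" "e' \<in> words dE n" using ij by (auto simp: i j)
    have "(\<Sum>\<tau>\<in>?T. complex_of_real (c \<tau>) * w \<tau> i * cnj (w \<tau> j)) = (\<Sum>\<tau>\<in>(\<lambda>zs. (ka, kb, zs, f)) ` letter_words n.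
       if ka = ka' \<and> kb = kb' \<and> f = f' then complex_of_real (c \<tau>) * eve_word (fst (snd (snd \<tau>))) e * cnj (eve_word (fst (snd (snd \<tau>))) e') else 0)"
      using ij by (intro sum.mono_neutral_cong_right) (auto simp: finite_words finite_letter_words i j w_def)
    also have "\<dots> = (if ka = ka' \<and> kb = kb' \<and> f = f' then
       (\<Sum>zs\<in>letter_words n. complex_of_real (c (ka, kb, zs, f)) * eve_word zs e * cnj (eve_word zs e')) else 0)"
      by (subst sum.reindex) (auto simp: inj_on_def)
    also have "\<dots> = final_state sim \<rho> i j - ideal_state sim \<rho> i j"
      unfolding i j final_state_eq[OF mem] ideal_state_eq[OF mem]
      by (simp add: c_def left_diff_distrib sum_subtractf)
    finally show "final_state sim \<rho> i j - ideal_state sim \<rho> i j = (\<Sum>\<tau>\<in>?T. complex_of_real (c \<tau>) * w \<tau> i * cnj (w \<tau> j))" ..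
  qed
  then have "trace_norm ?I (\<lambda>i j. final_state sim \<rho> i j - ideal_state sim \<rho> i j) = (\<Sum>\<tau>\<in>?T. \<bar>c \<tau>\<bar> * \<nu> \<tau>)"
    by (rule orthogonal_decomposition.trace_norm_eq)
  also have "\<dots> = (\<Sum>(ka, kb, zs, f)\<in>?T. \<bar>pmf padded_run (ka, kb, zs, f) - (if ka = kb then
         (\<Sum>k<ckeys p. \<Sum>l<ckeys p. pmf padded_run (k, l, zs, f)) / ckeys p else 0)\<bar>)"
  proof (intro sum.cong refl)
    fix \<tau> assume \<tau>: "\<tau> \<in> ?T"
    obtain ka kb zs f where \<tau>_eq: "\<tau> = (ka, kb, zs, f)" by (cases \<tau>)
    have "0 \<le> letter_prob \<alpha> z" for z
      using \<alpha> by (auto simp: letter_prob_def xy_prob_def split: option.splits)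
    then have q: "0 \<le> prod_list (map (letter_prob \<alpha>) zs)" by (intro prod_list_nonneg) auto
    have "\<bar>c \<tau>\<bar> * \<nu> \<tau> = \<bar>\<nu> \<tau> * coef \<tau> - \<nu> \<tau> * ideal_coef \<tau>\<bar>"
      using q by (simp add: c_def \<nu>_def \<tau>_eq abs_mult right_diff_distrib[symmetric] mult.commute)
    also have "\<nu> \<tau> * ideal_coef \<tau> = (if ka = kb then
         (\<Sum>k<ckeys p. \<Sum>l<ckeys p. pmf padded_run (k, l, zs, f)) / ckeys p else 0)"
      by (simp add: \<nu>_def ideal_coef_def \<tau>_eq pmf_padded_run sum_distrib_left)
    finally show "\<bar>c \<tau>\<bar> * \<nu> \<tau> = (case \<tau> of (ka, kb, zs, f) \<Rightarrow> \<bar>pmf padded_run (ka, kb, zs, f) - (if ka = kb then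
         (\<Sum>k<ckeys p. \<Sum>l<ckeys p. pmf padded_run (k, l, zs, f)) / ckeys p else 0)\<bar>)"
      by (simp add: \<tau>_eq pmf_padded_run \<nu>_def)
  qed
  finally show ?thesis unfolding trace_distance_def basis by simp
qed

end

section \<open>Distance from the ideal key\<close>

text \<open>A Pinsker-type inequality through the Bhattacharyya coefficient B. The relative entropy
  is at least 2 (1 - B) / ln 2, by ln t \<le> t - 1 at t = sqrt (Q / P), and Cauchy-Schwarz bounds
  the squared l1 distance by (2 - 2 B) (2 + 2 B). The constant is twice that of Pinsker's
  inequality, which is harmless in the limit.\<close>

lemma (in key_view) variational_distance_le:
  assumes D: "finite D" "Y ` set_pmf R \<subseteq> D"
  shows "(\<Sum>(k, y)\<in>{..<K} \<times> D. \<bar>pmf (map_pmf (\<lambda>w. (X w, Y w)) R) (k, y) - pmf (map_pmf Y R) y / K\<bar>)\<^sup>2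
    \<le> 4 * ln 2 * (log 2 K - shannon_entropy R X + mutual_inf R X Y)"
proof -
  let ?J = "{..<K} \<times> D" and ?g = "log 2 K - shannon_entropy R X + mutual_inf R X Y"
  define P where "P = pmf (map_pmf (\<lambda>w. (X w, Y w)) R)"
  define Q where "Q z = pmf (map_pmf Y R) (snd z) / K" for z :: "nat \<times> 'c"
  define B where "B = (\<Sum>z\<in>?J. sqrt (P z) * sqrt (Q z))"
  have nonneg: "0 \<le> P z" "0 \<le> Q z" for z by (simp_all add: P_def Q_def)
  have sumP: "sum P ?J = 1"
    unfolding P_def using fin D X by (intro sum_pmf_eq_1) auto
  have sumQ: "sum Q ?J = 1"
    using fin D K_pos sum_pmf_eq_1[of D "map_pmf Y R"]
    by (simp add: Q_def sum.cartesian_product' sum_divide_distrib[symmetric])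
  have pos: "0 < P (X w, Y w)" "0 < Q (X w, Y w)" if "w \<in> set_pmf R" for w
    using that K_pos prob_of_pos[OF that, of "\<lambda>w. (X w, Y w)"] prob_of_pos[OF that, of Y] by (auto simp: P_def Q_def)
  have ln_sqrt_ratio: "ln (sqrt a * sqrt b / a) = (ln b - ln a) / 2" if "0 < a" "0 < b" for a b :: real
  proof -
    have "ln (sqrt a * sqrt b / a) = ln (sqrt a * sqrt b) - ln a" using that by (intro ln_divide_pos) auto
    also have "ln (sqrt a * sqrt b) = ln (sqrt a) + ln (sqrt b)" using that by (intro ln_mult_pos) auto
    finally show ?thesis using that by (simp add: ln_sqrt)
  qed
  have "- ?g / 2 = expect R (\<lambda>w. - log 2 (K * prob_of R (\<lambda>w. (X w, Y w)) w / prob_of R Y w) / 2)"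
    unfolding gap_eq by simp
  also have "\<dots> = expect R (\<lambda>w. log 2 (sqrt (P (X w, Y w)) * sqrt (Q (X w, Y w)) / P (X w, Y w)))"
  proof (intro expect_cong)
    fix w assume w: "w \<in> set_pmf R"
    have "K * prob_of R (\<lambda>w. (X w, Y w)) w / prob_of R Y w = P (X w, Y w) / Q (X w, Y w)"
      by (simp add: P_def Q_def mult.commute)
    moreover have "- log 2 (P (X w, Y w) / Q (X w, Y w)) / 2 =
      log 2 (sqrt (P (X w, Y w)) * sqrt (Q (X w, Y w)) / P (X w, Y w))"
      using ln_sqrt_ratio[OF pos[OF w]] ln_div[of "P (X w, Y w)" "Q (X w, Y w)"] pos[OF w]
      by (simp add: log_def field_simps)
    ultimately show "- log 2 (K * prob_of R (\<lambda>w. (X w, Y w)) w / prob_of R Y w) / 2 =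
      log 2 (sqrt (P (X w, Y w)) * sqrt (Q (X w, Y w)) / P (X w, Y w))" by simp
  qed
  also have "\<dots> \<le> (expect R (\<lambda>w. sqrt (P (X w, Y w)) * sqrt (Q (X w, Y w)) / P (X w, Y w)) - 1) / ln 2"
    using pos by (intro expect_log_le fin) simp
  also have "expect R (\<lambda>w. sqrt (P (X w, Y w)) * sqrt (Q (X w, Y w)) / P (X w, Y w)) \<le> B"
    unfolding B_def using D X nonneg
      expect_inverse_prob_le[OF fin, of ?J "\<lambda>w. (X w, Y w)" "\<lambda>z. sqrt (P z) * sqrt (Q z)"]
    by (auto simp: P_def)
  finally have "- ?g / 2 \<le> (B - 1) / ln 2" by (simp add: divide_right_mono)
  then have hellinger: "2 * (1 - B) \<le> ln 2 * ?g" by (simp add: field_simps)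
  have squares: "(\<Sum>z\<in>?J. (sqrt (P z) - sqrt (Q z))\<^sup>2) = 2 - 2 * B" "(\<Sum>z\<in>?J. (sqrt (P z) + sqrt (Q z))\<^sup>2) = 2 + 2 * B"
    using nonneg by (simp_all add: power2_diff power2_sum sum.distrib sum_subtractf sumP sumQ B_def sum_distrib_left mult.assoc)
  have B: "0 \<le> 2 - 2 * B" unfolding squares(1)[symmetric] by (intro sum_nonneg) simp
  have "(\<Sum>z\<in>?J. \<bar>P z - Q z\<bar>)\<^sup>2 = (\<Sum>z\<in>?J. \<bar>sqrt (P z) - sqrt (Q z)\<bar> * (sqrt (P z) + sqrt (Q z)))\<^sup>2"
  proof -
    have "\<bar>P z - Q z\<bar> = \<bar>sqrt (P z) - sqrt (Q z)\<bar> * (sqrt (P z) + sqrt (Q z))" for z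
    proof -
      have "P z - Q z = (sqrt (P z) - sqrt (Q z)) * (sqrt (P z) + sqrt (Q z))"
        using nonneg by (simp add: algebra_simps)
      then show ?thesis using nonneg by (simp only: abs_mult) simp
    qed
    then show ?thesis by simp
  qed
  also have "\<dots> \<le> (2 - 2 * B) * (2 + 2 * B)"
    unfolding squares[symmetric]
    using Cauchy_Schwarz_ineq_sum[of "\<lambda>z. \<bar>sqrt (P z) - sqrt (Q z)\<bar>" "\<lambda>z. sqrt (P z) + sqrt (Q z)" ?J] by simp
  also have "\<dots> \<le> (2 - 2 * B) * 4" using B by (intro mult_left_mono) auto
  also have "\<dots> \<le> 4 * ln 2 * ?g" using hellinger by simp
  finally show ?thesis by (simp add: P_def Q_def case_prod_unfold)
qed

locale key_pair =
  fixes R :: "(nat \<times> nat \<times> 'c :: countable) pmf" and K :: nat and D :: "'c set"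
  assumes fin: "finite (set_pmf R)" and finD: "finite D" and sub: "set_pmf R \<subseteq> {..<K} \<times> {..<K} \<times> D"
begin

abbreviation "gap \<equiv> log 2 K - shannon_entropy R (\<lambda>(k, l, y). k) + mutual_inf R (\<lambda>(k, l, y). k) (\<lambda>(k, l, y). y)"

lemma key_view_first: "key_view R (\<lambda>(k, l, y). k) K"
  using fin sub by unfold_locales auto

lemma marginal: "pmf (map_pmf (\<lambda>(k, l, y). h k l y) R) z =
  (\<Sum>k<K. \<Sum>l<K. \<Sum>y\<in>D. if h k l y = z then pmf R (k, l, y) else 0)"
proof -
  have "pmf (map_pmf (\<lambda>(k, l, y). h k l y) R) z =
    (\<Sum>w\<in>{..<K} \<times> {..<K} \<times> D. if (case w of (k, l, y) \<Rightarrow> h k l y) = z then pmf R w else 0)"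
    unfolding pmf_map_sum[OF fin] using sub finD by (intro sum.mono_neutral_left) (auto simp: set_pmf_iff)
  then show ?thesis by (simp add: sum.cartesian_product')
qed

text \<open>Moving the mass of disagreeing keys onto the diagonal costs at most twice that mass.
  What remains is the distance of Alice's key from a uniform key independent of Eve's view.\<close>

lemma distance_to_ideal_le:
  "(\<Sum>(k, l, y)\<in>{..<K} \<times> {..<K} \<times> D. \<bar>pmf R (k, l, y) - (if k = l then (\<Sum>k<K. \<Sum>l<K. pmf R (k, l, y)) / K else 0)\<bar>)
    \<le> 2 * measure_pmf.prob R {(k, l, y). k \<noteq> l} + 2 * sqrt (ln 2 * gap)"
proof -
  let ?X = "\<lambda>(k, l, y). k" and ?Y = "\<lambda>(k, l, y). y"
  define P where "P k y = pmf (map_pmf (\<lambda>w. (?X w, ?Y w)) R) (k, y)" for k y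
  define Q where "Q y = pmf (map_pmf ?Y R) y / K" for y
  define e where "e k y = (\<Sum>l<K. if k \<noteq> l then pmf R (k, l, y) else 0)" for k y
  have Q: "(\<Sum>k<K. \<Sum>l<K. pmf R (k, l, y)) / K = Q y" if "y \<in> D" for y
    using that finD by (simp add: Q_def marginal sum.delta)
  have P: "P k y = (\<Sum>l<K. pmf R (k, l, y))" if "y \<in> D" "k < K" for k y
  proof -
    have "P k y = pmf (map_pmf (\<lambda>(k, l, y). (k, y)) R) (k, y)" by (simp add: P_def case_prod_unfold)
    also have "\<dots> = (\<Sum>k'<K. \<Sum>l<K. \<Sum>y'\<in>D. if k' = k then if y' = y then pmf R (k, l, y) else 0 else 0)"
      unfolding marginal by (intro sum.cong refl) auto
    also have "\<dots> = (\<Sum>k'<K. if k' = k then \<Sum>l<K. pmf R (k, l, y) else 0)"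
      using that finD by (intro sum.cong refl) (simp add: sum.delta)
    finally show ?thesis using that by (simp add: sum.delta)
  qed
  have split: "P k y = pmf R (k, k, y) + e k y" if "y \<in> D" "k < K" for k y
  proof -
    have "(\<Sum>l<K. pmf R (k, l, y)) = (\<Sum>l<K. (if l = k then pmf R (k, k, y) else 0) + (if k \<noteq> l then pmf R (k, l, y) else 0))"
      by (intro sum.cong) auto
    then show ?thesis using that by (simp add: P sum.distrib e_def sum.delta)
  qed
  have "(\<Sum>(k, l, y)\<in>{..<K} \<times> {..<K} \<times> D. \<bar>pmf R (k, l, y) - (if k = l then (\<Sum>k<K. \<Sum>l<K. pmf R (k, l, y)) / K else 0)\<bar>)
    = (\<Sum>k<K. \<Sum>l<K. \<Sum>y\<in>D. \<bar>pmf R (k, l, y) - (if k = l then Q y else 0)\<bar>)"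
    unfolding sum.cartesian_product' prod.case by (intro sum.cong refl) (auto simp: Q)
  also have "\<dots> = (\<Sum>k<K. \<Sum>y\<in>D. \<Sum>l<K. \<bar>pmf R (k, l, y) - (if k = l then Q y else 0)\<bar>)"
    by (intro sum.cong refl) (rule sum.swap)
  also have "\<dots> \<le> (\<Sum>k<K. \<Sum>y\<in>D. 2 * e k y + \<bar>P k y - Q y\<bar>)"
  proof (intro sum_mono)
    fix k y assume k: "k \<in> {..<K}" and y: "y \<in> D"
    have "(\<Sum>l<K. \<bar>pmf R (k, l, y) - (if k = l then Q y else 0)\<bar>) =
      (\<Sum>l<K. (if l = k then \<bar>pmf R (k, k, y) - Q y\<bar> else 0) + (if k \<noteq> l then pmf R (k, l, y) else 0))"
      by (intro sum.cong) auto
    also have "\<dots> = \<bar>pmf R (k, k, y) - Q y\<bar> + e k y" using k by (simp add: sum.distrib e_def sum.delta)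
    also have "\<dots> \<le> 2 * e k y + \<bar>P k y - Q y\<bar>"
    proof -
      have "0 \<le> e k y" unfolding e_def by (intro sum_nonneg) simp
      then show ?thesis using split[OF y, of k] k by simp
    qed
    finally show "(\<Sum>l<K. \<bar>pmf R (k, l, y) - (if k = l then Q y else 0)\<bar>) \<le> 2 * e k y + \<bar>P k y - Q y\<bar>" .
  qed
  also have "\<dots> = 2 * (\<Sum>k<K. \<Sum>y\<in>D. e k y) + (\<Sum>(k, y)\<in>{..<K} \<times> D. \<bar>P k y - Q y\<bar>)"
    by (simp add: sum.distrib sum_distrib_left sum.cartesian_product')
  also have "(\<Sum>k<K. \<Sum>y\<in>D. e k y) = measure_pmf.prob R {(k, l, y). k \<noteq> l}"
  proof -
    have "measure_pmf.prob R {(k, l, y). k \<noteq> l} = pmf (map_pmf (\<lambda>(k, l, y). k \<noteq> l) R) True"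
      by (simp add: pmf_map vimage_def case_prod_unfold)
    also have "\<dots> = (\<Sum>k<K. \<Sum>l<K. \<Sum>y\<in>D. if k \<noteq> l then pmf R (k, l, y) else 0)"
      unfolding marginal by simp
    also have "\<dots> = (\<Sum>k<K. \<Sum>y\<in>D. e k y)"
      unfolding e_def by (intro sum.cong refl) (rule sum.swap)
    finally show ?thesis ..
  qed
  also have "(\<Sum>(k, y)\<in>{..<K} \<times> D. \<bar>P k y - Q y\<bar>) \<le> 2 * sqrt (ln 2 * gap)"
  proof -
    have "(\<Sum>(k, y)\<in>{..<K} \<times> D. \<bar>P k y - Q y\<bar>)\<^sup>2 \<le> 4 * ln 2 * gap"
      unfolding P_def Q_def
      using finD sub by (intro key_view.variational_distance_le[OF key_view_first]) auto
    then have "(\<Sum>(k, y)\<in>{..<K} \<times> D. \<bar>P k y - Q y\<bar>) \<le> sqrt (4 * (ln 2 * gap))"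
      by (intro real_le_rsqrt) (simp add: mult.assoc)
    then show ?thesis by (simp only: real_sqrt_mult) simp
  qed
  finally show ?thesis by simp
qed

end

text \<open>The gap depends only on the partitions induced by the views. Appending the constant
  sampling messages to the transcript is injective and leaves it unchanged.\<close>

lemma gap_map_inj:
  fixes R :: "'w pmf" and X :: "'v \<Rightarrow> nat" and Y :: "'v \<Rightarrow> 'c :: countable" and X' :: "'w \<Rightarrow> nat" and Y' :: "'w \<Rightarrow> 'd :: countable"
  assumes view: "key_view R X' K" and X: "\<And>w. X (h w) = X' w" and Y: "\<And>w. Y (h w) = g (Y' w)" and g: "inj g"
  shows "log 2 K - shannon_entropy (map_pmf h R) X + mutual_inf (map_pmf h R) X Y =
    log 2 K - shannon_entropy R X' + mutual_inf R X' Y'"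
proof -
  interpret R: key_view R X' Y' K by (rule view)
  interpret S: key_view "map_pmf h R" X Y K using R.fin R.X X by unfold_locales auto
  show ?thesis
    unfolding R.gap_eq S.gap_eq integral_map_pmf map_pmf_comp
  proof (intro expect_cong)
    fix w assume "w \<in> set_pmf R"
    have "prob_of R (\<lambda>w. (X (h w), Y (h w))) w = prob_of R (\<lambda>w. (X' w, Y' w)) w"
      "prob_of R (\<lambda>w. Y (h w)) w = prob_of R Y' w"
      by (intro prob_of_cong[OF R.fin]; simp add: X Y inj_eq[OF g])+
    then show "log 2 (K * prob_of R (\<lambda>w. (X (h w), Y (h w))) w / prob_of R (\<lambda>w. Y (h w)) w) =
      log 2 (K * prob_of R (\<lambda>w. (X' w, Y' w)) w / prob_of R Y' w)" by simp
  qed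
qed

section \<open>Trace distance of a simulated run in terms of the classical defects\<close>

context simulated_run
begin

lemma set_padded_run:
  "set_pmf padded_run \<subseteq> {..<ckeys p} \<times> {..<ckeys p} \<times> letter_words n \<times> words M (crounds p + 2)"
proof
  fix \<tau> assume "\<tau> \<in> set_pmf padded_run"
  then obtain v ra rb where v: "v \<in> pair_words n" and r: "ra \<in> set_pmf (rand_A p)" "rb \<in> set_pmf (rand_B p)"
    and \<tau>: "\<tau> = outcome v ra rb"
    unfolding padded_run_eq using set_xy by auto
  have w: "map fst v \<in> words 3 n" "map snd v \<in> words 3 n" using v by (auto simp: pair_words_def words_def)
  show "\<tau> \<in> {..<ckeys p} \<times> {..<ckeys p} \<times> letter_words n \<times> words M (crounds p + 2)"
    using bound[OF w r order_refl] valid M pair_words_letters[OF v]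
    by (simp add: \<tau> outcome_def Let_def valid_key_protocol_def letter_words_def words_def)
qed

lemma trace_distance_le:
  defines "R \<equiv> run (horodecki_source \<alpha>) n p"
  shows "trace_distance (final_basis dE n sim) (final_state sim \<rho>) (ideal_state sim \<rho>) \<le>
    1 - measure_pmf.prob R {(ka, kb, zs, f). ka = kb} +
    sqrt (ln 2 * (log 2 (ckeys p) - shannon_entropy R (\<lambda>(ka, kb, zs, f). ka)
      + mutual_inf R (\<lambda>(ka, kb, zs, f). ka) (\<lambda>(ka, kb, zs, f). (zs, f))))"
proof -
  define h where "h = (\<lambda>(ka :: nat, kb :: nat, zs :: (nat \<times> nat) option list, f). (ka, kb, zs, f @ [0, 0 :: nat]))"
  have pad: "padded_run = map_pmf h R" by (simp add: padded_run_def h_def R_def)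
  interpret key_pair padded_run "ckeys p" "letter_words n \<times> words M (crounds p + 2)"
    using finite_padded_run set_padded_run finite_letter_words finite_words by unfold_locales auto
  have finR: "finite (set_pmf R)"
  proof (rule finite_imageD)
    show "finite (h ` set_pmf R)" using finite_padded_run by (simp add: pad)
    show "inj_on h (set_pmf R)" by (auto simp: inj_on_def h_def)
  qed
  have view: "key_view R (\<lambda>(ka, kb, zs, f). ka) (ckeys p)"
  proof
    fix w assume "w \<in> set_pmf R"
    then have "h w \<in> set_pmf padded_run" by (simp add: pad)
    then show "(case w of (ka, kb, zs, f) \<Rightarrow> ka) < ckeys p" using set_padded_run by (cases w) (auto simp: h_def)
  qed (rule finR)
  have gap: "gap = log 2 (ckeys p) - shannon_entropy R (\<lambda>(ka, kb, zs, f). ka)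
      + mutual_inf R (\<lambda>(ka, kb, zs, f). ka) (\<lambda>(ka, kb, zs, f). (zs, f))"
    unfolding pad by (rule gap_map_inj[OF view, where g = "\<lambda>(zs, f). (zs, f @ [0, 0])"]) (auto simp: h_def inj_def)
  have "measure_pmf.prob padded_run {(k, l, y). k \<noteq> l} = measure_pmf.prob R (UNIV - {(ka, kb, zs, f). ka = kb})"
    unfolding pad measure_map_pmf by (rule arg_cong[where f = "measure_pmf.prob R"]) (auto simp: h_def)
  also have "\<dots> = 1 - measure_pmf.prob R {(ka, kb, zs, f). ka = kb}"
    using measure_pmf.prob_compl[of "{(ka, kb, zs, f). ka = kb}" R] by simp
  finally have error: "measure_pmf.prob padded_run {(k, l, y). k \<noteq> l} = 1 - measure_pmf.prob R {(ka, kb, zs, f). ka = kb}" .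
  show ?thesis
    using distance_to_ideal_le unfolding trace_distance_eq error gap by (simp add: case_prod_unfold cong: if_cong)
qed

lemma trace_distance_nonneg: "0 \<le> trace_distance (final_basis dE n sim) (final_state sim \<rho>) (ideal_state sim \<rho>)"
  unfolding trace_distance_eq by (intro divide_nonneg_pos sum_nonneg) auto

end

text \<open>The quantum protocol needs a finite message alphabet, while classical messages are
  arbitrary natural numbers. Finite randomness and finitely many words leave finitely many
  transcripts.\<close>

lemma transcripts_bounded:
  assumes "valid_key_protocol p"
  obtains M where "0 < M" "\<And>xs ys ra rb k. xs \<in> words d n \<Longrightarrow> ys \<in> words d' n \<Longrightarrow> ra \<in> set_pmf (rand_A p) \<Longrightarrow>
      rb \<in> set_pmf (rand_B p) \<Longrightarrow> k \<le> crounds p \<Longrightarrow> set (transcript p xs ra ys rb k) \<subseteq> {..<M}"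
proof -
  let ?S = "\<Union>xs\<in>words d n. \<Union>ys\<in>words d' n. \<Union>ra\<in>set_pmf (rand_A p). \<Union>rb\<in>set_pmf (rand_B p). \<Union>k\<in>{..crounds p}.
    set (transcript p xs ra ys rb k)"
  have "finite ?S" using assms by (auto simp: valid_key_protocol_def finite_words)
  then obtain m where m: "\<forall>i\<in>?S. i < m" using finite_nat_set_iff_bounded by blast
  show ?thesis
  proof (rule that[of "Suc m"])
    fix xs ys ra rb k assume *: "xs \<in> words d n" "ys \<in> words d' n" "ra \<in> set_pmf (rand_A p)" "rb \<in> set_pmf (rand_B p)" "k \<le> crounds p"
    show "set (transcript p xs ra ys rb k) \<subseteq> {..<Suc m}"
    proof
      fix i assume "i \<in> set (transcript p xs ra ys rb k)"
      then have "i \<in> ?S" using * by blast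
      then show "i \<in> {..<Suc m}" using m by (meson lessThan_iff less_SucI)
    qed
  qed simp
qed

text \<open>The simulation is built from the classical protocol alone and the purification enters
  only afterwards, as \<open>q_admissible\<close> demands one sequence of protocols that is secure
  against every purification.\<close>

theorem secret_key_rate_le_distillable_key:
  assumes \<alpha>: "2 \<le> \<alpha>" "\<alpha> \<le> 5"
  shows "secret_key_rate (horodecki_source \<alpha>) \<le> distillable_key 3 3 (horodecki_state \<alpha>)"
  unfolding secret_key_rate_def
proof (rule SUP_least)
  fix p assume "p \<in> {p. admissible (horodecki_source \<alpha>) p}"
  then have p: "admissible (horodecki_source \<alpha>) p" by simp
  let ?R = "\<lambda>n. run (horodecki_source \<alpha>) n (p n)"
  have valid: "valid_key_protocol (p n)" for n using p by (simp add: admissible_def)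
  have "\<exists>M>0. \<forall>xs\<in>words 3 n. \<forall>ys\<in>words 3 n. \<forall>ra\<in>set_pmf (rand_A (p n)). \<forall>rb\<in>set_pmf (rand_B (p n)). \<forall>k\<le>crounds (p n).
      set (transcript (p n) xs ra ys rb k) \<subseteq> {..<M}" for n
    by (rule transcripts_bounded[OF valid[of n], of 3 n 3]) blast
  then obtain M where M: "\<And>n. 0 < M n" "\<And>n. \<forall>xs\<in>words 3 n. \<forall>ys\<in>words 3 n. \<forall>ra\<in>set_pmf (rand_A (p n)).
      \<forall>rb\<in>set_pmf (rand_B (p n)). \<forall>k\<le>crounds (p n). set (transcript (p n) xs ra ys rb k) \<subseteq> {..<M n}"
    by metis
  let ?s = "\<lambda>n. simulation 3 3 n (M n) (p n)"
  have "q_admissible 3 3 (horodecki_state \<alpha>) ?s"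
    unfolding q_admissible_def Let_def
  proof (intro conjI allI impI)
    show "valid_locc 3 3 n (?s n)" for n by (rule valid_simulation[OF valid M(1)])
    fix dE \<Psi> assume pur: "purification 3 3 (horodecki_state \<alpha>) dE \<Psi>"
    have sr: "simulated_run \<alpha> dE \<Psi> (p n) n (M n)" for n
      using pur \<alpha> valid M by unfold_locales blast+
    have "(\<lambda>n. 1 - measure_pmf.prob (?R n) {(ka, kb, zs, f). ka = kb} +
        sqrt (ln 2 * (log 2 (ckeys (p n)) - shannon_entropy (?R n) (\<lambda>(ka, kb, zs, f). ka)
        + mutual_inf (?R n) (\<lambda>(ka, kb, zs, f). ka) (\<lambda>(ka, kb, zs, f). (zs, f))))) \<longlonglongrightarrow> 1 - 1 + sqrt (ln 2 * (0 + 0))"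
      using p unfolding admissible_def by (intro tendsto_intros) auto
    then have lim: "(\<lambda>n. 1 - measure_pmf.prob (?R n) {(ka, kb, zs, f). ka = kb} +
        sqrt (ln 2 * (log 2 (ckeys (p n)) - shannon_entropy (?R n) (\<lambda>(ka, kb, zs, f). ka)
        + mutual_inf (?R n) (\<lambda>(ka, kb, zs, f). ka) (\<lambda>(ka, kb, zs, f). (zs, f))))) \<longlonglongrightarrow> 0" by simp
    show "(\<lambda>n. trace_distance (final_basis dE n (?s n)) (final_state (?s n) (proj (copies n \<Psi>)))
        (ideal_state (?s n) (proj (copies n \<Psi>)))) \<longlonglongrightarrow> 0"
      by (rule tendsto_sandwich[OF always_eventually always_eventually tendsto_const lim])
        (use simulated_run.trace_distance_nonneg[OF sr] simulated_run.trace_distance_le[OF sr] in blast)+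
  qed
  then have "rate (\<lambda>n. qkeys (?s n)) \<le> distillable_key 3 3 (horodecki_state \<alpha>)"
    unfolding distillable_key_def by (intro SUP_upper) simp
  then show "rate (\<lambda>n. ckeys (p n)) \<le> distillable_key 3 3 (horodecki_state \<alpha>)"
    by (simp add: simulation_def)
qed

theorem corollary3:
  shows "(\<forall>\<alpha>::real. 3 < \<alpha> \<and> \<alpha> \<le> 5 \<longrightarrow>
            distillable_key 3 3 (horodecki_state \<alpha>) \<ge> secret_key_rate (horodecki_source \<alpha>) \<and>
            secret_key_rate (horodecki_source \<alpha>) > 0) \<and>
         (\<forall>\<alpha>::real. 3 < \<alpha> \<and> \<alpha> \<le> 4 \<longrightarrow> distillable_key 3 3 (horodecki_state \<alpha>) > 0)"
proof -
  have "secret_key_rate (horodecki_source \<alpha>) \<le> distillable_key 3 3 (horodecki_state \<alpha>)"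
    "0 < secret_key_rate (horodecki_source \<alpha>)" if "3 < \<alpha>" "\<alpha> \<le> 5" for \<alpha> :: real
    using that secret_key_rate_le_distillable_key[of \<alpha>] secret_key_rate_horodecki_source_pos[of \<alpha>] by simp_all
  then show ?thesis by (force intro: less_le_trans)
qed

end
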